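(* Fix $Ek>0$ and let $(\boldsymbol u,\boldsymbol B,P,T)$ be a smooth solution of the viscous inertialess model (see context). Suppose that the magnetic flux is exact. Let $3\le p\le\infty$ and $0<\gamma<1$. If at some instant of time the magnetic field is nontrivial and dynamo action occurs, i.e. $\frac{\mathrm d}{\mathrm dt}\left(\frac12\int_V|\boldsymbol B|^2\,\mathrm dV\right)\ge 0$, then at that instant $$ Ra\,A_p\,\|\nabla_{x,y}\overline T\|_{L^p}+Ra^2\,Ek^{1-\gamma}\,\|\nabla\nabla_{x,y}\overline T\|_{L^2}^2\ \ge\ \frac1{Rm} $$ or $$ 4\Lambda\int_V|\nabla\boldsymbol B|^2\,\mathrm dV\ \le\ Ek^\gamma . $$
   Context: Domain: $V=[0,L_x]\times[0,L_y]\times[0,1]$ with $L_x,L_y>0$; all fields are periodic in $x$ and $y$. $S_-=\{z=0\}$, $S_+=\{z=1\}$, $\boldsymbol n_\pm=\pm\boldsymbol e_z$. $L^p$ norms are over $V$. Viscous inertialess model, with positive parameters $Ek,\Lambda,Ra,Rm,Pe$ and heat source $Q=Q(\boldsymbol x)$: velocity $\boldsymbol u$, pressure $P$, magnetic field $\boldsymbol B$, temperature $T$ satisfy $$\boldsymbol e_z\times\boldsymbol u+\nabla P-Ek\nabla^2\boldsymbol u=\Lambda(\nabla\times\boldsymbol B)\times\boldsymbol B+Ra\,T\boldsymbol e_z,\quad\nabla\cdot\boldsymbol u=0,$$ $$\partial_t\boldsymbol B-\nabla\times(\boldsymbol u\times\boldsymbol B)=\tfrac1{Rm}\nabla^2\boldsymbol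 B,\quad\nabla\cdot\boldsymbol B=0,\quad \partial_tT+\nabla\cdot(\boldsymbol uT)=\tfrac1{Pe}\nabla^2T+\tfrac{Q}{Pe},$$ with boundary conditions on $S_\pm$: $\boldsymbol u\cdot\boldsymbol n_\pm=0$ (no penetration), $(\nabla\times\boldsymbol u)\times\boldsymbol n_\pm=0$ (stress-free), $\boldsymbol B\times\boldsymbol n_\pm=0$ (ferromagnetic), $T=T_\pm$ with $T_\pm$ constants (isothermal). Magnetic flux is exact if $\int_{S_\pm}\boldsymbol n_\pm\cdot\boldsymbol B\,\mathrm dS_\pm=0$. $\overline T(x,y,z)=\int_0^zT(x,y,z')\,\mathrm dz'$, $\nabla_{x,y}=(\partial_x,\partial_y)$, $\nabla$ is the full gradient. Constants: $\lambda_1=\min\{\pi,2\pi/L_x,2\pi/L_y\}$, $C_{\mathrm P}=1/\lambda_1$, $C_3=\frac{2^{2/3}}{\pi^{2/3}\sqrt3}$, $C_{\mathrm S}=2\sqrt2\,C_3\Big(1+\frac{\sqrt{1+L_x^{-2}+L_y^{-2}}}{\lambda_1}\Big)$, and $A_p=C_{\mathrm P}^{(p-3)/p}C_{\mathrm S}^{3/p}$ for $3\le p\le\infty$ (so $A_\infty=C_{\mathrm P}$). *)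

theory Defs
  imports "HOL-Analysis.Analysis" "HOL-Probability.Essential_Supremum"
begin

section \<open>Domain and smoothness\<close>

text \<open>Fields that are periodic in x and y are represented as functions on the closed slab
  0 \<le> z \<le> 1; their values outside the slab are never used. All derivatives are taken within
  the slab, hence they are one-sided in z on the boundary.\<close>

definition slab :: "(real^3) set" where
  "slab = {x. 0 \<le> x$3 \<and> x$3 \<le> 1}"

definition V :: "real \<Rightarrow> real \<Rightarrow> (real^3) set" where
  "V Lx Ly = {x. 0 \<le> x$1 \<and> x$1 \<le> Lx \<and> 0 \<le> x$2 \<and> x$2 \<le> Ly \<and> 0 \<le> x$3 \<and> x$3 \<le> 1}"

definition xy_periodic :: "real \<Rightarrow> real \<Rightarrow> (real^3 \<Rightarrow> 'b) \<Rightarrow> bool" where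
  "xy_periodic Lx Ly f \<longleftrightarrow>
     (\<forall>x\<in>slab. f (x + Lx *\<^sub>R axis 1 1) = f x \<and> f (x + Ly *\<^sub>R axis 2 1) = f x)"

text \<open>The derivative within \<open>S\<close> is unique if \<open>S\<close> is convex with nonempty interior, and the
  definition is only used for such sets.\<close>

primrec Ck_on :: "nat \<Rightarrow> 'a::euclidean_space set \<Rightarrow> ('a \<Rightarrow> 'b::real_normed_vector) \<Rightarrow> bool" where
  "Ck_on 0 S f \<longleftrightarrow> continuous_on S f"
| "Ck_on (Suc k) S f \<longleftrightarrow> f differentiable_on S \<and>
     (\<forall>v. Ck_on k S (\<lambda>x. frechet_derivative f (at x within S) v))"

definition smooth_on :: "'a::euclidean_space set \<Rightarrow> ('a \<Rightarrow> 'b::real_normed_vector) \<Rightarrow> bool" where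
  "smooth_on S f \<longleftrightarrow> (\<forall>k. Ck_on k S f)"

section \<open>Differential operators\<close>

definition pd :: "3 \<Rightarrow> (real^3 \<Rightarrow> 'b::real_normed_vector) \<Rightarrow> real^3 \<Rightarrow> 'b" where
  "pd j f x = frechet_derivative f (at x within slab) (axis j 1)"

definition dt :: "real set \<Rightarrow> (real \<Rightarrow> 'b::real_normed_vector) \<Rightarrow> real \<Rightarrow> 'b" where
  "dt I f t = vector_derivative f (at t within I)"

definition grad :: "(real^3 \<Rightarrow> real) \<Rightarrow> real^3 \<Rightarrow> real^3" where
  "grad f x = (\<chi> j. pd j f x)"

definition grad_xy :: "(real^3 \<Rightarrow> real) \<Rightarrow> real^3 \<Rightarrow> real^2" where
  "grad_xy f x = vector [pd 1 f x, pd 2 f x]"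

text \<open>Gradient of a vector field; the norm of type \<^typ>\<open>real^3^'m\<close> is the Frobenius norm.\<close>

definition Grad :: "(real^3 \<Rightarrow> real^'m) \<Rightarrow> real^3 \<Rightarrow> real^3^'m" where
  "Grad F x = (\<chi> i j. pd j (\<lambda>y. F y $ i) x)"

definition dive :: "(real^3 \<Rightarrow> real^3) \<Rightarrow> real^3 \<Rightarrow> real" where
  "dive F x = (\<Sum>j\<in>UNIV. pd j (\<lambda>y. F y $ j) x)"

definition curl :: "(real^3 \<Rightarrow> real^3) \<Rightarrow> real^3 \<Rightarrow> real^3" where
  "curl F x = vector
     [pd 2 (\<lambda>y. F y $ 3) x - pd 3 (\<lambda>y. F y $ 2) x,
      pd 3 (\<lambda>y. F y $ 1) x - pd 1 (\<lambda>y. F y $ 3) x,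
      pd 1 (\<lambda>y. F y $ 2) x - pd 2 (\<lambda>y. F y $ 1) x]"

definition lap :: "(real^3 \<Rightarrow> 'b::real_normed_vector) \<Rightarrow> real^3 \<Rightarrow> 'b" where
  "lap f x = (\<Sum>j\<in>UNIV. pd j (pd j f) x)"

section \<open>The viscous inertialess model\<close>

abbreviation e_z :: "real^3" where
  "e_z \<equiv> axis 3 1"

text \<open>Boundary conditions at one point, for unit outer normal \<open>n\<close> and boundary temperature
  \<open>Tb\<close>.\<close>

definition bc_at :: "real^3 \<Rightarrow> real \<Rightarrow> (real^3 \<Rightarrow> real^3) \<Rightarrow> (real^3 \<Rightarrow> real^3) \<Rightarrow> (real^3 \<Rightarrow> real)
    \<Rightarrow> real^3 \<Rightarrow> bool" where
  "bc_at n Tb u B T x \<longleftrightarrow>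
     u x \<bullet> n = 0 \<and> cross3 (curl u x) n = 0 \<and> cross3 (B x) n = 0 \<and> T x = Tb"

text \<open>Solutions are smooth up to the boundary of the slab on a nondegenerate time interval \<open>I\<close>,
  which may contain its endpoints.\<close>

definition viscous_inertialess_solution ::
  "real \<Rightarrow> real \<Rightarrow> real \<Rightarrow> real \<Rightarrow> real \<Rightarrow> real \<Rightarrow> real \<Rightarrow> (real^3 \<Rightarrow> real) \<Rightarrow> real \<Rightarrow> real \<Rightarrow> real set \<Rightarrow>
   (real \<Rightarrow> real^3 \<Rightarrow> real^3) \<Rightarrow> (real \<Rightarrow> real^3 \<Rightarrow> real^3) \<Rightarrow>
   (real \<Rightarrow> real^3 \<Rightarrow> real) \<Rightarrow> (real \<Rightarrow> real^3 \<Rightarrow> real) \<Rightarrow> bool" where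
  "viscous_inertialess_solution Lx Ly Ek \<Lambda> Ra Rm Pe Q T_minus T_plus I u B P T \<longleftrightarrow>
     is_interval I \<and> interior I \<noteq> {} \<and>
     smooth_on (I \<times> slab) (\<lambda>(t, x). u t x) \<and>
     smooth_on (I \<times> slab) (\<lambda>(t, x). B t x) \<and>
     smooth_on (I \<times> slab) (\<lambda>(t, x). P t x) \<and>
     smooth_on (I \<times> slab) (\<lambda>(t, x). T t x) \<and>
     xy_periodic Lx Ly Q \<and>
     (\<forall>t\<in>I. xy_periodic Lx Ly (u t) \<and> xy_periodic Lx Ly (B t) \<and>
            xy_periodic Lx Ly (P t) \<and> xy_periodic Lx Ly (T t)) \<and>
     (\<forall>t\<in>I. \<forall>x\<in>slab.
        cross3 e_z (u t x) + grad (P t) x - Ek *\<^sub>R lap (u t) x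
          = \<Lambda> *\<^sub>R cross3 (curl (B t) x) (B t x) + (Ra * T t x) *\<^sub>R e_z \<and>
        dive (u t) x = 0 \<and>
        dt I (\<lambda>s. B s x) t - curl (\<lambda>y. cross3 (u t y) (B t y)) x
          = (1 / Rm) *\<^sub>R lap (B t) x \<and>
        dive (B t) x = 0 \<and>
        dt I (\<lambda>s. T s x) t + dive (\<lambda>y. T t y *\<^sub>R u t y) x
          = (1 / Pe) * lap (T t) x + Q x / Pe) \<and>
     (\<forall>t\<in>I. \<forall>x. x$3 = 0 \<longrightarrow> bc_at (- e_z) T_minus (u t) (B t) (T t) x) \<and>
     (\<forall>t\<in>I. \<forall>x. x$3 = 1 \<longrightarrow> bc_at e_z T_plus (u t) (B t) (T t) x)"

definition flux_exact :: "real \<Rightarrow> real \<Rightarrow> (real^3 \<Rightarrow> real^3) \<Rightarrow> bool" where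
  "flux_exact Lx Ly B \<longleftrightarrow>
     integral\<^sup>L (lebesgue_on ({0..Lx} \<times> {0..Ly})) (\<lambda>(x, y). (- e_z) \<bullet> B (vector [x, y, 0])) = 0 \<and>
     integral\<^sup>L (lebesgue_on ({0..Lx} \<times> {0..Ly})) (\<lambda>(x, y). e_z \<bullet> B (vector [x, y, 1])) = 0"

definition magnetic_energy :: "real \<Rightarrow> real \<Rightarrow> (real^3 \<Rightarrow> real^3) \<Rightarrow> real" where
  "magnetic_energy Lx Ly B = 1/2 * integral\<^sup>L (lebesgue_on (V Lx Ly)) (\<lambda>x. (norm (B x))\<^sup>2)"

definition dynamo_action_at ::
  "real \<Rightarrow> real \<Rightarrow> real set \<Rightarrow> (real \<Rightarrow> real^3 \<Rightarrow> real^3) \<Rightarrow> real \<Rightarrow> bool" where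
  "dynamo_action_at Lx Ly I B t \<longleftrightarrow>
     (\<exists>D\<ge>0. ((\<lambda>s. magnetic_energy Lx Ly (B s)) has_real_derivative D) (at t within I))"

section \<open>Norms and constants\<close>

definition Tbar :: "(real^3 \<Rightarrow> real) \<Rightarrow> real^3 \<Rightarrow> real" where
  "Tbar T x = integral\<^sup>L (lebesgue_on {0..x$3}) (\<lambda>z. T (vector [x$1, x$2, z]))"

definition Lp_norm :: "ereal \<Rightarrow> 'a::euclidean_space set \<Rightarrow> ('a \<Rightarrow> 'b::real_normed_vector) \<Rightarrow> real" where
  "Lp_norm p S f =
     (if p = \<infinity> then real_of_ereal (esssup (lebesgue_on S) (\<lambda>x. ereal (norm (f x))))
      else integral\<^sup>L (lebesgue_on S) (\<lambda>x. norm (f x) powr real_of_ereal p)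
             powr (1 / real_of_ereal p))"

definition lambda1 :: "real \<Rightarrow> real \<Rightarrow> real" where
  "lambda1 Lx Ly = Min {pi, 2 * pi / Lx, 2 * pi / Ly}"

definition C_P :: "real \<Rightarrow> real \<Rightarrow> real" where
  "C_P Lx Ly = 1 / lambda1 Lx Ly"

definition C3 :: real where
  "C3 = 2 powr (2/3) / (pi powr (2/3) * sqrt 3)"

definition C_S :: "real \<Rightarrow> real \<Rightarrow> real" where
  "C_S Lx Ly = 2 * sqrt 2 * C3 * (1 + sqrt (1 + 1 / Lx\<^sup>2 + 1 / Ly\<^sup>2) / lambda1 Lx Ly)"

definition A_const :: "ereal \<Rightarrow> real \<Rightarrow> real \<Rightarrow> real" where
  "A_const p Lx Ly =
     (if p = \<infinity> then C_P Lx Ly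
      else C_P Lx Ly powr ((real_of_ereal p - 3) / real_of_ereal p)
             * C_S Lx Ly powr (3 / real_of_ereal p))"

end

theory Submission
  imports Defs
begin

text \<open>Let \<open>\<phi>\<close> be the vertical primitive of the temperature and \<open>v = (-\<partial>\<^sub>y \<phi>, \<partial>\<^sub>x \<phi>, 0)\<close>. Testing the
  momentum equation with \<open>u\<close> expresses the work against the Lorentz force by \<open>Ek \<parallel>\<nabla>u\<parallel>\<^sup>2\<close> and the buoyancy
  work \<open>\<integral> T u\<^sub>z = - \<integral> u \<bullet> \<nabla>\<^sub>x\<^sub>y \<phi>\<close>. Testing it with \<open>v\<close> removes pressure and buoyancy, turns the Coriolis
  term into \<open>u \<bullet> \<nabla>\<^sub>x\<^sub>y \<phi>\<close> and leaves \<open>\<Lambda> \<integral> v \<bullet> (B \<bullet> \<nabla>) B - Ek \<integral> \<nabla>u : \<nabla>v\<close>. Inserting both in the energy balance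
  of \<open>B\<close> and completing the square in \<open>\<nabla>u\<close> bounds \<open>\<parallel>\<nabla>B\<parallel>\<^sup>2 / Rm\<close> by
  \<open>- Ra \<integral> v \<bullet> (B \<bullet> \<nabla>) B + Ra\<^sup>2 Ek \<parallel>\<nabla>v\<parallel>\<^sup>2 / (4 \<Lambda>)\<close>. The trilinear term is estimated by Hoelder's inequality,
  interpolating \<open>B\<close> between \<open>L\<^sup>2\<close> (Poincare) and \<open>L\<^sup>6\<close> (Sobolev).

  The Sobolev constant \<open>C\<^sub>S\<close> contains the sharp constant of the whole space, but the factor \<open>2 \<surd>2\<close> leaves
  enough room for the elementary proof of Gagliardo and Nirenberg applied to \<open>w\<^sup>4\<close> on the box itself.\<close>

text \<open>The alternative with \<gamma> stems from the term
  \<open>Ra\<^sup>2 * Ek / (4 * \<Lambda>) * GV\<close> left by completing the square, where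
  \<open>GB\<close> and \<open>GV\<close> are the squared gradient norms of \<open>B\<close> and
  \<open>v\<close>. It carries no factor \<open>GB\<close>, while the other terms do. If the second
  alternative fails, then \<open>Ek powr \<gamma> < 4 * \<Lambda> * GB\<close>; inserting this in
  \<open>Ek = Ek powr (1 - \<gamma>) * Ek powr \<gamma>\<close> supplies the missing factor, and the
  positive number \<open>GB\<close> cancels.

  The obstacle is that no bound on the velocity is available. Viscosity enters the first test with a
  favourable sign, so \<nabla>u may appear quadratically, but the buoyancy work is linear in u
  itself. The second test trades exactly that linear term for one in B and one in \<nabla>u. It has
  to work on the walls too, where v need not vanish: there the stress-free condition removes the
  viscous boundary term. The magnetic pressure is a gradient and disappears together with
  \<open>P\<close>, so that only the tension (B \<bullet> \<nabla>) B remains.\<close>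

lemmas HK_integral_add = Henstock_Kurzweil_Integration.integral_add
  and HK_integral_cong = Henstock_Kurzweil_Integration.integral_cong
  and HK_integral_combine = Henstock_Kurzweil_Integration.integral_combine

section \<open>Calculus on the slab\<close>

abbreviation vec3 :: "real \<Rightarrow> real \<Rightarrow> real \<Rightarrow> real^3" where
  "vec3 x y z \<equiv> vector [x, y, z]"

lemma vec3_axis: "vec3 x y z = x *\<^sub>R axis 1 1 + y *\<^sub>R axis 2 1 + z *\<^sub>R axis 3 1"
  by (simp add: vec_eq_iff forall_3 axis_def)

lemma vec3_eta: "vec3 (x$1) (x$2) (x$3) = x"
  by (simp add: vec_eq_iff forall_3)

lemma continuous_on_vec3 [continuous_intros]:
  assumes "continuous_on S f" "continuous_on S g" "continuous_on S h"
  shows "continuous_on S (\<lambda>x. vec3 (f x) (g x) (h x))"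
  unfolding vec3_axis by (intro continuous_intros assms)

lemma vec3_slab [simp]: "vec3 x y z \<in> slab \<longleftrightarrow> 0 \<le> z \<and> z \<le> 1"
  by (simp add: slab_def)

lemma convex_slab: "convex slab"
proof -
  have "slab = {x. axis 3 1 \<bullet> x \<ge> 0} \<inter> {x. axis 3 1 \<bullet> x \<le> 1}"
    by (auto simp: slab_def inner_axis')
  then show ?thesis
    by (metis convex_Int convex_halfspace_ge convex_halfspace_le)
qed

text \<open>Wall points have no full neighbourhood in the slab, but uniqueness only asks for
  arbitrarily small admissible increments along each axis, and one sign of the increment
  suffices.\<close>

lemma slab_has_derivative_unique:
  assumes "(f has_derivative D) (at x within slab)" "(f has_derivative D') (at x within slab)" "x \<in> slab"
  shows "D = D'"
proof (rule frechet_derivative_unique_within[OF assms(1,2)])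
  fix i :: "real^3" and e :: real assume i: "i \<in> Basis" and e: "e > 0"
  obtain j where j: "i = axis j 1" using i by (auto simp: Basis_vec_def)
  \<comment> \<open>The sign points away from the nearer wall, and the cap \<open>1/2\<close> keeps
    the increment inside the slab.\<close>
  define d where "d = (if x$3 \<le> 1/2 then min (e/2) (1/2) else - min (e/2) (1/2))"
  have "0 < \<bar>d\<bar> \<and> \<bar>d\<bar> < e" using e by (auto simp: d_def)
  moreover have "x + d *\<^sub>R i \<in> slab"
    using assms(3) e by (auto simp: j slab_def axis_def d_def min_def)
  ultimately show "\<exists>d. 0 < \<bar>d\<bar> \<and> \<bar>d\<bar> < e \<and> x + d *\<^sub>R i \<in> slab" by blast
qed

lemma slab_frechet_eqI:
  assumes "(f has_derivative D) (at x within slab)" "x \<in> slab"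
  shows "frechet_derivative f (at x within slab) = D"
  using assms slab_has_derivative_unique frechet_derivative_works
  by (metis Derivative.differentiableI)

lemma pd_eqI:
  assumes "(f has_derivative D) (at x within slab)" "x \<in> slab"
  shows "pd j f x = D (axis j 1)"
  by (simp add: pd_def slab_frechet_eqI[OF assms])

lemma has_derivative_within_cong:
  assumes "\<And>x. x \<in> S \<Longrightarrow> f x = g x" "x \<in> S"
  shows "(f has_derivative D) (at x within S) \<longleftrightarrow> (g has_derivative D) (at x within S)"
  using assms has_derivative_transform[of x S f g D] has_derivative_transform[of x S g f D] by auto

lemma pd_cong:
  assumes "\<And>x. x \<in> slab \<Longrightarrow> f x = g x" "x \<in> slab"
  shows "pd j f x = pd j g x"
proof -
  have "(f has_derivative D) (at x within slab) \<longleftrightarrow> (g has_derivative D) (at x within slab)" for D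
    by (rule has_derivative_within_cong) (use assms in auto)
  then show ?thesis by (simp add: pd_def frechet_derivative_def)
qed

text \<open>Differentiability is demanded beside continuity of the partial derivatives, so that the
  chain rule applies at once, on the walls as well.\<close>

definition C1 :: "(real^3 \<Rightarrow> 'b::real_normed_vector) \<Rightarrow> bool" where
  "C1 f \<longleftrightarrow> f differentiable_on slab \<and> (\<forall>j. continuous_on slab (pd j f))"

lemma C1_continuous: "C1 f \<Longrightarrow> continuous_on slab f"
  by (simp add: C1_def differentiable_imp_continuous_on)

lemma C1_continuous_pd: "C1 f \<Longrightarrow> continuous_on slab (pd j f)"
  by (simp add: C1_def)

lemma C1_differentiable: "C1 f \<Longrightarrow> x \<in> slab \<Longrightarrow> f differentiable (at x within slab)"
  by (simp add: C1_def differentiable_on_def)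

lemma has_derivative_pd:
  assumes "f differentiable (at x within slab)"
  shows "(f has_derivative (\<lambda>h. \<Sum>j\<in>UNIV. h$j *\<^sub>R pd j f x)) (at x within slab)"
proof -
  let ?D = "frechet_derivative f (at x within slab)"
  have D: "(f has_derivative ?D) (at x within slab)"
    using assms frechet_derivative_works by blast
  interpret linear ?D using D has_derivative_linear by blast
  have "?D = (\<lambda>h. \<Sum>j\<in>UNIV. h$j *\<^sub>R pd j f x)"
  proof
    fix h :: "real^3"
    have "h = (\<Sum>j\<in>UNIV. h$j *\<^sub>R axis j 1)"
      using basis_expansion[of h] by (simp add: scalar_mult_eq_scaleR)
    then have "?D h = ?D (\<Sum>j\<in>UNIV. h$j *\<^sub>R axis j 1)" by simp
    also have "\<dots> = (\<Sum>j\<in>UNIV. h$j *\<^sub>R pd j f x)"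
      by (simp add: sum scale pd_def)
    finally show "?D h = (\<Sum>j\<in>UNIV. h$j *\<^sub>R pd j f x)" .
  qed
  with D show ?thesis by simp
qed

lemma sum_axis_scale:
  fixes c :: "'n::finite \<Rightarrow> 'b::real_normed_vector"
  shows "(\<Sum>k\<in>UNIV. (axis j (1::real)) $ k *\<^sub>R c k) = c j"
proof -
  have "(\<Sum>k\<in>UNIV. (axis j (1::real)) $ k *\<^sub>R c k) = (\<Sum>k\<in>UNIV. if k = j then c k else 0)"
    by (rule sum.cong) (auto simp: axis_def)
  then show ?thesis by simp
qed

text \<open>One formula for the total derivative yields both the smoothness and, by uniqueness of
  derivatives within the slab, the values of \<open>pd\<close>. The algebra of C1 functions and the
  vertical primitive rest on it.\<close>

lemma C1I:
  assumes "\<And>x. x \<in> slab \<Longrightarrow> (f has_derivative (\<lambda>h. \<Sum>j\<in>UNIV. h$j *\<^sub>R g j x)) (at x within slab)"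
    and "\<And>j. continuous_on slab (g j)"
  shows "C1 f" and "\<And>x j. x \<in> slab \<Longrightarrow> pd j f x = g j x"
proof -
  show pd: "pd j f x = g j x" if "x \<in> slab" for x j
    using pd_eqI[OF assms(1)[OF that] that, of j] by (simp add: sum_axis_scale)
  have "f differentiable_on slab"
    using assms(1) by (auto simp: differentiable_on_def differentiable_def)
  moreover have "continuous_on slab (pd j f)" for j
    using assms(2) pd by (metis (no_types, lifting) continuous_on_cong)
  ultimately show "C1 f" by (simp add: C1_def)
qed

lemma C1_cong:
  assumes "C1 f" "\<And>x. x \<in> slab \<Longrightarrow> f x = g x"
  shows "C1 g"
proof (rule C1I)
  show "(g has_derivative (\<lambda>h. \<Sum>j\<in>UNIV. h$j *\<^sub>R pd j f x)) (at x within slab)" if "x \<in> slab" for x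
    by (rule has_derivative_transform[OF that, of _ f])
       (use assms that in \<open>auto intro: has_derivative_pd C1_differentiable\<close>)
qed (use assms C1_continuous_pd in auto)

lemma C1_const: "C1 (\<lambda>x. c)" and pd_const: "x \<in> slab \<Longrightarrow> pd j (\<lambda>x. c) x = 0"
  by (rule C1I[of _ "\<lambda>j x. 0"]; simp)+

lemma
  assumes "C1 f" "C1 g"
  shows C1_add: "C1 (\<lambda>x. f x + g x)"
    and pd_add: "x \<in> slab \<Longrightarrow> pd j (\<lambda>x. f x + g x) x = pd j f x + pd j g x"
proof -
  have 1: "((\<lambda>x. f x + g x) has_derivative (\<lambda>h. \<Sum>j\<in>UNIV. h$j *\<^sub>R (pd j f x + pd j g x))) (at x within slab)"
    if "x \<in> slab" for x
    using has_derivative_add[OF has_derivative_pd[OF C1_differentiable[OF assms(1) that]]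
        has_derivative_pd[OF C1_differentiable[OF assms(2) that]]]
    by (simp add: scaleR_add_right sum.distrib)
  have 2: "continuous_on slab (\<lambda>x. pd j f x + pd j g x)" for j
    by (intro continuous_intros C1_continuous_pd assms)
  show "C1 (\<lambda>x. f x + g x)" by (rule C1I(1)[OF 1 2])
  show "x \<in> slab \<Longrightarrow> pd j (\<lambda>x. f x + g x) x = pd j f x + pd j g x" by (rule C1I(2)[OF 1 2])
qed

lemma
  fixes f g :: "real^3 \<Rightarrow> real"
  assumes "C1 f" "C1 g"
  shows C1_mult: "C1 (\<lambda>x. f x * g x)"
    and pd_mult: "x \<in> slab \<Longrightarrow> pd j (\<lambda>x. f x * g x) x = pd j f x * g x + f x * pd j g x"
proof -
  have 1: "((\<lambda>x. f x * g x) has_derivative (\<lambda>h. \<Sum>j\<in>UNIV. h$j *\<^sub>R (pd j f x * g x + f x * pd j g x))) (at x within slab)"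
    if "x \<in> slab" for x
    using has_derivative_mult[OF has_derivative_pd[OF C1_differentiable[OF assms(1) that]]
        has_derivative_pd[OF C1_differentiable[OF assms(2) that]]]
    by (simp add: sum_3 algebra_simps)
  have 2: "continuous_on slab (\<lambda>x. pd j f x * g x + f x * pd j g x)" for j
    by (intro continuous_intros C1_continuous_pd C1_continuous assms)
  show "C1 (\<lambda>x. f x * g x)" by (rule C1I(1)[OF 1 2])
  show "x \<in> slab \<Longrightarrow> pd j (\<lambda>x. f x * g x) x = pd j f x * g x + f x * pd j g x" by (rule C1I(2)[OF 1 2])
qed

lemma
  fixes f :: "real^3 \<Rightarrow> real"
  assumes "C1 f"
  shows C1_minus: "C1 (\<lambda>x. - f x)"
    and pd_minus: "x \<in> slab \<Longrightarrow> pd j (\<lambda>x. - f x) x = - pd j f x"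
  using C1_mult[OF C1_const[of "-1::real"] assms] pd_mult[OF C1_const[of "-1::real"] assms, of x j]
  by (auto simp: pd_const)

lemma C1_diff:
  fixes f g :: "real^3 \<Rightarrow> real"
  assumes "C1 f" "C1 g"
  shows "C1 (\<lambda>x. f x - g x)"
  using C1_add[OF assms(1) C1_minus[OF assms(2)]] by simp

lemma
  fixes f :: "real^3 \<Rightarrow> real^'m"
  assumes "C1 f"
  shows C1_component: "C1 (\<lambda>x. f x $ i)"
    and pd_component: "x \<in> slab \<Longrightarrow> pd j (\<lambda>x. f x $ i) x = pd j f x $ i"
proof -
  have 1: "((\<lambda>x. f x $ i) has_derivative (\<lambda>h. \<Sum>j\<in>UNIV. h$j *\<^sub>R (pd j f x $ i))) (at x within slab)"
    if "x \<in> slab" for x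
    using bounded_linear.has_derivative[OF bounded_linear_vec_nth has_derivative_pd[OF C1_differentiable[OF assms that]], of i]
    by (simp add: sum_component)
  have 2: "continuous_on slab (\<lambda>x. pd j f x $ i)" for j
    by (intro continuous_intros C1_continuous_pd assms)
  show "C1 (\<lambda>x. f x $ i)" by (rule C1I(1)[OF 1 2])
  show "x \<in> slab \<Longrightarrow> pd j (\<lambda>x. f x $ i) x = pd j f x $ i" by (rule C1I(2)[OF 1 2])
qed

text \<open>\<open>S\<close> is left free because horizontal lines are used with two-sided
  derivatives and vertical ones with one-sided derivatives on \<open>{0..1}\<close>.\<close>

lemma C1_line:
  assumes "C1 f" "x + s *\<^sub>R axis j 1 \<in> slab" "\<And>r. r \<in> S \<Longrightarrow> x + r *\<^sub>R axis j 1 \<in> slab"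
  shows "((\<lambda>r. f (x + r *\<^sub>R axis j 1)) has_vector_derivative pd j f (x + s *\<^sub>R axis j 1)) (at s within S)"
proof -
  let ?l = "\<lambda>r::real. x + r *\<^sub>R axis j 1"
  have l: "(?l has_derivative (\<lambda>h. h *\<^sub>R axis j 1)) (at s within S)"
    by (auto intro!: derivative_eq_intros)
  have f: "(f has_derivative (\<lambda>h. \<Sum>j\<in>UNIV. h$j *\<^sub>R pd j f (?l s))) (at (?l s) within ?l ` S)"
    by (rule has_derivative_subset[OF has_derivative_pd[OF C1_differentiable[OF assms(1,2)]]])
       (use assms(3) in auto)
  have "((\<lambda>r. f (?l r)) has_derivative (\<lambda>h. \<Sum>k\<in>UNIV. (h *\<^sub>R axis j 1)$k *\<^sub>R pd k f (?l s))) (at s within S)"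
    using has_derivative_in_compose[OF l f[unfolded image_image]] by simp
  moreover have "(\<Sum>k\<in>UNIV. (h *\<^sub>R axis j 1)$k *\<^sub>R pd k f (?l s)) = h *\<^sub>R pd j f (?l s)" for h
    using sum_axis_scale[of j "\<lambda>k. h *\<^sub>R pd k f (?l s)"] by (simp add: mult.commute)
  ultimately show ?thesis by (simp add: has_vector_derivative_def)
qed

lemma
  assumes "C1 f"
  shows C1_line1: "z \<in> {0..1} \<Longrightarrow> ((\<lambda>x. f (vec3 x y z)) has_vector_derivative pd 1 f (vec3 x y z)) (at x within S)"
    and C1_line2: "z \<in> {0..1} \<Longrightarrow> ((\<lambda>y. f (vec3 x y z)) has_vector_derivative pd 2 f (vec3 x y z)) (at y within S)"
    and C1_line3: "z \<in> {0..1} \<Longrightarrow> S \<subseteq> {0..1} \<Longrightarrow>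
       ((\<lambda>z. f (vec3 x y z)) has_vector_derivative pd 3 f (vec3 x y z)) (at z within S)"
proof -
  have e: "vec3 x y z = vec3 0 y z + x *\<^sub>R axis 1 1"
    "vec3 x y z = vec3 x 0 z + y *\<^sub>R axis 2 1" "vec3 x y z = vec3 x y 0 + z *\<^sub>R axis 3 1" for x y z
    by (simp_all add: vec3_axis)
  show "z \<in> {0..1} \<Longrightarrow> ((\<lambda>x. f (vec3 x y z)) has_vector_derivative pd 1 f (vec3 x y z)) (at x within S)"
    using C1_line[OF assms, of "vec3 0 y z" x 1 S] by (simp add: e(1)[symmetric])
  show "z \<in> {0..1} \<Longrightarrow> ((\<lambda>y. f (vec3 x y z)) has_vector_derivative pd 2 f (vec3 x y z)) (at y within S)"
    using C1_line[OF assms, of "vec3 x 0 z" y 2 S] by (simp add: e(2)[symmetric])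
  show "z \<in> {0..1} \<Longrightarrow> S \<subseteq> {0..1} \<Longrightarrow>
       ((\<lambda>z. f (vec3 x y z)) has_vector_derivative pd 3 f (vec3 x y z)) (at z within S)"
    using C1_line[OF assms, of "vec3 x y 0" z 3 S] by (force simp: e(3)[symmetric])
qed

text \<open>Horizontal derivatives only see the values in the plane. This turns the wall conditions
  on \<open>curl U\<close> and \<open>dive B\<close> into conditions on single vertical
  derivatives.\<close>

lemma pd_plane_zero:
  assumes "C1 f" "z \<in> {0..1}" "\<And>x y. f (vec3 x y z) = 0"
  shows "pd 1 f (vec3 x y z) = 0" "pd 2 f (vec3 x y z) = 0"
  using vector_derivative_unique_at[OF C1_line1[OF assms(1,2), of y x UNIV], of 0]
    vector_derivative_unique_at[OF C1_line2[OF assms(1,2), of x y UNIV], of 0]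
  by (auto simp: assms(3))

text \<open>A horizontal translation maps the slab into itself, walls included, so the chain rule
  transports derivatives along a period.\<close>

lemma xy_periodic_pd:
  assumes "C1 f" "xy_periodic Lx Ly f"
  shows "xy_periodic Lx Ly (pd j f)"
proof -
  have "pd j f (x + c) = pd j f x"
    if x: "x \<in> slab" and c: "c $ 3 = 0" and p: "\<And>x. x \<in> slab \<Longrightarrow> f (x + c) = f x" for x c
  proof -
    have s: "y + c \<in> slab \<longleftrightarrow> y \<in> slab" for y using c by (simp add: slab_def)
    have im: "(\<lambda>y. y + c) ` slab \<subseteq> slab" using s by auto
    have "((\<lambda>y. f (y + c)) has_derivative (\<lambda>h. \<Sum>j\<in>UNIV. h$j *\<^sub>R pd j f (x + c))) (at x within slab)"
      by (rule has_derivative_in_compose[OF _ has_derivative_subset[OF has_derivative_pd[OF C1_differentiable[OF assms(1)]] im]])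
        (use x s in \<open>auto intro!: derivative_eq_intros\<close>)
    then have "(f has_derivative (\<lambda>h. \<Sum>j\<in>UNIV. h$j *\<^sub>R pd j f (x + c))) (at x within slab)"
      by (rule has_derivative_transform[OF x, rotated]) (use p in auto)
    from pd_eqI[OF this x, of j] show ?thesis by (simp add: sum_axis_scale)
  qed
  then show ?thesis using assms(2)
    by (simp add: xy_periodic_def axis_def)
qed

section \<open>Passage from smoothness in space-time to a fixed instant\<close>

lemma Ck_on_cong_slab:
  assumes "Ck_on k slab f" "\<And>x. x \<in> slab \<Longrightarrow> f x = g x"
  shows "Ck_on k slab g"
  using assms
proof (induction k arbitrary: f g)
  case 0 then show ?case by (metis Ck_on.simps(1) continuous_on_cong)
next
  case (Suc k)
  have *: "(f has_derivative D) (at x within slab) \<longleftrightarrow> (g has_derivative D) (at x within slab)"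
    if "x \<in> slab" for D x
    by (rule has_derivative_within_cong) (use that Suc.prems in auto)
  then have "frechet_derivative f (at x within slab) = frechet_derivative g (at x within slab)"
    if "x \<in> slab" for x using that by (simp add: frechet_derivative_def)
  moreover have "g differentiable_on slab" using Suc.prems(1) * by (simp add: differentiable_on_def differentiable_def)
  ultimately show ?case using Suc.prems(1) Suc.IH
    by (simp) (metis (no_types, lifting))
qed

text \<open>The derivative of the slice in direction \<open>v\<close> is the slice of the derivative
  in direction \<open>(0, v)\<close>, which is again covered by the induction hypothesis because
  that runs over all \<open>f\<close>. The two agree only on the slab, hence the congruence
  rule.\<close>

lemma Ck_on_slice:
  fixes f :: "real \<times> (real^3) \<Rightarrow> 'b::real_normed_vector"
  assumes "Ck_on k (I \<times> slab) f" "t \<in> I"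
  shows "Ck_on k slab (\<lambda>x. f (t, x))"
  using assms(1)
proof (induction k arbitrary: f)
  case 0
  have "continuous_on slab (\<lambda>x. f (t, x))"
    by (rule continuous_on_compose2[of "I \<times> slab" f]) (use 0 \<open>t \<in> I\<close> in \<open>auto intro!: continuous_intros\<close>)
  then show ?case by simp
next
  case (Suc k)
  have d: "((\<lambda>x. f (t, x)) has_derivative (\<lambda>v. frechet_derivative f (at (t, x) within I \<times> slab) (0, v))) (at x within slab)"
    if "x \<in> slab" for x
  proof -
    have "(f has_derivative frechet_derivative f (at (t, x) within I \<times> slab)) (at (t, x) within I \<times> slab)"
      using Suc.prems that \<open>t \<in> I\<close> frechet_derivative_works by (auto simp: differentiable_on_def)
    then show ?thesis
      by (rule has_derivative_in_compose[OF _ has_derivative_subset, of "Pair t" "\<lambda>v. (0, v)", rotated])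
         (use \<open>t \<in> I\<close> in \<open>auto intro!: derivative_eq_intros\<close>)
  qed
  have "Ck_on k slab (\<lambda>x. frechet_derivative (\<lambda>x. f (t, x)) (at x within slab) v)" for v
  proof (rule Ck_on_cong_slab)
    show "Ck_on k slab (\<lambda>x. frechet_derivative f (at (t, x) within I \<times> slab) (0, v))"
      using Suc.prems by (intro Suc.IH) (auto simp: split_def)
  qed (simp add: slab_frechet_eqI[OF d])
  then show ?case using d by (auto simp: differentiable_on_def differentiable_def)
qed

lemma smooth_on_slice:
  fixes f :: "real \<Rightarrow> real^3 \<Rightarrow> 'b::real_normed_vector"
  shows "smooth_on (I \<times> slab) (\<lambda>(t, x). f t x) \<Longrightarrow> t \<in> I \<Longrightarrow> smooth_on slab (f t)"
  using Ck_on_slice[of _ I "\<lambda>(t, x). f t x" t] by (simp add: smooth_on_def)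

lemma smooth_on_slab_pd: "smooth_on slab f \<Longrightarrow> smooth_on slab (pd j f)"
  unfolding smooth_on_def pd_def[abs_def] by (metis (no_types) Ck_on.simps(2))

lemma smooth_on_slab_C1: "smooth_on slab f \<Longrightarrow> C1 f"
  using smooth_on_slab_pd[of f] unfolding C1_def smooth_on_def by (meson Ck_on.simps)

lemma smooth_on_slab_component:
  fixes f :: "real^3 \<Rightarrow> real^'m"
  assumes "smooth_on slab f"
  shows "smooth_on slab (\<lambda>x. f x $ i)"
proof -
  have "Ck_on k slab f \<Longrightarrow> Ck_on k slab (\<lambda>x. f x $ i)" for k and f :: "real^3 \<Rightarrow> real^'m"
  proof (induction k arbitrary: f)
    case 0 then show ?case by (auto intro!: continuous_intros)
  next
    case (Suc k)
    have d: "((\<lambda>x. f x $ i) has_derivative (\<lambda>v. frechet_derivative f (at x within slab) v $ i)) (at x within slab)"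
      if "x \<in> slab" for x
      using bounded_linear.has_derivative[OF bounded_linear_vec_nth] Suc.prems that frechet_derivative_works
      by (fastforce simp: differentiable_on_def)
    have "Ck_on k slab (\<lambda>x. frechet_derivative (\<lambda>x. f x $ i) (at x within slab) v)" for v
      by (rule Ck_on_cong_slab[OF Suc.IH]) (use Suc.prems slab_frechet_eqI[OF d] in auto)
    then show ?case using d by (auto simp: differentiable_on_def differentiable_def)
  qed
  then show ?thesis using assms by (simp add: smooth_on_def)
qed

lemma lap_component:
  fixes f :: "real^3 \<Rightarrow> real^'m"
  assumes "smooth_on slab f" "x \<in> slab"
  shows "lap f x $ i = lap (\<lambda>x. f x $ i) x"
proof -
  have "pd j (pd j f) x $ i = pd j (pd j (\<lambda>x. f x $ i)) x" for j
  proof -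
    have "pd j (pd j f) x $ i = pd j (\<lambda>x. pd j f x $ i) x"
      by (rule pd_component[symmetric]) (use assms smooth_on_slab_pd smooth_on_slab_C1 in blast)+
    also have "\<dots> = pd j (pd j (\<lambda>x. f x $ i)) x"
      by (rule pd_cong[OF _ assms(2)]) (use assms smooth_on_slab_C1 pd_component in metis)
    finally show ?thesis .
  qed
  then show ?thesis by (simp add: lap_def)
qed

section \<open>Integral inequalities\<close>

text \<open>Jensen's inequality for the exponential at the points \<open>ln (a i)\<close>; zero
  entries are treated apart because \<open>exp\<close> never takes the value 0.\<close>

lemma weighted_AM_GM:
  fixes a w :: "'i \<Rightarrow> real"
  assumes "finite J" "\<And>i. i \<in> J \<Longrightarrow> 0 \<le> a i" "\<And>i. i \<in> J \<Longrightarrow> 0 \<le> w i" "(\<Sum>i\<in>J. w i) = 1"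
  shows "(\<Prod>i\<in>J. a i powr w i) \<le> (\<Sum>i\<in>J. w i * a i)"
proof (cases "\<exists>i\<in>J. a i = 0")
  case True
  \<comment> \<open>\<open>0 powr w\<close> is 0 for every \<open>w\<close>, also for
    \<open>w = 0\<close>, so the weight of the zero entry does not matter.\<close>
  then have "(\<Prod>i\<in>J. a i powr w i) = 0" using assms(1) by (auto intro!: prod_zero)
  moreover have "0 \<le> (\<Sum>i\<in>J. w i * a i)" using assms by (simp add: sum_nonneg)
  ultimately show ?thesis by linarith
next
  case False
  then have pos: "a i > 0" if "i \<in> J" for i using assms(2) that by (force simp: order_less_le)
  have "J \<noteq> {}" using assms(4) by auto
  have "exp (\<Sum>i\<in>J. w i *\<^sub>R ln (a i)) \<le> (\<Sum>i\<in>J. w i * exp (ln (a i)))"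
    by (rule convex_on_sum[OF assms(1) \<open>J \<noteq> {}\<close> exp_convex assms(4) assms(3)]) auto
  also have "\<dots> = (\<Sum>i\<in>J. w i * a i)" using pos by (intro sum.cong) auto
  also have "exp (\<Sum>i\<in>J. w i *\<^sub>R ln (a i)) = (\<Prod>i\<in>J. a i powr w i)"
    using pos assms(1) by (force simp: exp_sum powr_def intro!: prod.cong)
  finally show ?thesis .
qed

text \<open>Normalise every \<open>f i\<close> to integral 1, apply the weighted mean inequality
  pointwise and integrate. \<open>h\<close> is a separate function so that continuity is asked of
  \<open>h\<close> and the \<open>f i\<close>, not of the product of real powers, which can jump
  where a weight is 0.\<close>

lemma integral_Hoelder:
  fixes h :: "'a::euclidean_space \<Rightarrow> real" and f :: "'i \<Rightarrow> 'a \<Rightarrow> real" and w :: "'i \<Rightarrow> real"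
  assumes "box a b \<noteq> {}" and J: "finite J"
    and h: "continuous_on (cbox a b) h" and f: "\<And>i. i \<in> J \<Longrightarrow> continuous_on (cbox a b) (f i)"
    and f0: "\<And>i x. i \<in> J \<Longrightarrow> x \<in> cbox a b \<Longrightarrow> 0 \<le> f i x"
    and w: "\<And>i. i \<in> J \<Longrightarrow> 0 \<le> w i" "(\<Sum>i\<in>J. w i) = 1"
    and le: "\<And>x. x \<in> cbox a b \<Longrightarrow> h x \<le> (\<Prod>i\<in>J. f i x powr w i)"
  shows "integral (cbox a b) h \<le> (\<Prod>i\<in>J. integral (cbox a b) (f i) powr w i)"
proof (cases "\<exists>i\<in>J. integral (cbox a b) (f i) = 0")
  case True
  then obtain i where i: "i \<in> J" "integral (cbox a b) (f i) = 0" by blast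
  \<comment> \<open>A continuous nonnegative function whose integral over a box with interior is 0
    vanishes, and with it the pointwise bound on \<open>h\<close>.\<close>
  then have "f i x = 0" if "x \<in> cbox a b" for x
    using integral_cbox_eq_0_iff[OF f[OF i(1)] assms(1) f0[OF i(1)]] that by auto
  then have "(\<Prod>i\<in>J. f i x powr w i) = 0" if "x \<in> cbox a b" for x
    using that i(1) J by (intro prod_zero) (auto intro!: bexI[of _ i])
  then have "h x \<le> 0" if "x \<in> cbox a b" for x using le[OF that] that by simp
  then have "integral (cbox a b) h \<le> integral (cbox a b) (\<lambda>x. 0)"
    by (intro integral_le integrable_continuous h) auto
  also have "\<dots> \<le> (\<Prod>i\<in>J. integral (cbox a b) (f i) powr w i)" by (simp add: prod_nonneg)
  finally show ?thesis .
next
  case False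
  define c where "c i = integral (cbox a b) (f i)" for i
  have c: "c i > 0" if "i \<in> J" for i
    using False that integral_nonneg[OF integrable_continuous[OF f[OF that]] f0[OF that]]
    by (force simp: c_def order_less_le)
  define C where "C = (\<Prod>i\<in>J. c i powr w i)"
  have C: "C > 0" unfolding C_def using c by (force intro!: prod_pos)
  have "h x / C \<le> (\<Sum>i\<in>J. w i / c i * f i x)" if "x \<in> cbox a b" for x
  proof -
    have "h x / C \<le> (\<Prod>i\<in>J. f i x powr w i) / C" using le[OF that] C by (simp add: divide_right_mono)
    also have "\<dots> = (\<Prod>i\<in>J. (f i x / c i) powr w i)"
      unfolding C_def prod_dividef[symmetric] using f0 c that by (intro prod.cong) (auto simp: powr_divide less_imp_le)
    also have "\<dots> \<le> (\<Sum>i\<in>J. w i * (f i x / c i))"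
      by (rule weighted_AM_GM) (use J w f0 c that in \<open>auto simp: less_imp_le\<close>)
    finally show ?thesis by simp
  qed
  then have "integral (cbox a b) (\<lambda>x. h x / C) \<le> integral (cbox a b) (\<lambda>x. \<Sum>i\<in>J. w i / c i * f i x)"
    by (intro integral_le integrable_continuous continuous_intros h f) (use C in auto)
  also have "\<dots> = (\<Sum>i\<in>J. w i / c i * c i)"
    unfolding c_def using J f by (subst integral_sum) (auto intro!: integrable_continuous continuous_on_mult_left simp del: times_divide_eq_left)
  also have "\<dots> = 1" unfolding w(2)[symmetric] using c by (intro sum.cong) (auto simp: less_imp_neq[symmetric])
  finally have "integral (cbox a b) h / C \<le> 1" by (simp add: divide_inverse)
  then show ?thesis using C by (simp add: C_def c_def)
qed

lemma integral_Cauchy_Schwarz: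
  fixes f g h :: "'a::euclidean_space \<Rightarrow> real"
  assumes "box a b \<noteq> {}" "continuous_on (cbox a b) h" "continuous_on (cbox a b) f" "continuous_on (cbox a b) g"
    and "\<And>x. x \<in> cbox a b \<Longrightarrow> 0 \<le> f x" "\<And>x. x \<in> cbox a b \<Longrightarrow> 0 \<le> g x"
    and "\<And>x. x \<in> cbox a b \<Longrightarrow> h x \<le> sqrt (f x) * sqrt (g x)"
  shows "integral (cbox a b) h \<le> sqrt (integral (cbox a b) f) * sqrt (integral (cbox a b) g)"
proof -
  have "integral (cbox a b) h \<le> (\<Prod>i\<in>UNIV. integral (cbox a b) ((\<lambda>i::bool. if i then f else g) i) powr (1/2))"
    by (rule integral_Hoelder) (use assms in \<open>auto simp: UNIV_bool powr_half_sqrt mult.commute split: if_splits\<close>)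
  also have "\<dots> = sqrt (integral (cbox a b) f) * sqrt (integral (cbox a b) g)"
    using assms by (simp add: UNIV_bool powr_half_sqrt integral_nonneg integrable_continuous)
  finally show ?thesis .
qed

text \<open>For \<open>k < pi / (b - a)\<close> the tangent centred at the midpoint \<open>c\<close>
  is finite on the interval, and \<open>(g x)\<^sup>2\<close> differs from
  \<open>(f' x)\<^sup>2 - k\<^sup>2 * (f x)\<^sup>2\<close> by the derivative of \<open>H\<close>,
  which vanishes at both ends. At the sharp frequency \<open>pi / (b - a)\<close> the tangent has
  poles at the ends, so this frequency is reached as a limit.\<close>

lemma Wirtinger_Dirichlet:
  fixes f f' :: "real \<Rightarrow> real"
  assumes "a < b" and f: "\<And>x. x \<in> {a..b} \<Longrightarrow> (f has_vector_derivative f' x) (at x within {a..b})"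
    and f': "continuous_on {a..b} f'" and "f a = 0" "f b = 0"
  shows "integral {a..b} (\<lambda>x. (f x)\<^sup>2) \<le> ((b - a) / pi)\<^sup>2 * integral {a..b} (\<lambda>x. (f' x)\<^sup>2)"
proof -
  define A where "A = integral {a..b} (\<lambda>x. (f x)\<^sup>2)"
  define A' where "A' = integral {a..b} (\<lambda>x. (f' x)\<^sup>2)"
  have cf: "continuous_on {a..b} f"
    by (rule continuous_on_vector_derivative[OF f])
  have main: "k\<^sup>2 * A \<le> A'" if k: "0 < k" "k < pi / (b - a)" for k
  proof -
    define c where "c = (a + b) / 2"
    have cos: "cos (k * (x - c)) > 0" if "x \<in> {a..b}" for x
    proof -
      have "k * \<bar>x - c\<bar> \<le> k * ((b - a) / 2)"
        using that k by (intro mult_left_mono) (auto simp: c_def abs_le_iff field_simps)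
      also have "\<dots> < pi / 2" using k \<open>a < b\<close> by (simp add: field_simps)
      finally have "\<bar>k * (x - c)\<bar> < pi / 2" using k by (simp add: abs_mult)
      then show ?thesis by (intro cos_gt_zero_pi) auto
    qed
    define H where "H x = k * (f x)\<^sup>2 * tan (k * (x - c))" for x
    define g where "g x = f' x + k * f x * tan (k * (x - c))" for x
    have "(H has_vector_derivative (g x)\<^sup>2 - (f' x)\<^sup>2 + k\<^sup>2 * (f x)\<^sup>2) (at x within {a..b})" if x: "x \<in> {a..b}" for x
    proof -
      have 1: "(f has_real_derivative f' x) (at x within {a..b})"
        using f[OF x] by (simp add: has_real_derivative_iff_has_vector_derivative)
      have t: "inverse ((cos (k * (x - c)))\<^sup>2) = 1 + (tan (k * (x - c)))\<^sup>2"
        using cos[OF x] by (simp add: tan_sec power_inverse)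
      have "((\<lambda>x. tan (k * (x - c))) has_real_derivative (1 + (tan (k * (x - c)))\<^sup>2) * k) (at x within {a..b})"
        using cos[OF x] unfolding t[symmetric] by (auto intro!: derivative_eq_intros)
      note d = DERIV_mult[OF DERIV_cmult[OF DERIV_power[OF 1, of 2], of k] this]
      have "(H has_real_derivative (g x)\<^sup>2 - (f' x)\<^sup>2 + k\<^sup>2 * (f x)\<^sup>2) (at x within {a..b})"
        unfolding H_def[abs_def] by (rule DERIV_cong[OF d]) (simp add: g_def power2_eq_square algebra_simps)
      then show ?thesis by (simp add: has_real_derivative_iff_has_vector_derivative)
    qed
    then have "((\<lambda>x. (g x)\<^sup>2 - (f' x)\<^sup>2 + k\<^sup>2 * (f x)\<^sup>2) has_integral H b - H a) {a..b}"
      using \<open>a < b\<close> by (intro fundamental_theorem_of_calculus) auto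
    then have i1: "((\<lambda>x. (g x)\<^sup>2 - (f' x)\<^sup>2 + k\<^sup>2 * (f x)\<^sup>2) has_integral 0) {a..b}"
      using assms by (simp add: H_def)
    have i2: "((\<lambda>x. (f' x)\<^sup>2 - k\<^sup>2 * (f x)\<^sup>2) has_integral A' - k\<^sup>2 * A) {a..b}"
      unfolding A_def A'_def by (intro has_integral_diff has_integral_mult_right integrable_integral
          integrable_continuous_real continuous_intros cf f')
    have "((\<lambda>x. (g x)\<^sup>2) has_integral A' - k\<^sup>2 * A) {a..b}"
      using has_integral_add[OF i1 i2] by simp
    then have "0 \<le> A' - k\<^sup>2 * A" by (rule has_integral_nonneg) simp
    then show ?thesis by simp
  qed
  have "((\<lambda>k. k\<^sup>2 * A) \<longlongrightarrow> (pi / (b - a))\<^sup>2 * A) (at_left (pi / (b - a)))"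
    by (intro tendsto_intros)
  moreover have "\<forall>\<^sub>F k in at_left (pi / (b - a)). k\<^sup>2 * A \<le> A'"
    using eventually_at_left_real[of 0 "pi / (b - a)"] \<open>a < b\<close>
    by (auto elim!: eventually_mono intro: main)
  ultimately have "(pi / (b - a))\<^sup>2 * A \<le> A'"
    by (rule tendsto_upperbound) simp
  then show ?thesis using \<open>a < b\<close> by (simp add: A_def A'_def power_divide field_simps)
qed

lemma periodic_integral_shift:
  fixes g :: "real \<Rightarrow> real"
  assumes g: "continuous_on UNIV g" and per: "\<And>x. g (x + L) = g x" and "0 \<le> c" "c \<le> L"
  shows "integral {c..c + L} g = integral {0..L} g"
proof -
  have i: "g integrable_on {x..y}" for x y
    by (intro integrable_continuous_real continuous_on_subset[OF g]) simp
  have "integral {0 + L..c + L} g = integral {0..c} (g \<circ> (+) L)"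
    using integral_shift_cbox_plus[of 0 c g L] by simp
  then have "integral {L..c + L} g = integral {0..c} g" by (simp add: o_def per add.commute[of L])
  moreover have "integral {c..L} g + integral {L..c + L} g = integral {c..c + L} g"
    using assms i by (intro HK_integral_combine) auto
  moreover have "integral {0..c} g + integral {c..L} g = integral {0..L} g"
    using assms i by (intro HK_integral_combine) auto
  ultimately show ?thesis by simp
qed

text \<open>A periodic function takes equal values at some pair of points half a period apart, so the
  Dirichlet inequality applies on both half periods after subtracting that value.\<close>

lemma Wirtinger_periodic:
  fixes f f' :: "real \<Rightarrow> real"
  assumes "L > 0" and f: "\<And>x. (f has_vector_derivative f' x) (at x)"
    and f': "continuous_on UNIV f'" and per: "\<And>x. f (x + L) = f x" "\<And>x. f' (x + L) = f' x"
    and mean: "integral {0..L} f = 0"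
  shows "integral {0..L} (\<lambda>x. (f x)\<^sup>2) \<le> (L / (2 * pi))\<^sup>2 * integral {0..L} (\<lambda>x. (f' x)\<^sup>2)"
proof -
  have cf: "continuous_on UNIV f"
    by (rule continuous_on_vector_derivative[OF has_vector_derivative_at_within[OF f]])
  have cf': "continuous_on S f" "continuous_on S f'" for S using cf f' continuous_on_subset by blast+
  define h where "h x = f (x + L/2) - f x" for x
  \<comment> \<open>The half-period shift reverses the sign of \<open>h\<close> between the two
    ends, so \<open>h\<close> has a zero \<open>c\<close> in \<open>{0..L/2}\<close>.\<close>
  have h: "h (L/2) = - h 0" using per(1)[of 0] by (simp add: h_def)
  have "continuous_on {0..L/2} h" unfolding h_def
    by (intro continuous_intros cf' continuous_on_compose2[OF cf]) auto
  then obtain c where c: "0 \<le> c" "c \<le> L/2" "h c = 0"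
    using IVT'[of h 0 0 "L/2"] IVT2'[of h "L/2" 0 0] \<open>L > 0\<close> h by (metis atLeastAtMost_iff le_cases
        neg_0_le_iff_le neg_le_0_iff_le divide_nonneg_pos less_imp_le zero_less_numeral)
  define k where "k = f c"
  have k: "f (c + L/2) = k" "f (c + L) = k" using c per(1)[of c] by (auto simp: k_def h_def)
  have half: "integral {d..d + L/2} (\<lambda>x. (f x - k)\<^sup>2) \<le> (L / (2 * pi))\<^sup>2 * integral {d..d + L/2} (\<lambda>x. (f' x)\<^sup>2)"
    if "f d = k" "f (d + L/2) = k" for d
  proof -
    have "integral {d..d + L/2} (\<lambda>x. (f x - k)\<^sup>2) \<le> ((d + L/2 - d) / pi)\<^sup>2 * integral {d..d + L/2} (\<lambda>x. (f' x)\<^sup>2)"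
      by (rule Wirtinger_Dirichlet)
         (use \<open>L > 0\<close> that in \<open>auto intro!: derivative_eq_intros has_vector_derivative_at_within[OF f] cf'\<close>)
    then show ?thesis by simp
  qed
  have comb: "integral {c..c + L} g = integral {c..c + L/2} g + integral {c + L/2..c + L/2 + L/2} g"
    if "continuous_on UNIV g" for g :: "real \<Rightarrow> real"
    using HK_integral_combine[of c "c + L/2" "c + L" g] \<open>L > 0\<close>
    by (simp add: add.assoc integrable_continuous_real continuous_on_subset[OF that])
  \<comment> \<open>Shifting a function of mean zero by a constant can only increase the integral of
    its square.\<close>
  have "integral {0..L} (\<lambda>x. (f x)\<^sup>2) \<le> integral {0..L} (\<lambda>x. (f x)\<^sup>2) + L * k\<^sup>2"
    using \<open>L > 0\<close> by simp
  also have "\<dots> = integral {0..L} (\<lambda>x. (f x - k)\<^sup>2)"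
  proof -
    have "((\<lambda>x. (f x)\<^sup>2 - 2 * k * f x + k\<^sup>2) has_integral
        integral {0..L} (\<lambda>x. (f x)\<^sup>2) - 2 * k * integral {0..L} f + L *\<^sub>R k\<^sup>2) {0..L}"
      using has_integral_const_real[of "k\<^sup>2" 0 L] \<open>L > 0\<close>
      by (intro has_integral_add has_integral_diff has_integral_mult_right integrable_integral
          integrable_continuous_real continuous_intros cf') auto
    then show ?thesis by (simp add: mean power2_diff integral_unique algebra_simps)
  qed
  also have "\<dots> = integral {c..c + L} (\<lambda>x. (f x - k)\<^sup>2)"
    by (rule periodic_integral_shift[symmetric]) (use c \<open>L > 0\<close> per in \<open>auto intro!: continuous_intros cf'\<close>)
  also have "\<dots> = integral {c..c + L/2} (\<lambda>x. (f x - k)\<^sup>2) + integral {c + L/2..c + L/2 + L/2} (\<lambda>x. (f x - k)\<^sup>2)"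
    by (rule comb) (intro continuous_intros cf')
  also have "\<dots> \<le> (L / (2 * pi))\<^sup>2 * integral {c..c + L/2} (\<lambda>x. (f' x)\<^sup>2)
      + (L / (2 * pi))\<^sup>2 * integral {c + L/2..c + L/2 + L/2} (\<lambda>x. (f' x)\<^sup>2)"
    by (intro add_mono half) (use k in \<open>auto simp: k_def add.assoc\<close>)
  also have "\<dots> = (L / (2 * pi))\<^sup>2 * integral {c..c + L} (\<lambda>x. (f' x)\<^sup>2)"
    by (subst comb) (auto intro!: continuous_intros cf' simp: algebra_simps)
  also have "integral {c..c + L} (\<lambda>x. (f' x)\<^sup>2) = integral {0..L} (\<lambda>x. (f' x)\<^sup>2)"
    by (rule periodic_integral_shift) (use c \<open>L > 0\<close> per in \<open>auto intro!: continuous_intros cf'\<close>)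
  finally show ?thesis .
qed

section \<open>Supremum of a function on an interval in terms of its mean and variation\<close>

context
  fixes f f' :: "real \<Rightarrow> real" and L :: real
  assumes L: "0 < L" and f: "\<And>x. x \<in> {0..L} \<Longrightarrow> (f has_vector_derivative f' x) (at x within {0..L})"
    and f': "continuous_on {0..L} f'"
begin

private lemma int_f': "(\<lambda>x. \<bar>f' x\<bar>) integrable_on {a..b}" if "{a..b} \<subseteq> {0..L}"
  by (intro integrable_continuous_real continuous_intros continuous_on_subset[OF f' that])

private lemma diff_le: "\<bar>f b - f a\<bar> \<le> integral {a..b} (\<lambda>x. \<bar>f' x\<bar>)" if "0 \<le> a" "a \<le> b" "b \<le> L"
proof -
  have "(f' has_integral f b - f a) {a..b}"
    using that by (intro fundamental_theorem_of_calculus)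
      (auto intro: has_vector_derivative_within_subset[OF f])
  then have i: "f' integrable_on {a..b}" "integral {a..b} f' = f b - f a" by auto
  have "norm (integral {a..b} f') \<le> integral {a..b} (\<lambda>x. \<bar>f' x\<bar>)"
    by (rule integral_norm_bound_integral[OF i(1) int_f']) (use that in auto)
  then show ?thesis by (simp add: i)
qed

private lemma cont_f: "continuous_on {0..L} f"
  by (rule continuous_on_vector_derivative[OF f])

lemma oscillation_le: "x \<in> {0..L} \<Longrightarrow> y \<in> {0..L} \<Longrightarrow> \<bar>f x - f y\<bar> \<le> integral {0..L} (\<lambda>x. \<bar>f' x\<bar>)"
proof (induction x y rule: linorder_wlog)
  case (le x y)
  have "\<bar>f y - f x\<bar> \<le> integral {x..y} (\<lambda>x. \<bar>f' x\<bar>)" by (rule diff_le) (use le in auto)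
  also have "\<dots> \<le> integral {0..L} (\<lambda>x. \<bar>f' x\<bar>)"
    by (rule integral_subset_le) (use le in \<open>auto intro!: int_f'\<close>)
  finally show ?case by (simp add: abs_minus_commute)
qed (auto simp: abs_minus_commute)

text \<open>On a closed loop two points are joined by two arcs. The variations along them add up to
  the total, so the two bounds average to one half of it. The gain enters the Sobolev constant
  through the periodic directions.\<close>

lemma oscillation_closed_le:
  assumes "f 0 = f L"
  shows "x \<in> {0..L} \<Longrightarrow> y \<in> {0..L} \<Longrightarrow> \<bar>f x - f y\<bar> \<le> 1/2 * integral {0..L} (\<lambda>x. \<bar>f' x\<bar>)"
proof (induction x y rule: linorder_wlog)
  case (le x y)
  have "\<bar>f y - f x\<bar> \<le> integral {x..y} (\<lambda>x. \<bar>f' x\<bar>)" "\<bar>f x - f 0\<bar> \<le> integral {0..x} (\<lambda>x. \<bar>f' x\<bar>)"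
    "\<bar>f L - f y\<bar> \<le> integral {y..L} (\<lambda>x. \<bar>f' x\<bar>)"
    by (rule diff_le; use le in auto)+
  moreover have "integral {0..x} (\<lambda>x. \<bar>f' x\<bar>) + integral {x..L} (\<lambda>x. \<bar>f' x\<bar>) = integral {0..L} (\<lambda>x. \<bar>f' x\<bar>)"
    "integral {x..y} (\<lambda>x. \<bar>f' x\<bar>) + integral {y..L} (\<lambda>x. \<bar>f' x\<bar>) = integral {x..L} (\<lambda>x. \<bar>f' x\<bar>)"
    by (rule HK_integral_combine; use le in \<open>auto intro!: int_f'\<close>)+
  ultimately show ?case using assms by linarith
qed (auto simp: abs_minus_commute)

text \<open>Average the bound of the value at \<open>x\<close> by the value at \<open>y\<close> plus
  \<open>R\<close> over \<open>y\<close>.\<close>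

private lemma mean_plus_oscillation:
  assumes "x \<in> {0..L}" "\<And>y. y \<in> {0..L} \<Longrightarrow> \<bar>f x - f y\<bar> \<le> R"
  shows "\<bar>f x\<bar> \<le> 1/L * integral {0..L} (\<lambda>x. \<bar>f x\<bar>) + R"
proof -
  have "integral {0..L} (\<lambda>y. \<bar>f x\<bar>) \<le> integral {0..L} (\<lambda>y. \<bar>f y\<bar> + R)"
    by (intro integral_le integrable_continuous_real continuous_intros cont_f)
       (use assms(2) in fastforce)
  also have "\<dots> = integral {0..L} (\<lambda>y. \<bar>f y\<bar>) + L * R"
    using L by (subst integral_add) (auto intro!: integrable_continuous_real continuous_intros cont_f)
  finally show ?thesis using L by (simp add: field_simps)
qed

lemma sup_le_mean_plus:
  "x \<in> {0..L} \<Longrightarrow> \<bar>f x\<bar> \<le> 1/L * integral {0..L} (\<lambda>x. \<bar>f x\<bar>) + integral {0..L} (\<lambda>x. \<bar>f' x\<bar>)"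
  by (rule mean_plus_oscillation) (auto intro: oscillation_le)

lemma sup_le_mean_plus_half:
  "f 0 = f L \<Longrightarrow> x \<in> {0..L} \<Longrightarrow> \<bar>f x\<bar> \<le> 1/L * integral {0..L} (\<lambda>x. \<bar>f x\<bar>) + 1/2 * integral {0..L} (\<lambda>x. \<bar>f' x\<bar>)"
  by (rule mean_plus_oscillation) (auto dest: oscillation_closed_le)

end

section \<open>Integration over the box\<close>

lemma cbox_vec3: "cbox (vec3 a b c) (vec3 a' b' c') =
    {x. a \<le> x$1 \<and> x$1 \<le> a' \<and> b \<le> x$2 \<and> x$2 \<le> b' \<and> c \<le> x$3 \<and> x$3 \<le> c'}"
  by (auto simp: mem_box_cart forall_3)

lemma V_cbox: "V Lx Ly = cbox 0 (vec3 Lx Ly 1)"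
  by (auto simp: V_def mem_box_cart forall_3)

lemma V_subset_slab: "V Lx Ly \<subseteq> slab" by (auto simp: V_def slab_def)

text \<open>\<open>real^3\<close> is not a product type, so iterated integration has to pass through
  triples of reals. The two measures agree on open boxes, which determines them.\<close>

lemma lborel_vec3: "(lborel :: (real^3) measure) =
    distr (lborel \<Otimes>\<^sub>M (lborel \<Otimes>\<^sub>M lborel)) borel (\<lambda>(x, y, z). vec3 x y z)"
proof (rule lborel_eqI)
  have meas: "(\<lambda>(x, y, z). vec3 x y z) \<in> borel \<Otimes>\<^sub>M (borel \<Otimes>\<^sub>M borel) \<rightarrow>\<^sub>M borel"
    unfolding borel_prod
    by (intro borel_measurable_continuous_onI) (auto simp: split_beta intro!: continuous_intros)
  fix l u :: "real^3" assume lu: "\<And>b. b \<in> Basis \<Longrightarrow> l \<bullet> b \<le> u \<bullet> b"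
  have le: "l $ i \<le> u $ i" for i using lu[of "axis i 1"] by (simp add: inner_axis)
  have "(\<lambda>(x, y, z). vec3 x y z) -` box l u \<inter> space (lborel \<Otimes>\<^sub>M (lborel \<Otimes>\<^sub>M lborel))
      = {l$1<..<u$1} \<times> ({l$2<..<u$2} \<times> {l$3<..<u$3})"
    by (auto simp: mem_box_cart forall_3 space_pair_measure)
  then have "emeasure (distr (lborel \<Otimes>\<^sub>M (lborel \<Otimes>\<^sub>M lborel)) borel (\<lambda>(x, y, z). vec3 x y z)) (box l u)
      = emeasure (lborel \<Otimes>\<^sub>M (lborel \<Otimes>\<^sub>M lborel)) ({l$1<..<u$1} \<times> ({l$2<..<u$2} \<times> {l$3<..<u$3}))"
    using meas by (subst emeasure_distr) auto
  also have "\<dots> = ennreal (u$1 - l$1) * (ennreal (u$2 - l$2) * ennreal (u$3 - l$3))"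
    using lborel.emeasure_pair_measure_Times[of "{l$1<..<u$1}" lborel "{l$2<..<u$2} \<times> {l$3<..<u$3}"]
      lborel.emeasure_pair_measure_Times[of "{l$2<..<u$2}" lborel "{l$3<..<u$3}"]
    by (simp add: le borel_open open_Times lborel_prod[where 'a=real and 'b=real])
  also have "\<dots> = (\<Prod>b\<in>Basis. (u - l) \<bullet> b)"
  proof -
    have "(\<Prod>b\<in>Basis. (u - l) \<bullet> b) = (\<Prod>i\<in>UNIV. (u - l) $ i)"
    proof -
      have B: "(Basis :: (real^3) set) = range (\<lambda>i::3. axis i (1::real))" by (auto simp: Basis_vec_def)
      have inj: "inj (\<lambda>i::3. axis i (1::real))" by (simp add: inj_on_def axis_eq_axis)
      show ?thesis unfolding B prod.reindex[OF inj] comp_def inner_axis by simp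
    qed
    also have "\<dots> = (u$1 - l$1) * (u$2 - l$2) * (u$3 - l$3)"
      unfolding UNIV_3 by simp
    finally show ?thesis by (simp only: ennreal_mult le mult.assoc diff_ge_0_iff_ge mult_nonneg_nonneg)
  qed
  finally show "emeasure (distr (lborel \<Otimes>\<^sub>M (lborel \<Otimes>\<^sub>M lborel)) borel (\<lambda>(x, y, z). vec3 x y z)) (box l u)
    = (\<Prod>b\<in>Basis. (u - l) \<bullet> b)" .
qed simp

lemma integral_lebesgue_on_cbox:
  fixes f :: "'a::euclidean_space \<Rightarrow> real"
  assumes "continuous_on (cbox a b) f"
  shows "integral\<^sup>L (lebesgue_on (cbox a b)) f = integral (cbox a b) f"
    and "integrable (lebesgue_on (cbox a b)) f"
  using continuous_imp_integrable[OF assms] lebesgue_integral_eq_integral[of "cbox a b" f] by auto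

lemma integral_vec3:
  fixes f :: "real^3 \<Rightarrow> real"
  assumes f: "continuous_on (cbox (vec3 a b c) (vec3 a' b' c')) f"
  shows "integral (cbox (vec3 a b c) (vec3 a' b' c')) f =
    integral {a..a'} (\<lambda>x. integral {b..b'} (\<lambda>y. integral {c..c'} (\<lambda>z. f (vec3 x y z))))"
proof -
  let ?g = "\<lambda>p::real \<times> real \<times> real. vec3 (fst p) (fst (snd p)) (snd (snd p))"
  let ?C = "cbox (vec3 a b c) (vec3 a' b' c')" and ?D = "cbox (a, b, c) (a', b', c')"
  have CD: "?g p \<in> ?C \<longleftrightarrow> p \<in> ?D" for p
    by (cases p) (simp only: cbox_Pair_iff cbox_vec3 mem_Collect_eq vector_3 fst_conv snd_conv
        cbox_interval[where 'a=real] atLeastAtMost_iff conj_assoc)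
  have cont: "continuous_on ?D (\<lambda>p. f (?g p))"
    by (rule continuous_on_compose2[OF f]) (auto simp: cbox_vec3 cbox_Pair_eq intro!: continuous_intros)
  have meas: "?g \<in> borel_measurable borel"
    by (intro borel_measurable_continuous_onI continuous_intros)
  have "integral ?C f = (LINT x : ?C | lborel. f x)"
    by (rule set_borel_integral_eq_integral(2)[symmetric])
       (unfold set_integrable_def, intro borel_integrable_compact f compact_cbox)
  also have "\<dots> = (LINT p : ?D | lborel. f (?g p))"
  proof -
    have "(LINT x : ?C | lborel. f x) = (LINT x | distr lborel borel ?g. indicator ?C x *\<^sub>R f x)"
      unfolding set_lebesgue_integral_def by (subst lborel_vec3) (simp only: lborel_prod case_prod_unfold)
    also have "\<dots> = (LINT p | lborel. indicator ?C (?g p) *\<^sub>R f (?g p))"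
    proof (rule integral_distr)
      show "?g \<in> borel_measurable lborel" using meas by simp
      show "(\<lambda>x. indicator ?C x *\<^sub>R f x) \<in> borel_measurable borel"
        using borel_measurable_integrable[OF borel_integrable_compact[OF compact_cbox f]]
        by (simp only: measurable_lborel2)
    qed
    also have "\<dots> = (LINT p : ?D | lborel. f (?g p))"
      unfolding set_lebesgue_integral_def
      by (simp only: indicator_def CD)
    finally show ?thesis .
  qed
  also have "\<dots> = integral ?D (\<lambda>p. f (?g p))"
    by (rule set_borel_integral_eq_integral(2))
       (unfold set_integrable_def, intro borel_integrable_compact cont compact_cbox)
  also have "\<dots> = integral (cbox a a') (\<lambda>x. integral (cbox (b, c) (b', c')) (\<lambda>q. f (?g (x, q))))"
    by (rule integral_prod_continuous) (rule cont)
  also have "\<dots> = integral (cbox a a') (\<lambda>x. integral (cbox b b') (\<lambda>y. integral (cbox c c') (\<lambda>z. f (?g (x, y, z)))))"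
    by (intro HK_integral_cong integral_prod_continuous continuous_on_compose2[OF cont])
       (auto simp: cbox_Pair_eq intro!: continuous_intros)
  finally show ?thesis by simp
qed

lemma continuous_on_vec3_slab:
  assumes "continuous_on slab f" "continuous_on S a" "continuous_on S b" "continuous_on S c"
    "\<And>x. x \<in> S \<Longrightarrow> 0 \<le> c x \<and> c x \<le> 1"
  shows "continuous_on S (\<lambda>x. f (vec3 (a x) (b x) (c x)))"
  by (rule continuous_on_compose2[OF assms(1)]) (use assms in \<open>auto intro!: continuous_intros\<close>)

text \<open>The innermost variable is the one along which a one-dimensional inequality or the
  fundamental theorem is applied, and the outer pairs are the variables of the factors
  \<open>g1\<close>, \<open>g2\<close>, \<open>g3\<close> in the Sobolev inequality; hence the
  different orders.\<close>

lemma
  fixes f :: "real^3 \<Rightarrow> real"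
  assumes f: "continuous_on slab f"
  shows integral_V_xyz: "integral (V Lx Ly) f =
      integral {0..Lx} (\<lambda>x. integral {0..Ly} (\<lambda>y. integral {0..1} (\<lambda>z. f (vec3 x y z))))"
    and integral_V_xzy: "integral (V Lx Ly) f =
      integral {0..Lx} (\<lambda>x. integral {0..1} (\<lambda>z. integral {0..Ly} (\<lambda>y. f (vec3 x y z))))"
    and integral_V_yzx: "integral (V Lx Ly) f =
      integral {0..Ly} (\<lambda>y. integral {0..1} (\<lambda>z. integral {0..Lx} (\<lambda>x. f (vec3 x y z))))"
    and integral_V_zxy: "integral (V Lx Ly) f =
      integral {0..1} (\<lambda>z. integral {0..Lx} (\<lambda>x. integral {0..Ly} (\<lambda>y. f (vec3 x y z))))"
    and integral_V_zyx: "integral (V Lx Ly) f =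
      integral {0..1} (\<lambda>z. integral {0..Ly} (\<lambda>y. integral {0..Lx} (\<lambda>x. f (vec3 x y z))))"
proof -
  have V: "V Lx Ly = cbox (vec3 0 0 0) (vec3 Lx Ly 1)" by (auto simp: cbox_vec3 V_def)
  have s: "continuous_on S (\<lambda>x. f (vec3 (a x) (b x) (c x)))"
    if "continuous_on S a" "continuous_on S b" "continuous_on S c" "\<And>x. x \<in> S \<Longrightarrow> 0 \<le> c x \<and> c x \<le> 1"
    for S :: "'s::topological_space set" and a b c
    by (rule continuous_on_vec3_slab[OF f that])
  have ci: "continuous_on (cbox (a::real \<times> real) b) (\<lambda>p. integral {c..d} (g p))"
    if "continuous_on (cbox a b \<times> {c..d}) (\<lambda>p. g (fst p) (snd p))"
    for g :: "real \<times> real \<Rightarrow> real \<Rightarrow> real" and a b c d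
    using integral_continuous_on_param[of "cbox a b" c d g] that by (simp add: case_prod_unfold)
  note sw = integral_swap_continuous[where 'a=real and 'b=real, unfolded cbox_interval[where 'a=real]]
  show xyz: "integral (V Lx Ly) f =
      integral {0..Lx} (\<lambda>x. integral {0..Ly} (\<lambda>y. integral {0..1} (\<lambda>z. f (vec3 x y z))))"
    unfolding V by (rule integral_vec3) (rule continuous_on_subset[OF f], auto simp: cbox_vec3 slab_def)
  have yxz: "integral (V Lx Ly) f =
      integral {0..Ly} (\<lambda>y. integral {0..Lx} (\<lambda>x. integral {0..1} (\<lambda>z. f (vec3 x y z))))"
    unfolding xyz
    by (rule sw, unfold case_prod_unfold, rule ci) (auto simp: cbox_Pair_eq intro!: continuous_intros s)
  show xzy: "integral (V Lx Ly) f =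
      integral {0..Lx} (\<lambda>x. integral {0..1} (\<lambda>z. integral {0..Ly} (\<lambda>y. f (vec3 x y z))))"
    unfolding xyz
    by (intro HK_integral_cong sw)
       (auto simp: split_beta cbox_Pair_eq intro!: continuous_intros s)
  show yzx: "integral (V Lx Ly) f =
      integral {0..Ly} (\<lambda>y. integral {0..1} (\<lambda>z. integral {0..Lx} (\<lambda>x. f (vec3 x y z))))"
    unfolding yxz
    by (intro HK_integral_cong sw)
       (auto simp: split_beta cbox_Pair_eq intro!: continuous_intros s)
  show "integral (V Lx Ly) f =
      integral {0..1} (\<lambda>z. integral {0..Lx} (\<lambda>x. integral {0..Ly} (\<lambda>y. f (vec3 x y z))))"
    unfolding xzy
    by (rule sw, unfold case_prod_unfold, rule ci) (auto simp: cbox_Pair_eq intro!: continuous_intros s)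
  show "integral (V Lx Ly) f =
      integral {0..1} (\<lambda>z. integral {0..Ly} (\<lambda>y. integral {0..Lx} (\<lambda>x. f (vec3 x y z))))"
    unfolding yzx
    by (rule sw, unfold case_prod_unfold, rule ci) (auto simp: cbox_Pair_eq intro!: continuous_intros s)
qed

lemma xy_periodicD1: "xy_periodic Lx Ly f \<Longrightarrow> z \<in> {0..1} \<Longrightarrow> f (vec3 Lx y z) = f (vec3 0 y z)"
  and xy_periodicD2: "xy_periodic Lx Ly f \<Longrightarrow> z \<in> {0..1} \<Longrightarrow> f (vec3 x Ly z) = f (vec3 x 0 z)"
proof -
  assume p: "xy_periodic Lx Ly f" and z: "z \<in> {0..1}"
  have "vec3 Lx y z = vec3 0 y z + Lx *\<^sub>R axis 1 1" "vec3 x Ly z = vec3 x 0 z + Ly *\<^sub>R axis 2 1"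
    by (simp_all add: vec3_axis)
  then show "f (vec3 Lx y z) = f (vec3 0 y z)" "f (vec3 x Ly z) = f (vec3 x 0 z)"
    using p z by (simp_all only: xy_periodic_def vec3_slab atLeastAtMost_iff simp_thms)
qed

lemma xy_periodic_line:
  assumes "xy_periodic Lx Ly f" "z \<in> {0..1}"
  shows "f (vec3 (x + Lx) y z) = f (vec3 x y z)" "f (vec3 x (y + Ly) z) = f (vec3 x y z)"
proof -
  have "vec3 (x + Lx) y z = vec3 x y z + Lx *\<^sub>R axis 1 1" "vec3 x (y + Ly) z = vec3 x y z + Ly *\<^sub>R axis 2 1"
    by (simp_all add: vec3_axis algebra_simps)
  then show "f (vec3 (x + Lx) y z) = f (vec3 x y z)" "f (vec3 x (y + Ly) z) = f (vec3 x y z)"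
    using assms by (simp_all only: xy_periodic_def vec3_slab atLeastAtMost_iff)
qed

lemma xy_periodic_mult: "xy_periodic Lx Ly f \<Longrightarrow> xy_periodic Lx Ly g \<Longrightarrow> xy_periodic Lx Ly (\<lambda>x. f x * g x)"
  by (simp add: xy_periodic_def)

lemma xy_periodic_component: "xy_periodic Lx Ly f \<Longrightarrow> xy_periodic Lx Ly (\<lambda>x. f x $ i)"
  by (simp add: xy_periodic_def)

text \<open>Along horizontal lines the end values agree by periodicity; only vertical lines need the
  wall values.\<close>

lemma integral_V_pd:
  fixes f :: "real^3 \<Rightarrow> real"
  assumes f: "C1 f" and per: "xy_periodic Lx Ly f" and "Lx > 0" "Ly > 0"
    and bdry: "j = 3 \<Longrightarrow> (\<And>x y. f (vec3 x y 0) = 0 \<and> f (vec3 x y 1) = 0)"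
  shows "integral (V Lx Ly) (pd j f) = 0"
proof -
  consider "j = 1" | "j = 2" | "j = 3" using exhaust_3 by blast
  then show ?thesis
  proof cases
    case 1
    have 0: "integral {0..Lx} (\<lambda>x. pd 1 f (vec3 x y z)) = 0" if "z \<in> {0..1}" for y z
      using fundamental_theorem_of_calculus[of 0 Lx "\<lambda>x. f (vec3 x y z)"] C1_line1[OF f that] xy_periodicD1[OF per that]
        \<open>Lx > 0\<close> by (force intro!: integral_unique)
    have "integral {0..1} (\<lambda>z. integral {0..Ly} (\<lambda>y. integral {0..Lx} (\<lambda>x. pd 1 f (vec3 x y z)))) = integral {0..1::real} (\<lambda>z. 0)"
      by (rule HK_integral_cong) (simp add: 0)
    then show ?thesis unfolding 1 using integral_V_zyx[OF C1_continuous_pd[OF f, of 1]] by simp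
  next
    case 2
    have 0: "integral {0..Ly} (\<lambda>y. pd 2 f (vec3 x y z)) = 0" if "z \<in> {0..1}" for x z
      using fundamental_theorem_of_calculus[of 0 Ly "\<lambda>y. f (vec3 x y z)"] C1_line2[OF f that] xy_periodicD2[OF per that]
        \<open>Ly > 0\<close> by (force intro!: integral_unique)
    have "integral {0..1} (\<lambda>z. integral {0..Lx} (\<lambda>x. integral {0..Ly} (\<lambda>y. pd 2 f (vec3 x y z)))) = integral {0..1::real} (\<lambda>z. 0)"
      by (rule HK_integral_cong) (simp add: 0)
    then show ?thesis unfolding 2 using integral_V_zxy[OF C1_continuous_pd[OF f, of 2]] by simp
  next
    case 3
    have "integral {0..1} (\<lambda>z. pd 3 f (vec3 x y z)) = 0" for x y
      using fundamental_theorem_of_calculus[of 0 1 "\<lambda>z. f (vec3 x y z)"] C1_line3[OF f] bdry[OF 3]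
      by (force intro!: integral_unique)
    then show ?thesis unfolding 3 using integral_V_xyz[OF C1_continuous_pd[OF f, of 3]] by simp
  qed
qed

lemma integrable_V:
  fixes f :: "real^3 \<Rightarrow> real"
  shows "continuous_on slab f \<Longrightarrow> f integrable_on V Lx Ly"
  unfolding V_cbox by (intro integrable_continuous) (use V_subset_slab V_cbox continuous_on_subset in metis)

lemma integral_V_by_parts:
  fixes f g :: "real^3 \<Rightarrow> real"
  assumes f: "C1 f" "xy_periodic Lx Ly f" and g: "C1 g" "xy_periodic Lx Ly g" and L: "Lx > 0" "Ly > 0"
    and bdry: "j = 3 \<Longrightarrow> (\<And>x y. f (vec3 x y 0) * g (vec3 x y 0) = 0 \<and> f (vec3 x y 1) * g (vec3 x y 1) = 0)"
  shows "integral (V Lx Ly) (\<lambda>x. f x * pd j g x) = - integral (V Lx Ly) (\<lambda>x. pd j f x * g x)"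
proof -
  have "0 = integral (V Lx Ly) (pd j (\<lambda>x. f x * g x))"
    using integral_V_pd[OF C1_mult[OF f(1) g(1)] xy_periodic_mult[OF f(2) g(2)] L, of j] bdry by simp
  also have "\<dots> = integral (V Lx Ly) (\<lambda>x. pd j f x * g x + f x * pd j g x)"
    by (intro HK_integral_cong pd_mult f g) (use V_subset_slab in blast)
  also have "\<dots> = integral (V Lx Ly) (\<lambda>x. pd j f x * g x) + integral (V Lx Ly) (\<lambda>x. f x * pd j g x)"
    by (intro HK_integral_add integrable_V continuous_intros
        C1_continuous C1_continuous_pd f g)
  finally show ?thesis by simp
qed

section \<open>The vertical primitive\<close>

text \<open>Rescaling to the unit interval moves the variable end point into the integrand, so that
  the primitive can be differentiated under an integral with fixed limits.\<close>

lemma Tbar_eq: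
  assumes "continuous_on slab f" "x \<in> slab"
  shows "Tbar f x = x$3 * integral {0..1} (\<lambda>s. f (vec3 (x$1) (x$2) (x$3 * s)))"
proof -
  let ?f = "\<lambda>z. f (vec3 (x$1) (x$2) z)"
  have z: "0 \<le> x$3" "x$3 \<le> 1" using assms(2) by (auto simp: slab_def)
  have c: "continuous_on {0..x$3} ?f"
    by (rule continuous_on_vec3_slab[OF assms(1)]) (use z in \<open>auto intro!: continuous_intros\<close>)
  have "Tbar f x = integral {0..x$3} ?f"
    unfolding Tbar_def using integral_lebesgue_on_cbox(1)[of 0 "x$3" ?f] c by simp
  also have "\<dots> = integral {0..1} (\<lambda>s. x$3 * ?f (x$3 * s))"
  proof (cases "x$3 = 0")
    case False
    have "((\<lambda>s. x$3 *\<^sub>R ?f (x$3 * s)) has_integral integral {x$3 * 0..x$3 * 1} ?f) {0..1}"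
      by (rule has_integral_substitution[of 0 1 "\<lambda>s. x$3 * s" 0 "x$3"])
         (use z c False in \<open>auto intro!: derivative_eq_intros simp: mult_left_le\<close>)
    from integral_unique[OF this] show ?thesis by (simp only: mult_zero_right mult_1_right real_scaleR_def)
  qed simp
  finally show ?thesis by simp
qed

lemma continuous_on_Tbar:
  assumes "continuous_on slab f"
  shows "continuous_on slab (Tbar f)"
proof -
  have "continuous_on slab (\<lambda>x. integral (cbox 0 1) (\<lambda>s. f (vec3 (x$1) (x$2) (x$3 * s))))"
    by (rule integral_continuous_on_param)
       (auto simp: case_prod_unfold slab_def mult_le_one intro!: continuous_on_vec3_slab[OF assms] continuous_intros)
  then have "continuous_on slab (\<lambda>x. x$3 * integral {0..1} (\<lambda>s. f (vec3 (x$1) (x$2) (x$3 * s))))"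
    by (intro continuous_intros) simp
  then show ?thesis by (rule continuous_on_cong[THEN iffD1, rotated -1]) (simp_all add: Tbar_eq assms)
qed

text \<open>\<open>Tbar f\<close> is \<open>x$3 * G x\<close>, and \<open>G\<close> is
  differentiated under the integral sign. Horizontal derivatives simply pass inside; the vertical
  one is \<open>G\<close> plus \<open>x$3\<close> times its vertical derivative and has to be
  recombined into \<open>f\<close>.\<close>

lemma
  fixes f :: "real^3 \<Rightarrow> real"
  assumes f: "C1 f"
  shows C1_Tbar: "C1 (Tbar f)"
    and pd_Tbar: "x \<in> slab \<Longrightarrow> pd j (Tbar f) x = (if j = 3 then f x else Tbar (pd j f) x)"
proof -
  define A where "A s x = vec3 (x$1) (x$2) (x$3 * s)" for s and x :: "real^3"
  define G where "G x = integral (cbox 0 1) (\<lambda>s. f (A s x))" for x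
  \<comment> \<open>Gradient of \<open>f (A s x)\<close> with respect to \<open>x\<close>; the
    factor \<open>s\<close> comes from the rescaled third coordinate.\<close>
  define g where "g x s = vec3 (pd 1 f (A s x)) (pd 2 f (A s x)) (s * pd 3 f (A s x))" for x s
  have As: "A s x \<in> slab" if "x \<in> slab" "s \<in> {0..1}" for x s
    using that by (auto simp: A_def slab_def mult_le_one)
  have cA: "continuous_on S (\<lambda>p. h (A (a p) (b p)))"
    if "continuous_on slab h" "continuous_on S a" "continuous_on S b" "\<And>p. p \<in> S \<Longrightarrow> a p \<in> {0..1} \<and> b p \<in> slab"
    for S :: "'s::topological_space set" and a b and h :: "real^3 \<Rightarrow> real"
    unfolding A_def by (rule continuous_on_vec3_slab[OF that(1)])
      (use that in \<open>force simp: slab_def intro!: mult_le_one continuous_intros\<close>)+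
  have cg: "continuous_on S (\<lambda>p. g (b p) (a p))"
    if "continuous_on S a" "continuous_on S b" "\<And>p. p \<in> S \<Longrightarrow> a p \<in> {0..1} \<and> b p \<in> slab"
    for S :: "'s::topological_space set" and a b
    unfolding g_def by (intro continuous_intros cA C1_continuous_pd f that)
  have cgx: "continuous_on {0..1} (g x)" if "x \<in> slab" for x
    by (rule cg) (use that in \<open>auto intro: continuous_intros\<close>)
  have dG: "(G has_derivative (\<lambda>h. integral {0..1} (g x) \<bullet> h)) (at x within slab)" if x: "x \<in> slab" for x
  proof -
    have "(G has_derivative blinfun_apply (integral (cbox 0 1) (\<lambda>s. blinfun_inner_right (g x s)))) (at x within slab)"
      unfolding G_def[abs_def]
    proof (rule leibniz_rule[OF _ _ _ x convex_slab])
      fix x :: "real^3" and s :: real assume x: "x \<in> slab" and s: "s \<in> cbox 0 1"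
      have dA: "(A s has_derivative A s) (at x within slab)"
      proof -
        have "bounded_linear (A s)"
          unfolding A_def vec3_axis by (intro bounded_linear_intros bounded_linear_vec_nth)
        then show ?thesis by (rule bounded_linear_imp_has_derivative)
      qed
      have "((\<lambda>x. f (A s x)) has_derivative (\<lambda>h. \<Sum>j\<in>UNIV. (A s h)$j *\<^sub>R pd j f (A s x))) (at x within slab)"
        by (rule has_derivative_in_compose[OF dA has_derivative_subset[OF has_derivative_pd[OF C1_differentiable[OF f]]]])
           (use As s x in auto)
      moreover have "(\<lambda>h. \<Sum>j\<in>UNIV. (A s h)$j *\<^sub>R pd j f (A s x)) = blinfun_apply (blinfun_inner_right (g x s))"
        by (auto simp: fun_eq_iff g_def A_def sum_3 inner_vec_def algebra_simps)
      ultimately show "((\<lambda>x. f (A s x)) has_derivative blinfun_apply (blinfun_inner_right (g x s))) (at x within slab)"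
        by simp
    next
      show "(\<lambda>s. f (A s x)) integrable_on cbox 0 1" if "x \<in> slab" for x
        by (rule integrable_continuous) (use that in \<open>auto intro!: cA C1_continuous[OF f] continuous_intros\<close>)
      have "continuous_on (slab \<times> cbox 0 1) (\<lambda>p. g (fst p) (snd p))"
        by (rule cg) (auto intro!: continuous_intros)
      then show "continuous_on (slab \<times> cbox 0 1) (\<lambda>(x, t). blinfun_inner_right (g x t))"
        unfolding case_prod_unfold
        by (rule bounded_linear.continuous_on[OF bounded_linear_blinfun_inner_right])
    qed
    moreover have "integral (cbox 0 1) (\<lambda>s. blinfun_inner_right (g x s)) = blinfun_inner_right (integral (cbox 0 1) (g x))"
      using integral_linear[OF integrable_continuous bounded_linear_blinfun_inner_right, of 0 1 "g x"] cgx[OF x]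
      by (simp add: o_def)
    ultimately show ?thesis by simp
  qed
  have gi: "integral {0..1} (g x) $ j = integral {0..1} (\<lambda>s. g x s $ j)" if "x \<in> slab" for x j
    using integral_linear[OF integrable_continuous bounded_linear_vec_nth, of 0 1 "g x" j] cgx[OF that]
    by (simp add: o_def)
  have eq: "Tbar h x = x$3 * integral {0..1} (\<lambda>s. h (A s x))" if "x \<in> slab" "continuous_on slab h" for x h
    unfolding A_def by (rule Tbar_eq[OF that(2,1)])
  \<comment> \<open>The integrand is the derivative in \<open>s\<close> of
    \<open>s * f (A s x)\<close>, whose end values are 0 and \<open>f x\<close>.\<close>
  have top: "G x + x$3 * integral {0..1} (\<lambda>s. g x s $ 3) = f x" if x: "x \<in> slab" for x
  proof -
    have c: "continuous_on {0..1} (\<lambda>s. f (A s x))" "continuous_on {0..1} (\<lambda>s. g x s $ 3)"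
      using x cgx[OF x] by (auto intro!: cA C1_continuous[OF f] continuous_intros)
    have "((\<lambda>s. f (A s x) + x$3 * g x s $ 3) has_integral 1 * f (A 1 x) - 0 * f (A 0 x)) {0..1}"
    proof (rule fundamental_theorem_of_calculus)
      fix s :: real assume s: "s \<in> {0..1}"
      have "x$3 * s \<in> {0..1}" using s x by (auto simp: slab_def mult_le_one)
      then have "((\<lambda>z. f (vec3 (x$1) (x$2) z)) has_real_derivative pd 3 f (A s x)) (at (x$3 * s) within (\<lambda>s. x$3 * s) ` {0..1})"
        unfolding A_def using x
        by (auto simp: has_real_derivative_iff_has_vector_derivative slab_def mult_le_one intro!: C1_line3[OF f])
      moreover have "((\<lambda>s. x$3 * s) has_real_derivative x$3) (at s within {0..1})"
        by (auto intro!: derivative_eq_intros)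
      ultimately have "((\<lambda>s. f (A s x)) has_real_derivative pd 3 f (A s x) * x$3) (at s within {0..1})"
        using DERIV_image_chain[of "\<lambda>z. f (vec3 (x$1) (x$2) z)" _ "\<lambda>s. x$3 * s" s "{0..1}"]
        by (simp add: A_def o_def)
      from DERIV_mult[OF DERIV_ident this]
      show "((\<lambda>s. s * f (A s x)) has_vector_derivative f (A s x) + x$3 * g x s $ 3) (at s within {0..1})"
        unfolding has_real_derivative_iff_has_vector_derivative[symmetric]
        by (rule DERIV_cong) (simp add: g_def algebra_simps)
    qed simp
    moreover have "((\<lambda>s. f (A s x) + x$3 * g x s $ 3) has_integral G x + x$3 * integral {0..1} (\<lambda>s. g x s $ 3)) {0..1}"
      unfolding G_def cbox_interval
      by (intro has_integral_add has_integral_mult_right integrable_integral integrable_continuous_real c)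
    ultimately show ?thesis by (auto simp: A_def vec3_eta dest: has_integral_unique)
  qed
  let ?D = "\<lambda>j x. if j = 3 then f x else Tbar (pd j f) x"
  have 1: "(Tbar f has_derivative (\<lambda>h. \<Sum>j\<in>UNIV. h$j *\<^sub>R ?D j x)) (at x within slab)" if x: "x \<in> slab" for x
  proof -
    have p3: "((\<lambda>x. x$3) has_derivative (\<lambda>h. h$3)) (at x within slab)"
      by (rule bounded_linear_imp_has_derivative[OF bounded_linear_vec_nth])
    have "((\<lambda>x. x$3 * G x) has_derivative (\<lambda>h. x$3 * (integral {0..1} (g x) \<bullet> h) + h$3 * G x)) (at x within slab)"
      by (rule has_derivative_mult[OF p3 dG[OF x]])
    moreover have "(\<lambda>h. x$3 * (integral {0..1} (g x) \<bullet> h) + h$3 * G x) = (\<lambda>h. \<Sum>j\<in>UNIV. h$j *\<^sub>R ?D j x)"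
      by (auto simp: fun_eq_iff inner_vec_def sum_3 gi[OF x] top[OF x, symmetric] eq[OF x C1_continuous_pd[OF f]])
         (auto simp: g_def algebra_simps)
    ultimately have "((\<lambda>x. x$3 * G x) has_derivative (\<lambda>h. \<Sum>j\<in>UNIV. h$j *\<^sub>R ?D j x)) (at x within slab)" by simp
    then show ?thesis
      by (rule has_derivative_transform[OF x, rotated]) (simp add: eq[OF _ C1_continuous[OF f]] G_def)
  qed
  have 2: "continuous_on slab (?D j)" for j
    by (cases "j = 3") (auto intro: continuous_on_Tbar C1_continuous_pd[OF f] C1_continuous[OF f])
  show "C1 (Tbar f)" by (rule C1I(1)[OF 1 2])
  show "x \<in> slab \<Longrightarrow> pd j (Tbar f) x = ?D j x" by (rule C1I(2)[OF 1 2])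
qed

lemma xy_periodic_Tbar:
  assumes "continuous_on slab f" "xy_periodic Lx Ly f"
  shows "xy_periodic Lx Ly (Tbar f)"
  unfolding xy_periodic_def Tbar_def using xy_periodic_line[OF assms(2)]
  by (auto simp: slab_def axis_def intro!: Bochner_Integration.integral_cong)

text \<open>The increment of \<open>f\<close> in the second variable is the integral of
  \<open>pd 2 f\<close>. Differentiating it in the first variable under the integral, and then in
  the upper limit, yields both mixed derivatives. The regularity assumed is what is established for
  \<phi>.\<close>

lemma pd_commute:
  fixes f :: "real^3 \<Rightarrow> real"
  assumes f: "C1 f" and f2: "C1 (pd 2 f)" and f1: "C1 (pd 1 f)" and x: "x \<in> slab"
  shows "pd 2 (pd 1 f) x = pd 1 (pd 2 f) x"
proof -
  define y z where "y = x$2" and "z = x$3"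
  have z: "z \<in> {0..1}" using x by (auto simp: z_def slab_def)
  define F where "F s r = f (vec3 s r z)" for s r
  \<comment> \<open>Horizontal lines never leave the slab, so \<open>y - 1\<close> can serve as base
    point and \<open>y\<close> is interior to \<open>{y - 1..y + 1}\<close>.\<close>
  have key: "pd 1 f (vec3 (x$1) r z) = pd 1 f (vec3 (x$1) (y - 1) z)
      + integral {y - 1..r} (\<lambda>s. pd 1 (pd 2 f) (vec3 (x$1) s z))" if r: "r \<in> {y - 1..y + 1}" for r
  proof -
    have "((\<lambda>s. integral (cbox (y - 1) r) (\<lambda>q. pd 2 f (vec3 s q z))) has_vector_derivative
        integral (cbox (y - 1) r) (\<lambda>q. pd 1 (pd 2 f) (vec3 (x$1) q z))) (at (x$1) within UNIV)"
      by (rule leibniz_rule_vector_derivative)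
        (use z in \<open>auto intro!: C1_line1[OF f2] integrable_continuous_real continuous_on_vec3_slab C1_continuous[OF f2]
           C1_continuous_pd[OF f2] continuous_intros simp: case_prod_unfold\<close>)
    moreover have "integral (cbox (y - 1) r) (\<lambda>q. pd 2 f (vec3 s q z)) = f (vec3 s r z) - f (vec3 s (y - 1) z)" for s
      using fundamental_theorem_of_calculus[of "y - 1" r "\<lambda>q. f (vec3 s q z)"] C1_line2[OF f z] r
      by (auto intro!: integral_unique)
    ultimately have "((\<lambda>s. f (vec3 s r z) - f (vec3 s (y - 1) z)) has_vector_derivative
        integral (cbox (y - 1) r) (\<lambda>q. pd 1 (pd 2 f) (vec3 (x$1) q z))) (at (x$1))" by simp
    moreover have "((\<lambda>s. f (vec3 s r z) - f (vec3 s (y - 1) z)) has_vector_derivative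
        pd 1 f (vec3 (x$1) r z) - pd 1 f (vec3 (x$1) (y - 1) z)) (at (x$1))"
      by (intro has_vector_derivative_diff C1_line1[OF f z])
    ultimately show ?thesis using vector_derivative_unique_at by fastforce
  qed
  have "((\<lambda>r. integral {y - 1..r} (\<lambda>s. pd 1 (pd 2 f) (vec3 (x$1) s z))) has_vector_derivative
      pd 1 (pd 2 f) (vec3 (x$1) y z)) (at y within {y - 1..y + 1})"
    by (rule integral_has_vector_derivative)
       (use z in \<open>auto intro!: continuous_on_vec3_slab C1_continuous_pd[OF f2] continuous_intros\<close>)
  from has_vector_derivative_add[OF has_vector_derivative_const this]
  have "((\<lambda>r. pd 1 f (vec3 (x$1) r z)) has_vector_derivative 0 + pd 1 (pd 2 f) (vec3 (x$1) y z)) (at y within {y - 1..y + 1})"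
    by (rule has_vector_derivative_transform[rotated 2]) (simp, rule key)
  moreover have "((\<lambda>r. pd 1 f (vec3 (x$1) r z)) has_vector_derivative pd 2 (pd 1 f) (vec3 (x$1) y z)) (at y within {y - 1..y + 1})"
    by (rule C1_line2[OF f1 z])
  ultimately have "pd 2 (pd 1 f) (vec3 (x$1) y z) = 0 + pd 1 (pd 2 f) (vec3 (x$1) y z)"
    by (intro vector_derivative_unique_within[of y "{y - 1..y + 1}"])
       (auto simp: trivial_limit_within islimpt_Icc)
  then show ?thesis by (simp add: y_def z_def vec3_eta)
qed

section \<open>Magnetic energy\<close>

lemma has_vector_derivative_time_slice:
  fixes B :: "real \<Rightarrow> real^3 \<Rightarrow> 'b::real_normed_vector"
  assumes B: "smooth_on (I \<times> slab) (\<lambda>(t, x). B t x)" and "t \<in> I" "x \<in> slab"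
  shows "((\<lambda>s. B s x) has_vector_derivative
    frechet_derivative (\<lambda>(t, x). B t x) (at (t, x) within I \<times> slab) (1, 0)) (at t within I)"
proof -
  let ?F = "\<lambda>(t, x). B t x" and ?D = "frechet_derivative (\<lambda>(t, x). B t x) (at (t, x) within I \<times> slab)"
  have "Ck_on (Suc 0) (I \<times> slab) ?F" using B by (simp add: smooth_on_def)
  then have D: "(?F has_derivative ?D) (at (t, x) within I \<times> slab)"
    using assms frechet_derivative_works by (auto simp: differentiable_on_def)
  then have lin: "linear ?D" using has_derivative_linear by blast
  have slice: "((\<lambda>s. ?F (s, x)) has_derivative (\<lambda>h. ?D (h, 0))) (at t within I)"
  proof (rule has_derivative_in_compose[where g="?F" and f="\<lambda>s. (s, x)"])
    show "((\<lambda>s. (s, x)) has_derivative (\<lambda>h. (h, 0))) (at t within I)"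
      by (auto intro!: derivative_eq_intros)
    show "(?F has_derivative ?D) (at (t, x) within (\<lambda>s. (s, x)) ` I)"
      by (rule has_derivative_subset[OF D]) (use \<open>x \<in> slab\<close> in auto)
  qed
  have "(\<lambda>h. ?D (h, 0)) = (\<lambda>h. h *\<^sub>R ?D (1, 0))"
  proof
    fix h :: real
    have "(h, 0) = h *\<^sub>R (1, 0 :: real^3)" by simp
    then show "?D (h, 0) = h *\<^sub>R ?D (1, 0)" by (metis linear_scale[OF lin])
  qed
  from slice[unfolded this] show ?thesis unfolding has_vector_derivative_def case_prod_conv .
qed

text \<open>Such an interval has no isolated points, so derivatives within \<open>I\<close> are
  unique also at an endpoint. This identifies the derivative in
  \<open>dynamo_action_at\<close>.\<close>

lemma is_interval_at_within_neq_bot: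
  fixes I :: "real set"
  assumes "is_interval I" "interior I \<noteq> {}" "t \<in> I"
  shows "at t within I \<noteq> bot"
proof -
  have "I \<noteq> {x}" for x using assms(2) interior_singleton[of x] by metis
  then have "t islimpt I"
    using connected_imp_perfect[OF is_interval_connected[OF assms(1)] assms(3)] by blast
  then show ?thesis by (simp add: trivial_limit_within)
qed

text \<open>Differentiation under the integral over the compact box; joint smoothness in time and
  space makes the time derivative continuous on \<open>I\<close> times the box.\<close>

lemma magnetic_energy_has_derivative:
  assumes B: "smooth_on (I \<times> slab) (\<lambda>(t, x). B t x)" and I: "is_interval I" "interior I \<noteq> {}" "t \<in> I"
  shows "((\<lambda>s. magnetic_energy Lx Ly (B s)) has_real_derivative
    integral (V Lx Ly) (\<lambda>x. B t x \<bullet> dt I (\<lambda>s. B s x) t)) (at t within I)"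
proof -
  define D where "D s x = frechet_derivative (\<lambda>(t, x). B t x) (at (s, x) within I \<times> slab) (1, 0)" for s x
  have dD: "dt I (\<lambda>s. B s x) s = D s x" if "s \<in> I" "x \<in> slab" for s x
    unfolding dt_def D_def
    by (rule vector_derivative_within[OF is_interval_at_within_neq_bot[OF I(1,2)] has_vector_derivative_time_slice[OF B]])
       (use that in auto)
  have Ck: "Ck_on 0 (I \<times> slab) (\<lambda>(t, x). B t x)" "Ck_on (Suc 0) (I \<times> slab) (\<lambda>(t, x). B t x)"
    using B by (auto simp: smooth_on_def)
  have V: "V Lx Ly = cbox 0 (vec3 Lx Ly 1)" by (rule V_cbox)
  have sub: "I \<times> cbox 0 (vec3 Lx Ly 1) \<subseteq> I \<times> slab" using V_subset_slab[of Lx Ly] V by auto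
  have cD: "continuous_on (I \<times> cbox 0 (vec3 Lx Ly 1)) (\<lambda>p. D (fst p) (snd p))"
    by (rule continuous_on_subset[OF _ sub]) (use Ck(2) in \<open>auto simp: D_def\<close>)
  have cB: "continuous_on (I \<times> cbox 0 (vec3 Lx Ly 1)) (\<lambda>p. B (fst p) (snd p))"
    by (rule continuous_on_subset[OF _ sub]) (use Ck(1) in \<open>auto simp: case_prod_unfold\<close>)
  have cBs: "continuous_on (cbox 0 (vec3 Lx Ly 1)) (B s)" if "s \<in> I" for s
    by (rule continuous_on_compose2[OF cB, of _ "\<lambda>x. (s, x)", simplified]) (use that in \<open>auto intro!: continuous_intros\<close>)
  have "((\<lambda>s. integral (cbox 0 (vec3 Lx Ly 1)) (\<lambda>x. B s x \<bullet> B s x)) has_real_derivative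
      integral (cbox 0 (vec3 Lx Ly 1)) (\<lambda>x. 2 * (B t x \<bullet> D t x))) (at t within I)"
  proof (rule leibniz_rule_field_derivative[OF _ _ _ \<open>t \<in> I\<close>])
    fix s x assume s: "s \<in> I" and "x \<in> cbox 0 (vec3 Lx Ly 1)"
    then have x: "x \<in> slab" using V V_subset_slab by blast
    have d: "((\<lambda>s. B s x) has_derivative (\<lambda>h. h *\<^sub>R D s x)) (at s within I)"
      using has_vector_derivative_time_slice[OF B s x] by (simp add: D_def has_vector_derivative_def)
    show "((\<lambda>s. B s x \<bullet> B s x) has_real_derivative 2 * (B s x \<bullet> D s x)) (at s within I)"
      using has_derivative_inner[OF d d] unfolding has_field_derivative_def
      by (rule has_derivative_eq_rhs) (auto simp: fun_eq_iff inner_commute algebra_simps)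
  next
    show "(\<lambda>x. B s x \<bullet> B s x) integrable_on cbox 0 (vec3 Lx Ly 1)" if "s \<in> I" for s
      by (intro integrable_continuous continuous_intros cBs that)
    show "continuous_on (I \<times> cbox 0 (vec3 Lx Ly 1)) (\<lambda>(s, x). 2 * (B s x \<bullet> D s x))"
      unfolding case_prod_unfold by (intro continuous_intros cB cD)
    show "convex I" using I(1) is_interval_convex by blast
  qed
  from DERIV_cmult[OF this, of "1/2"]
  have "((\<lambda>s. 1/2 * integral (V Lx Ly) (\<lambda>x. B s x \<bullet> B s x)) has_real_derivative
      integral (V Lx Ly) (\<lambda>x. B t x \<bullet> D t x)) (at t within I)"
    by (simp add: V)
  moreover have "magnetic_energy Lx Ly (B s) = 1/2 * integral (V Lx Ly) (\<lambda>x. B s x \<bullet> B s x)" if "s \<in> I" for s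
    unfolding magnetic_energy_def V
    by (subst integral_lebesgue_on_cbox) (auto simp: power2_norm_eq_inner intro!: continuous_intros cBs that)
  moreover have "integral (V Lx Ly) (\<lambda>x. B t x \<bullet> D t x) = integral (V Lx Ly) (\<lambda>x. B t x \<bullet> dt I (\<lambda>s. B s x) t)"
    by (rule HK_integral_cong) (use V_subset_slab \<open>t \<in> I\<close> dD in force)
  ultimately show ?thesis
    unfolding has_field_derivative_def using has_derivative_transform[OF \<open>t \<in> I\<close>] by (metis (no_types, lifting))
qed

section \<open>Poincare and Sobolev inequalities\<close>

lemma continuous_on_integral_Icc:
  fixes F :: "'a::topological_space \<Rightarrow> real \<Rightarrow> real"
  assumes "continuous_on (S \<times> {l..r}) (\<lambda>p. F (fst p) (snd p))"
  shows "continuous_on S (\<lambda>q. integral {l..r} (F q))"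
  using integral_continuous_on_param[of S l r F] assms by (simp add: case_prod_unfold)

lemma
  fixes f :: "real^3 \<Rightarrow> real"
  assumes "continuous_on slab f"
  shows continuous_on_integral_x: "\<lbrakk>continuous_on S b; continuous_on S c; \<And>q. q \<in> S \<Longrightarrow> 0 \<le> c q \<and> c q \<le> 1\<rbrakk>
      \<Longrightarrow> continuous_on S (\<lambda>q. integral {0..Lx} (\<lambda>x. f (vec3 x (b q) (c q))))"
    and continuous_on_integral_y: "\<lbrakk>continuous_on S a; continuous_on S c; \<And>q. q \<in> S \<Longrightarrow> 0 \<le> c q \<and> c q \<le> 1\<rbrakk>
      \<Longrightarrow> continuous_on S (\<lambda>q. integral {0..Ly} (\<lambda>y. f (vec3 (a q) y (c q))))"
    and continuous_on_integral_z: "\<lbrakk>continuous_on S a; continuous_on S b\<rbrakk>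
      \<Longrightarrow> continuous_on S (\<lambda>q. integral {0..1} (\<lambda>z. f (vec3 (a q) (b q) z)))"
    and continuous_on_integral_xy: "\<lbrakk>continuous_on S c; \<And>q. q \<in> S \<Longrightarrow> 0 \<le> c q \<and> c q \<le> 1\<rbrakk>
      \<Longrightarrow> continuous_on S (\<lambda>q. integral {0..Lx} (\<lambda>x. integral {0..Ly} (\<lambda>y. f (vec3 x y (c q)))))"
proof -
  have comp: "continuous_on (S \<times> T) (\<lambda>p. h (fst p))" if "continuous_on S h" for h :: "'a \<Rightarrow> real" and T :: "real set"
    by (rule continuous_on_compose2[OF that]) (auto intro!: continuous_intros)
  have y: "continuous_on S (\<lambda>q. integral {0..Ly} (\<lambda>y. f (vec3 (a q) y (c q))))"
    if "continuous_on S a" "continuous_on S c" "\<And>q. q \<in> S \<Longrightarrow> 0 \<le> c q \<and> c q \<le> 1"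
    for a c and S :: "'b::topological_space set"
    by (rule continuous_on_integral_Icc, rule continuous_on_vec3_slab[OF assms])
       (use that in \<open>auto intro!: continuous_on_compose2[OF that(1)] continuous_on_compose2[OF that(2)] continuous_intros\<close>)
  show "\<lbrakk>continuous_on S b; continuous_on S c; \<And>q. q \<in> S \<Longrightarrow> 0 \<le> c q \<and> c q \<le> 1\<rbrakk>
      \<Longrightarrow> continuous_on S (\<lambda>q. integral {0..Lx} (\<lambda>x. f (vec3 x (b q) (c q))))"
    by (rule continuous_on_integral_Icc, rule continuous_on_vec3_slab[OF assms])
       (auto intro!: comp continuous_intros)
  show "\<lbrakk>continuous_on S a; continuous_on S c; \<And>q. q \<in> S \<Longrightarrow> 0 \<le> c q \<and> c q \<le> 1\<rbrakk>
      \<Longrightarrow> continuous_on S (\<lambda>q. integral {0..Ly} (\<lambda>y. f (vec3 (a q) y (c q))))"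
    by (rule y)
  show "\<lbrakk>continuous_on S a; continuous_on S b\<rbrakk>
      \<Longrightarrow> continuous_on S (\<lambda>q. integral {0..1} (\<lambda>z. f (vec3 (a q) (b q) z)))"
    by (rule continuous_on_integral_Icc, rule continuous_on_vec3_slab[OF assms])
       (auto intro!: comp continuous_intros)
  show "\<lbrakk>continuous_on S c; \<And>q. q \<in> S \<Longrightarrow> 0 \<le> c q \<and> c q \<le> 1\<rbrakk>
      \<Longrightarrow> continuous_on S (\<lambda>q. integral {0..Lx} (\<lambda>x. integral {0..Ly} (\<lambda>y. f (vec3 x y (c q)))))"
    by (rule continuous_on_integral_Icc, rule y) (auto intro!: comp continuous_intros)
qed

lemma continuous_on_slab_line:
  fixes f :: "real^3 \<Rightarrow> real"
  assumes "continuous_on slab f"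
  shows "z \<in> {0..1} \<Longrightarrow> continuous_on S (\<lambda>x. f (vec3 x y z))"
    and "z \<in> {0..1} \<Longrightarrow> continuous_on S (\<lambda>y. f (vec3 x y z))"
    and "S \<subseteq> {0..1} \<Longrightarrow> continuous_on S (\<lambda>z. f (vec3 x y z))"
  by (rule continuous_on_vec3_slab[OF assms]; auto intro!: continuous_intros)+

text \<open>Wirtinger's inequality compares integrals over lines, not values, so the comparison is
  assumed only after integration along each vertical line.\<close>

lemma integral_V_mono_vertical:
  fixes f g :: "real^3 \<Rightarrow> real"
  assumes f: "continuous_on slab f" and g: "continuous_on slab g"
    and le: "\<And>x y. integral {0..1} (\<lambda>z. f (vec3 x y z)) \<le> integral {0..1} (\<lambda>z. g (vec3 x y z))"
  shows "integral (V Lx Ly) f \<le> integral (V Lx Ly) g"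
  unfolding integral_V_xyz[OF f] integral_V_xyz[OF g]
proof (rule integral_le)
  note c = continuous_on_integral_z[OF f] continuous_on_integral_z[OF g]
  show "integral {0..Ly} (\<lambda>y. integral {0..1} (\<lambda>z. f (vec3 x y z))) \<le> integral {0..Ly} (\<lambda>y. integral {0..1} (\<lambda>z. g (vec3 x y z)))" for x
    by (rule integral_le[OF _ _ le]; intro integrable_continuous_real c continuous_intros)
qed (intro integrable_continuous_real continuous_on_integral_Icc continuous_on_integral_z[OF f]
    continuous_on_integral_z[OF g] continuous_intros)+

lemma integral_V_mono_horizontal:
  fixes f g :: "real^3 \<Rightarrow> real"
  assumes f: "continuous_on slab f" and g: "continuous_on slab g"
    and le: "\<And>z. z \<in> {0..1} \<Longrightarrow> integral {0..Lx} (\<lambda>x. integral {0..Ly} (\<lambda>y. f (vec3 x y z)))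
      \<le> integral {0..Lx} (\<lambda>x. integral {0..Ly} (\<lambda>y. g (vec3 x y z)))"
  shows "integral (V Lx Ly) f \<le> integral (V Lx Ly) g"
  unfolding integral_V_zxy[OF f] integral_V_zxy[OF g]
  by (rule integral_le[OF _ _ le])
     (auto intro!: integrable_continuous_real continuous_on_integral_xy[OF f] continuous_on_integral_xy[OF g] continuous_intros)

lemma Poincare_vertical:
  fixes f :: "real^3 \<Rightarrow> real"
  assumes f: "C1 f" and bdry: "\<And>x y. f (vec3 x y 0) = 0" "\<And>x y. f (vec3 x y 1) = 0"
  shows "integral (V Lx Ly) (\<lambda>x. (f x)\<^sup>2) \<le> (1 / pi)\<^sup>2 * integral (V Lx Ly) (\<lambda>x. (pd 3 f x)\<^sup>2)"
proof -
  note c = C1_continuous[OF f] C1_continuous_pd[OF f, of 3]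
  have c2: "continuous_on slab (\<lambda>x. (f x)\<^sup>2)" "continuous_on slab (\<lambda>x. (1 / pi)\<^sup>2 * (pd 3 f x)\<^sup>2)"
    by (intro continuous_intros c)+
  have "integral {0..1} (\<lambda>z. (f (vec3 x y z))\<^sup>2) \<le> integral {0..1} (\<lambda>z. (1 / pi)\<^sup>2 * (pd 3 f (vec3 x y z))\<^sup>2)" for x y
    using Wirtinger_Dirichlet[of 0 1 "\<lambda>z. f (vec3 x y z)" "\<lambda>z. pd 3 f (vec3 x y z)"]
      C1_line3[OF f] bdry continuous_on_slab_line(3)[OF c(2)] by simp
  then have "integral (V Lx Ly) (\<lambda>x. (f x)\<^sup>2) \<le> integral (V Lx Ly) (\<lambda>x. (1 / pi)\<^sup>2 * (pd 3 f x)\<^sup>2)"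
    by (rule integral_V_mono_vertical[OF c2])
  then show ?thesis by simp
qed

text \<open>Split \<open>F\<close> into its mean \<open>g\<close> over \<open>y\<close> and a
  remainder, which are orthogonal on each line in direction \<open>y\<close>. The remainder is
  controlled by Wirtinger's inequality in \<open>y\<close>, the mean by the one in \<open>x\<close>,
  where the hypothesis makes the mean of \<open>g\<close> vanish.\<close>

lemma Poincare_slice:
  fixes f :: "real^3 \<Rightarrow> real"
  assumes f: "C1 f" and per: "xy_periodic Lx Ly f" and L: "0 < Lx" "0 < Ly" and z: "z \<in> {0..1}"
    and mean: "integral {0..Lx} (\<lambda>x. integral {0..Ly} (\<lambda>y. f (vec3 x y z))) = 0"
  shows "integral {0..Lx} (\<lambda>x. integral {0..Ly} (\<lambda>y. (f (vec3 x y z))\<^sup>2))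
    \<le> integral {0..Lx} (\<lambda>x. integral {0..Ly} (\<lambda>y.
        (Lx / (2 * pi))\<^sup>2 * (pd 1 f (vec3 x y z))\<^sup>2 + (Ly / (2 * pi))\<^sup>2 * (pd 2 f (vec3 x y z))\<^sup>2))"
proof -
  note cf = C1_continuous[OF f] and cp = C1_continuous_pd[OF f]
  have z01: "0 \<le> z \<and> z \<le> 1" using z by auto
  define F where "F x y = f (vec3 x y z)" for x y
  define Fx where "Fx x y = pd 1 f (vec3 x y z)" for x y
  define Fy where "Fy x y = pd 2 f (vec3 x y z)" for x y
  have cont: "continuous_on S (\<lambda>p. F (a p) (b p))" "continuous_on S (\<lambda>p. Fx (a p) (b p))" "continuous_on S (\<lambda>p. Fy (a p) (b p))"
    if "continuous_on S a" "continuous_on S b" for S :: "'s::topological_space set" and a b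
    unfolding F_def Fx_def Fy_def
    by (rule continuous_on_vec3_slab[OF cf] continuous_on_vec3_slab[OF cp];
        use that z01 in \<open>simp add: continuous_intros\<close>)+
  define g where "g x = 1 / Ly * integral {0..Ly} (F x)" for x
  define g' where "g' x = 1 / Ly * integral {0..Ly} (Fx x)" for x
  have cg: "continuous_on S g" "continuous_on S g'" for S
    unfolding g_def g'_def by (intro continuous_intros continuous_on_integral_Icc cont)+
  have dg: "(g has_vector_derivative g' x) (at x)" for x
  proof -
    have "((\<lambda>x. integral (cbox 0 Ly) (F x)) has_vector_derivative integral (cbox 0 Ly) (Fx x)) (at x within UNIV)"
    proof (rule leibniz_rule_vector_derivative)
      show "((\<lambda>x. F x y) has_vector_derivative Fx x y) (at x within UNIV)" for x y
        unfolding F_def Fx_def by (rule C1_line1[OF f z])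
      show "F x integrable_on cbox 0 Ly" for x
        by (intro integrable_continuous cont continuous_intros)
      show "continuous_on (UNIV \<times> cbox 0 Ly) (\<lambda>(x, t). Fx x t)"
        unfolding case_prod_unfold by (intro cont continuous_intros)
    qed auto
    from has_vector_derivative_mult_right[OF this, of "1 / Ly"]
    show ?thesis by (simp add: g_def[abs_def] g'_def)
  qed
  have split: "integral {0..Ly} (\<lambda>y. (F x y)\<^sup>2) \<le> Ly * (g x)\<^sup>2 + (Ly / (2 * pi))\<^sup>2 * integral {0..Ly} (\<lambda>y. (Fy x y)\<^sup>2)" for x
  proof -
    have hi: "(F x has_integral Ly * g x) {0..Ly}"
      unfolding g_def using L by (auto intro!: integrable_integral integrable_continuous_real cont continuous_intros)
    have "integral {0..Ly} (\<lambda>y. (F x y - g x)\<^sup>2) \<le> (Ly / (2 * pi))\<^sup>2 * integral {0..Ly} (\<lambda>y. (Fy x y)\<^sup>2)"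
    proof (rule Wirtinger_periodic)
      show "((\<lambda>y. F x y - g x) has_vector_derivative Fy x y) (at y)" for y
        using C1_line2[OF f z, of x y UNIV] by (auto simp: F_def Fy_def intro!: derivative_eq_intros)
      show "continuous_on UNIV (Fy x)" by (intro cont continuous_intros)
      show "F x (y + Ly) - g x = F x y - g x" "Fy x (y + Ly) = Fy x y" for y
        unfolding F_def Fy_def using xy_periodic_line(2)[OF per z] xy_periodic_line(2)[OF xy_periodic_pd[OF f per] z] by auto
      show "integral {0..Ly} (\<lambda>y. F x y - g x) = 0"
        using has_integral_diff[OF hi has_integral_const_real[of "g x" 0 Ly]] L by (auto simp: integral_unique)
    qed (rule L)
    moreover have "integral {0..Ly} (\<lambda>y. (F x y - g x)\<^sup>2) = integral {0..Ly} (\<lambda>y. (F x y)\<^sup>2) - Ly * (g x)\<^sup>2"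
    proof -
      have "((\<lambda>y. (F x y)\<^sup>2 - 2 * g x * F x y + (g x)\<^sup>2) has_integral
          integral {0..Ly} (\<lambda>y. (F x y)\<^sup>2) - 2 * g x * (Ly * g x) + Ly *\<^sub>R (g x)\<^sup>2) {0..Ly}"
        using has_integral_const_real[of "(g x)\<^sup>2" 0 Ly] L
        by (intro has_integral_add has_integral_diff has_integral_mult_right integrable_integral hi
            integrable_continuous_real continuous_intros cont) auto
      then show ?thesis by (simp add: power2_diff integral_unique power2_eq_square algebra_simps)
    qed
    ultimately show ?thesis by linarith
  qed
  have g_le: "integral {0..Lx} (\<lambda>x. (g x)\<^sup>2) \<le> (Lx / (2 * pi))\<^sup>2 * integral {0..Lx} (\<lambda>x. (g' x)\<^sup>2)"
  proof (rule Wirtinger_periodic[OF L(1) dg cg(2)])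
    show "g (x + Lx) = g x" "g' (x + Lx) = g' x" for x
      unfolding g_def g'_def F_def Fx_def
      using xy_periodic_line(1)[OF per z] xy_periodic_line(1)[OF xy_periodic_pd[OF f per] z] by auto
    show "integral {0..Lx} g = 0" unfolding g_def F_def using mean by simp
  qed
  \<comment> \<open>Cauchy-Schwarz against the constant 1: averaging over \<open>y\<close> does not
    increase the square integral of \<open>Fx\<close>.\<close>
  have g'_le: "Ly * (g' x)\<^sup>2 \<le> integral {0..Ly} (\<lambda>y. (Fx x y)\<^sup>2)" for x
  proof -
    have "integral (cbox 0 Ly) (\<lambda>y. \<bar>Fx x y\<bar>) \<le> sqrt (integral (cbox 0 Ly) (\<lambda>y. (Fx x y)\<^sup>2)) * sqrt (integral (cbox 0 Ly) (\<lambda>y. 1))"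
      by (rule integral_Cauchy_Schwarz) (use L in \<open>auto intro!: continuous_intros cont simp: box_real\<close>)
    moreover have "\<bar>integral {0..Ly} (Fx x)\<bar> \<le> integral {0..Ly} (\<lambda>y. \<bar>Fx x y\<bar>)"
      using integral_norm_bound_integral[of "Fx x" "{0..Ly}" "\<lambda>y. \<bar>Fx x y\<bar>"]
        integrable_continuous_real[OF cont(2), of 0 Ly "\<lambda>_. x" "\<lambda>y. y"]
        integrable_continuous_real[OF continuous_on_rabs[OF cont(2)], of 0 Ly "\<lambda>_. x" "\<lambda>y. y"]
      by simp
    ultimately have "\<bar>Ly * g' x\<bar> \<le> sqrt (integral {0..Ly} (\<lambda>y. (Fx x y)\<^sup>2)) * sqrt Ly"
      using L by (simp add: g'_def)
    then have "(Ly * g' x)\<^sup>2 \<le> (sqrt (integral {0..Ly} (\<lambda>y. (Fx x y)\<^sup>2)) * sqrt Ly)\<^sup>2"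
      by (rule abs_le_square_iff[THEN iffD1, OF order_trans]) simp
    also have "\<dots> = integral {0..Ly} (\<lambda>y. (Fx x y)\<^sup>2) * Ly"
      using L by (simp add: power_mult_distrib integral_nonneg integrable_continuous_real continuous_intros cont)
    finally show ?thesis using L by (simp add: power2_eq_square mult.left_commute[of "g' x"])
  qed
  have ci: "continuous_on S (\<lambda>x. integral {0..Ly} (\<lambda>y. (F x y)\<^sup>2))"
    "continuous_on S (\<lambda>x. integral {0..Ly} (\<lambda>y. (Fx x y)\<^sup>2))"
    "continuous_on S (\<lambda>x. integral {0..Ly} (\<lambda>y. (Fy x y)\<^sup>2))" for S
    by (intro continuous_on_integral_Icc continuous_intros cont)+
  have "integral {0..Lx} (\<lambda>x. integral {0..Ly} (\<lambda>y. (F x y)\<^sup>2))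
      \<le> integral {0..Lx} (\<lambda>x. Ly * (g x)\<^sup>2 + (Ly / (2 * pi))\<^sup>2 * integral {0..Ly} (\<lambda>y. (Fy x y)\<^sup>2))"
    by (intro integral_le integrable_continuous_real continuous_intros ci cg split)
  also have "\<dots> = Ly * integral {0..Lx} (\<lambda>x. (g x)\<^sup>2)
      + (Ly / (2 * pi))\<^sup>2 * integral {0..Lx} (\<lambda>x. integral {0..Ly} (\<lambda>y. (Fy x y)\<^sup>2))"
    by (subst HK_integral_add) (auto intro!: integrable_continuous_real continuous_intros ci cg)
  also have "Ly * integral {0..Lx} (\<lambda>x. (g x)\<^sup>2) \<le> Ly * ((Lx / (2 * pi))\<^sup>2 * integral {0..Lx} (\<lambda>x. (g' x)\<^sup>2))"
    using g_le L by simp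
  also have "\<dots> = (Lx / (2 * pi))\<^sup>2 * integral {0..Lx} (\<lambda>x. Ly * (g' x)\<^sup>2)" by simp
  also have "\<dots> \<le> (Lx / (2 * pi))\<^sup>2 * integral {0..Lx} (\<lambda>x. integral {0..Ly} (\<lambda>y. (Fx x y)\<^sup>2))"
    by (intro mult_left_mono integral_le integrable_continuous_real continuous_intros ci cg g'_le) auto
  also have "(Lx / (2 * pi))\<^sup>2 * integral {0..Lx} (\<lambda>x. integral {0..Ly} (\<lambda>y. (Fx x y)\<^sup>2))
      + (Ly / (2 * pi))\<^sup>2 * integral {0..Lx} (\<lambda>x. integral {0..Ly} (\<lambda>y. (Fy x y)\<^sup>2))
      = integral {0..Lx} (\<lambda>x. (Lx / (2 * pi))\<^sup>2 * integral {0..Ly} (\<lambda>y. (Fx x y)\<^sup>2) + (Ly / (2 * pi))\<^sup>2 * integral {0..Ly} (\<lambda>y. (Fy x y)\<^sup>2))"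
    by (subst HK_integral_add) (auto intro!: integrable_continuous_real continuous_intros ci)
  also have "\<dots> = integral {0..Lx} (\<lambda>x. integral {0..Ly} (\<lambda>y. (Lx / (2 * pi))\<^sup>2 * (Fx x y)\<^sup>2 + (Ly / (2 * pi))\<^sup>2 * (Fy x y)\<^sup>2))"
    by (subst HK_integral_add) (auto intro!: integrable_continuous_real continuous_intros cont)
  finally show ?thesis by (simp add: F_def Fx_def Fy_def)
qed

lemma lambda1_bounds:
  assumes "Lx > 0" "Ly > 0"
  shows "0 < lambda1 Lx Ly" "lambda1 Lx Ly \<le> pi" "Lx / (2 * pi) \<le> 1 / lambda1 Lx Ly" "Ly / (2 * pi) \<le> 1 / lambda1 Lx Ly"
proof -
  show pos: "0 < lambda1 Lx Ly" using assms by (simp add: lambda1_def)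
  show "lambda1 Lx Ly \<le> pi" by (simp add: lambda1_def)
  have "lambda1 Lx Ly \<le> 2 * pi / Lx" "lambda1 Lx Ly \<le> 2 * pi / Ly" by (simp_all add: lambda1_def)
  then show "Lx / (2 * pi) \<le> 1 / lambda1 Lx Ly" "Ly / (2 * pi) \<le> 1 / lambda1 Lx Ly"
    using assms pos by (simp_all add: field_simps)
qed

lemma Poincare_horizontal:
  fixes f :: "real^3 \<Rightarrow> real"
  assumes f: "C1 f" and per: "xy_periodic Lx Ly f" and L: "0 < Lx" "0 < Ly"
    and mean: "\<And>z. z \<in> {0..1} \<Longrightarrow> integral {0..Lx} (\<lambda>x. integral {0..Ly} (\<lambda>y. f (vec3 x y z))) = 0"
  shows "integral (V Lx Ly) (\<lambda>x. (f x)\<^sup>2) \<le> (1 / lambda1 Lx Ly)\<^sup>2 * integral (V Lx Ly) (\<lambda>x. (pd 1 f x)\<^sup>2 + (pd 2 f x)\<^sup>2)"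
proof -
  let ?g = "\<lambda>x. (Lx / (2 * pi))\<^sup>2 * (pd 1 f x)\<^sup>2 + (Ly / (2 * pi))\<^sup>2 * (pd 2 f x)\<^sup>2"
  have c: "continuous_on slab (\<lambda>x. (f x)\<^sup>2)" "continuous_on slab ?g"
    "continuous_on slab (\<lambda>x. (1 / lambda1 Lx Ly)\<^sup>2 * ((pd 1 f x)\<^sup>2 + (pd 2 f x)\<^sup>2))"
    by (intro continuous_intros C1_continuous C1_continuous_pd f)+
  have "integral (V Lx Ly) (\<lambda>x. (f x)\<^sup>2) \<le> integral (V Lx Ly) ?g"
    by (rule integral_V_mono_horizontal[OF c(1,2) Poincare_slice[OF f per L _ mean]])
  also have "\<dots> \<le> integral (V Lx Ly) (\<lambda>x. (1 / lambda1 Lx Ly)\<^sup>2 * ((pd 1 f x)\<^sup>2 + (pd 2 f x)\<^sup>2))"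
    unfolding distrib_left using lambda1_bounds[OF L] L
    by (intro integral_le integrable_V c(2) c(3)[unfolded distrib_left] add_mono mult_right_mono power_mono) auto
  finally show ?thesis by simp
qed

text \<open>Integrated over a horizontal slice, the horizontal derivatives in the divergence vanish
  by periodicity, so the flux has derivative 0 in \<open>z\<close>.\<close>

lemma slice_flux_constant:
  fixes F :: "real^3 \<Rightarrow> real^3"
  assumes F: "C1 F" and per: "xy_periodic Lx Ly F" and L: "0 < Lx" "0 < Ly"
    and div: "\<And>x. x \<in> slab \<Longrightarrow> dive F x = 0" and z: "z \<in> {0..1}"
  shows "integral {0..Lx} (\<lambda>x. integral {0..Ly} (\<lambda>y. F (vec3 x y z) $ 3))
    = integral {0..Lx} (\<lambda>x. integral {0..Ly} (\<lambda>y. F (vec3 x y 0) $ 3))"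
proof -
  define f where "f i x = F x $ i" for i :: 3 and x
  have f: "C1 (f i)" "xy_periodic Lx Ly (f i)" for i
    unfolding f_def using C1_component[OF F] xy_periodic_component[OF per] by auto
  note cp = C1_continuous_pd[OF f(1)]
  define M where "M z = integral {0..Lx} (\<lambda>x. integral {0..Ly} (\<lambda>y. f 3 (vec3 x y z)))" for z
  define m where "m z x = integral {0..Ly} (\<lambda>y. f 3 (vec3 x y z))" for z x
  define m' where "m' z x = integral {0..Ly} (\<lambda>y. pd 3 (f 3) (vec3 x y z))" for z x
  have m: "((\<lambda>z. m z x) has_vector_derivative m' z x) (at z within {0..1})" if "z \<in> {0..1}" for z x
    unfolding m_def m'_def cbox_interval[symmetric]
  proof (rule leibniz_rule_vector_derivative)
    show "((\<lambda>z. f 3 (vec3 x y z)) has_vector_derivative pd 3 (f 3) (vec3 x y z)) (at z within cbox 0 1)"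
      if "z \<in> cbox 0 1" for z y using C1_line3[OF f(1)] that by simp
    show "(\<lambda>y. f 3 (vec3 x y z)) integrable_on cbox 0 Ly" if "z \<in> cbox 0 1" for z
      by (intro integrable_continuous continuous_on_slab_line C1_continuous f) (use that in simp)
    show "continuous_on (cbox 0 1 \<times> cbox 0 Ly) (\<lambda>(z, y). pd 3 (f 3) (vec3 x y z))"
      unfolding case_prod_unfold by (rule continuous_on_vec3_slab[OF cp]) (auto intro!: continuous_intros)
  qed (use that in auto)
  have M': "(M has_vector_derivative 0) (at z within {0..1})" if z: "z \<in> {0..1}" for z
  proof -
    have "((\<lambda>z. integral (cbox 0 Lx) (m z)) has_vector_derivative integral (cbox 0 Lx) (m' z)) (at z within cbox 0 1)"
    proof (rule leibniz_rule_vector_derivative)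
      show "((\<lambda>z. m z x) has_vector_derivative m' z x) (at z within cbox 0 1)" if "z \<in> cbox 0 1" for z x
        using m that by simp
      show "m z integrable_on cbox 0 Lx" if "z \<in> cbox 0 1" for z
        unfolding m_def by (intro integrable_continuous continuous_on_integral_y C1_continuous f continuous_intros) (use that in auto)
      show "continuous_on (cbox 0 1 \<times> cbox 0 Lx) (\<lambda>(z, x). m' z x)"
        unfolding case_prod_unfold m'_def by (rule continuous_on_integral_y[OF cp]) (auto intro!: continuous_intros)
    qed (use z in auto)
    moreover have "integral (cbox 0 Lx) (m' z) = 0"
    proof -
      have i1: "integral {0..Lx} (\<lambda>x. pd 1 (f 1) (vec3 x y z)) = 0" for y
        using fundamental_theorem_of_calculus[of 0 Lx "\<lambda>x. f 1 (vec3 x y z)"] C1_line1[OF f(1) z] xy_periodicD1[OF f(2) z]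
          L by (force intro!: integral_unique)
      have i2: "integral {0..Ly} (\<lambda>y. pd 2 (f 2) (vec3 x y z)) = 0" for x
        using fundamental_theorem_of_calculus[of 0 Ly "\<lambda>y. f 2 (vec3 x y z)"] C1_line2[OF f(1) z] xy_periodicD2[OF f(2) z]
          L by (force intro!: integral_unique)
      have "pd 3 (f 3) x = - pd 1 (f 1) x - pd 2 (f 2) x" if "x \<in> slab" for x
        using div[OF that] by (simp add: dive_def sum_3 f_def[abs_def])
      then have "m' z x = integral {0..Ly} (\<lambda>y. - pd 1 (f 1) (vec3 x y z) - pd 2 (f 2) (vec3 x y z))" for x
        unfolding m'_def using z by simp
      moreover have "integral {0..Ly} (\<lambda>y. - pd 1 (f 1) (vec3 x y z) - pd 2 (f 2) (vec3 x y z))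
          = - integral {0..Ly} (\<lambda>y. pd 1 (f 1) (vec3 x y z))" for x
        using z by (subst Henstock_Kurzweil_Integration.integral_diff)
          (auto intro!: integrable_continuous_real continuous_intros continuous_on_slab_line cp simp: i2)
      ultimately have "integral (cbox 0 Lx) (m' z) = - integral (cbox 0 Lx) (\<lambda>x. integral (cbox 0 Ly) (\<lambda>y. pd 1 (f 1) (vec3 x y z)))"
        by (subst Henstock_Kurzweil_Integration.integral_neg[symmetric]) (rule HK_integral_cong, simp)
      also have "integral (cbox 0 Lx) (\<lambda>x. integral (cbox 0 Ly) (\<lambda>y. pd 1 (f 1) (vec3 x y z)))
          = integral (cbox 0 Ly) (\<lambda>y. integral (cbox 0 Lx) (\<lambda>x. pd 1 (f 1) (vec3 x y z)))"
        by (rule integral_swap_continuous, unfold case_prod_unfold, rule continuous_on_vec3_slab[OF cp])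
           (use z in \<open>auto intro!: continuous_intros\<close>)
      finally show ?thesis by (simp add: i1)
    qed
    ultimately show ?thesis by (simp add: M_def[abs_def] m_def[abs_def])
  qed
  have "M z = M 0"
    using has_vector_derivative_zero_constant[of "{0..1::real}" M] M' z
    by (metis atLeastAtMost_iff convex_real_interval(5) order_refl zero_le_one)
  then show ?thesis by (simp add: M_def f_def)
qed

text \<open>Cauchy-Schwarz is applied in \<open>z\<close>, then \<open>y\<close>, then
  \<open>x\<close>. Each of \<open>g1\<close>, \<open>g2\<close>, \<open>g3\<close> is independent
  of one variable and stays outside that integration, while the inequality separates the other
  two.\<close>

lemma Loomis_Whitney_box:
  fixes h :: "real^3 \<Rightarrow> real" and g1 g2 g3 :: "real \<Rightarrow> real \<Rightarrow> real"
  assumes L: "0 < Lx" "0 < Ly" and h: "continuous_on slab h"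
    and g1: "continuous_on ({0..Ly} \<times> {0..1}) (\<lambda>p. g1 (fst p) (snd p))"
    and g2: "continuous_on ({0..Lx} \<times> {0..1}) (\<lambda>p. g2 (fst p) (snd p))"
    and g3: "continuous_on ({0..Lx} \<times> {0..Ly}) (\<lambda>p. g3 (fst p) (snd p))"
    and nonneg: "\<And>y z. y \<in> {0..Ly} \<Longrightarrow> z \<in> {0..1} \<Longrightarrow> 0 \<le> g1 y z" "\<And>x z. x \<in> {0..Lx} \<Longrightarrow> z \<in> {0..1} \<Longrightarrow> 0 \<le> g2 x z"
      "\<And>x y. x \<in> {0..Lx} \<Longrightarrow> y \<in> {0..Ly} \<Longrightarrow> 0 \<le> g3 x y"
    and le: "\<And>x y z. x \<in> {0..Lx} \<Longrightarrow> y \<in> {0..Ly} \<Longrightarrow> z \<in> {0..1} \<Longrightarrow>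
      h (vec3 x y z) \<le> sqrt (g1 y z) * sqrt (g2 x z) * sqrt (g3 x y)"
  shows "integral (V Lx Ly) h \<le> sqrt (integral {0..Ly} (\<lambda>y. integral {0..1} (g1 y)))
    * sqrt (integral {0..Lx} (\<lambda>x. integral {0..1} (g2 x))) * sqrt (integral {0..Lx} (\<lambda>x. integral {0..Ly} (g3 x)))"
proof -
  have CS: "integral {a..b} k \<le> sqrt (integral {a..b} f) * sqrt (integral {a..b} g)"
    if "a < b" "continuous_on {a..b} k" "continuous_on {a..b} f" "continuous_on {a..b} g"
      "\<And>x. x \<in> {a..b} \<Longrightarrow> 0 \<le> f x" "\<And>x. x \<in> {a..b} \<Longrightarrow> 0 \<le> g x"
      "\<And>x. x \<in> {a..b} \<Longrightarrow> k x \<le> sqrt (f x) * sqrt (g x)" for a b :: real and k f g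
    using integral_Cauchy_Schwarz[of a b k f g] that by simp
  have c1: "continuous_on {0..1} (g1 y)" if "y \<in> {0..Ly}" for y
    by (rule continuous_on_compose2[OF g1, where f="\<lambda>z. (y, z)", simplified]) (use that in \<open>auto intro!: continuous_intros\<close>)
  have c2: "continuous_on {0..1} (g2 x)" if "x \<in> {0..Lx}" for x
    by (rule continuous_on_compose2[OF g2, where f="\<lambda>z. (x, z)", simplified]) (use that in \<open>auto intro!: continuous_intros\<close>)
  have c3: "continuous_on {0..Ly} (g3 x)" if "x \<in> {0..Lx}" for x
    by (rule continuous_on_compose2[OF g3, where f="\<lambda>z. (x, z)", simplified]) (use that in \<open>auto intro!: continuous_intros\<close>)
  define G1 where "G1 y = integral {0..1} (g1 y)" for y
  define G2 where "G2 x = integral {0..1} (g2 x)" for x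
  define G3 where "G3 x = integral {0..Ly} (g3 x)" for x
  have cG: "continuous_on {0..Ly} G1" "continuous_on {0..Lx} G2" "continuous_on {0..Lx} G3"
    unfolding G1_def G2_def G3_def by (intro continuous_on_integral_Icc g1 g2 g3)+
  have G0: "y \<in> {0..Ly} \<Longrightarrow> 0 \<le> G1 y" "x \<in> {0..Lx} \<Longrightarrow> 0 \<le> G2 x" "x \<in> {0..Lx} \<Longrightarrow> 0 \<le> G3 x" for x y
    unfolding G1_def G2_def G3_def by (rule integral_nonneg; use nonneg integrable_continuous_real c1 c2 c3 in blast)+
  have ch: "continuous_on S (\<lambda>x. integral {0..Ly} (\<lambda>y. integral {0..1} (\<lambda>z. h (vec3 x y z))))" for S
    by (rule continuous_on_integral_Icc, rule continuous_on_integral_z[OF h]) (intro continuous_intros)+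
  have I1: "0 \<le> integral {0..Ly} G1"
    by (rule integral_nonneg) (use G0 integrable_continuous_real cG in auto)
  have "integral {0..1} (\<lambda>z. h (vec3 x y z)) \<le> sqrt (g3 x y * G2 x) * sqrt (G1 y)"
    if x: "x \<in> {0..Lx}" and y: "y \<in> {0..Ly}" for x y
  proof -
    have "integral {0..1} (\<lambda>z. h (vec3 x y z)) \<le> sqrt (integral {0..1} (\<lambda>z. g3 x y * g2 x z)) * sqrt (integral {0..1} (g1 y))"
    proof (rule CS)
      show "h (vec3 x y z) \<le> sqrt (g3 x y * g2 x z) * sqrt (g1 y z)" if "z \<in> {0..1}" for z
        using le[OF x y that] by (simp add: real_sqrt_mult mult_ac)
    qed (use x y nonneg in \<open>auto intro!: c1 c2 continuous_on_slab_line(3)[OF h] continuous_intros mult_nonneg_nonneg\<close>)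
    then show ?thesis by (simp add: G1_def G2_def)
  qed
  then have 2: "integral {0..Ly} (\<lambda>y. integral {0..1} (\<lambda>z. h (vec3 x y z)))
      \<le> sqrt (integral {0..Ly} (\<lambda>y. g3 x y * G2 x)) * sqrt (integral {0..Ly} G1)" if "x \<in> {0..Lx}" for x
    using that L(2) by (intro CS)
      (auto intro!: c3 cG nonneg mult_nonneg_nonneg G0 continuous_on_integral_z[OF h] continuous_intros)
  have 3: "integral {0..Ly} (\<lambda>y. integral {0..1} (\<lambda>z. h (vec3 x y z)))
      \<le> sqrt (integral {0..Ly} G1 * G3 x) * sqrt (G2 x)" if "x \<in> {0..Lx}" for x
    using 2[OF that] by (simp add: G3_def real_sqrt_mult mult_ac)
  have "integral {0..Lx} (\<lambda>x. integral {0..Ly} (\<lambda>y. integral {0..1} (\<lambda>z. h (vec3 x y z))))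
      \<le> sqrt (integral {0..Lx} (\<lambda>x. integral {0..Ly} G1 * G3 x)) * sqrt (integral {0..Lx} G2)"
    by (rule CS[OF L(1) _ _ _ _ _ 3])
       (auto intro!: cG G0 I1 mult_nonneg_nonneg ch continuous_intros)
  then show ?thesis
    unfolding integral_V_xyz[OF h]
    by (simp add: real_sqrt_mult mult_ac G1_def[abs_def] G2_def[abs_def] G3_def[abs_def])
qed

lemma integral_V_nonneg:
  fixes f :: "real^3 \<Rightarrow> real"
  assumes "continuous_on slab f" "\<And>x. x \<in> slab \<Longrightarrow> 0 \<le> f x"
  shows "0 \<le> integral (V Lx Ly) f"
  using integral_nonneg[OF integrable_V[OF assms(1)]] assms(2) V_subset_slab by blast

lemma box_V_nonempty: "0 < Lx \<Longrightarrow> 0 < Ly \<Longrightarrow> box 0 (vec3 Lx Ly 1) \<noteq> {}"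
proof -
  assume "0 < Lx" "0 < Ly"
  then have "vec3 (Lx/2) (Ly/2) (1/2) \<in> box 0 (vec3 Lx Ly 1)" by (simp add: mem_box_cart forall_3)
  then show ?thesis by blast
qed

lemma integral_V_Cauchy_Schwarz:
  fixes f g h :: "real^3 \<Rightarrow> real"
  assumes "0 < Lx" "0 < Ly" "continuous_on slab h" "continuous_on slab f" "continuous_on slab g"
    and "\<And>x. x \<in> slab \<Longrightarrow> 0 \<le> f x" "\<And>x. x \<in> slab \<Longrightarrow> 0 \<le> g x"
    and "\<And>x. x \<in> slab \<Longrightarrow> h x \<le> sqrt (f x) * sqrt (g x)"
  shows "integral (V Lx Ly) h \<le> sqrt (integral (V Lx Ly) f) * sqrt (integral (V Lx Ly) g)"
proof -
  have "cbox 0 (vec3 Lx Ly 1) \<subseteq> slab" using V_subset_slab V_cbox by metis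
  then show ?thesis unfolding V_cbox using assms
    by (intro integral_Cauchy_Schwarz box_V_nonempty) (auto intro: continuous_on_subset)
qed

lemma
  fixes f :: "real^3 \<Rightarrow> real"
  assumes "C1 f"
  shows C1_power: "C1 (\<lambda>x. f x ^ n)"
    and pd_power: "x \<in> slab \<Longrightarrow> pd j (\<lambda>x. f x ^ n) x = real n * f x ^ (n - 1) * pd j f x"
proof -
  have "C1 (\<lambda>x. f x ^ n) \<and> (x \<in> slab \<longrightarrow> pd j (\<lambda>x. f x ^ n) x = real n * f x ^ (n - 1) * pd j f x)"
  proof (induction n)
    case 0 show ?case by (simp add: C1_const pd_const)
  next
    case (Suc n)
    then show ?case using C1_mult[OF assms, of "\<lambda>x. f x ^ n"] pd_mult[OF assms, of "\<lambda>x. f x ^ n" x j]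
      by (cases n) (auto simp: algebra_simps)
  qed
  then show "C1 (\<lambda>x. f x ^ n)" "x \<in> slab \<Longrightarrow> pd j (\<lambda>x. f x ^ n) x = real n * f x ^ (n - 1) * pd j f x"
    by auto
qed

text \<open>Gagliardo's argument for \<open>w\<^sup>4\<close>: each factor bounds the supremum over one coordinate line by
  the mean plus the oscillation of \<open>w\<^sup>4\<close> along the line.\<close>

lemma Gagliardo_L6:
  fixes w :: "real^3 \<Rightarrow> real"
  assumes w: "C1 w" and per: "xy_periodic Lx Ly w" and L: "0 < Lx" "0 < Ly"
  defines "N \<equiv> sqrt (integral (V Lx Ly) (\<lambda>x. (w x)\<^sup>2))" and "a \<equiv> \<lambda>j. sqrt (integral (V Lx Ly) (\<lambda>x. (pd j w x)\<^sup>2))"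
  shows "sqrt (integral (V Lx Ly) (\<lambda>x. w x ^ 6)) \<le> (N / Lx + 2 * a 1) * (N / Ly + 2 * a 2) * (N + 4 * a 3)"
proof -
  define F where "F x = w x ^ 4" for x
  define F' where "F' j x = 4 * w x ^ 3 * pd j w x" for j x
  have F: "C1 F" unfolding F_def[abs_def] by (rule C1_power[OF w])
  have pdF: "pd j F x = F' j x" if "x \<in> slab" for j x
    unfolding F_def[abs_def] F'_def using pd_power[OF w that, of j 4] by simp
  note cw = C1_continuous[OF w] and cp = C1_continuous_pd[OF w]
  have cF: "continuous_on slab F" "continuous_on slab (F' j)" for j
    unfolding F_def[abs_def] F'_def[abs_def] by (intro continuous_intros cw cp)+
  have cF': "continuous_on slab (\<lambda>x. \<bar>F' j x\<bar>)" "continuous_on slab (\<lambda>x. \<bar>F x\<bar>)" for j by (intro continuous_intros cF)+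
  define g1 where "g1 y z = 1 / Lx * integral {0..Lx} (\<lambda>x. \<bar>F (vec3 x y z)\<bar>) + 1/2 * integral {0..Lx} (\<lambda>x. \<bar>F' 1 (vec3 x y z)\<bar>)" for y z
  define g2 where "g2 x z = 1 / Ly * integral {0..Ly} (\<lambda>y. \<bar>F (vec3 x y z)\<bar>) + 1/2 * integral {0..Ly} (\<lambda>y. \<bar>F' 2 (vec3 x y z)\<bar>)" for x z
  \<comment> \<open>There is no periodicity in \<open>z\<close>, so the variation enters with factor
    1 instead of \<open>1/2\<close>; the mean has coefficient 1 because the layer has height
    1.\<close>
  define g3 where "g3 x y = integral {0..1} (\<lambda>z. \<bar>F (vec3 x y z)\<bar>) + integral {0..1} (\<lambda>z. \<bar>F' 3 (vec3 x y z)\<bar>)" for x y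
  have b1: "\<bar>F (vec3 x y z)\<bar> \<le> g1 y z" if "x \<in> {0..Lx}" "z \<in> {0..1}" for x y z
    unfolding g1_def
  proof (rule sup_le_mean_plus_half[OF L(1) _ _ _ that(1)])
    show "((\<lambda>x. F (vec3 x y z)) has_vector_derivative F' 1 (vec3 x y z)) (at x within {0..Lx})" for x
      using C1_line1[OF F that(2), of y x "{0..Lx}"] pdF[of "vec3 x y z" 1] that by simp
    show "continuous_on {0..Lx} (\<lambda>x. F' 1 (vec3 x y z))" by (rule continuous_on_slab_line(1)[OF cF(2) that(2)])
    show "F (vec3 0 y z) = F (vec3 Lx y z)" using xy_periodicD1[OF per that(2)] by (simp add: F_def)
  qed
  have b2: "\<bar>F (vec3 x y z)\<bar> \<le> g2 x z" if "y \<in> {0..Ly}" "z \<in> {0..1}" for x y z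
    unfolding g2_def
  proof (rule sup_le_mean_plus_half[OF L(2) _ _ _ that(1)])
    show "((\<lambda>y. F (vec3 x y z)) has_vector_derivative F' 2 (vec3 x y z)) (at y within {0..Ly})" for y
      using C1_line2[OF F that(2), of x y "{0..Ly}"] pdF[of "vec3 x y z" 2] that by simp
    show "continuous_on {0..Ly} (\<lambda>y. F' 2 (vec3 x y z))" by (rule continuous_on_slab_line(2)[OF cF(2) that(2)])
    show "F (vec3 x 0 z) = F (vec3 x Ly z)" using xy_periodicD2[OF per that(2)] by (simp add: F_def)
  qed
  have b3: "\<bar>F (vec3 x y z)\<bar> \<le> g3 x y" if "z \<in> {0..1}" for x y z
  proof -
    have "\<bar>F (vec3 x y z)\<bar> \<le> 1 / 1 * integral {0..1} (\<lambda>z. \<bar>F (vec3 x y z)\<bar>) + integral {0..1} (\<lambda>z. \<bar>F' 3 (vec3 x y z)\<bar>)"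
    proof (rule sup_le_mean_plus[OF zero_less_one _ _ that])
      show "((\<lambda>z. F (vec3 x y z)) has_vector_derivative F' 3 (vec3 x y z)) (at z within {0..1})" if "z \<in> {0..1}" for z
        using C1_line3[OF F that order_refl, of x y] pdF[of "vec3 x y z" 3] that by simp
      show "continuous_on {0..1} (\<lambda>z. F' 3 (vec3 x y z))" by (rule continuous_on_slab_line(3)[OF cF(2)]) simp
    qed
    then show ?thesis by (simp add: g3_def)
  qed
  define S where "S = integral (V Lx Ly) (\<lambda>x. w x ^ 6)"
  have S0: "0 \<le> S" unfolding S_def by (intro integral_V_nonneg continuous_intros cw) simp
  have N0: "0 \<le> N" "0 \<le> a j" for j unfolding N_def a_def
    by (auto intro!: integral_V_nonneg continuous_intros cw cp)
  have w6: "sqrt (w x ^ 6) = \<bar>w x\<bar> ^ 3" for x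
    using real_sqrt_abs[of "w x ^ 3"] by (simp add: power_abs flip: power_mult)
  \<comment> \<open>With \<open>w ^ 4 = w ^ 3 * w\<close>, Cauchy-Schwarz produces one factor
    \<open>sqrt S\<close>, as it does for the derivative \<open>4 * w ^ 3 * pd j w\<close>. The
    power 4 is chosen to make this happen.\<close>
  have int_F: "integral (V Lx Ly) (\<lambda>x. \<bar>F x\<bar>) \<le> sqrt S * N"
    unfolding S_def N_def
  proof (rule integral_V_Cauchy_Schwarz[OF L])
    show "\<bar>F x\<bar> \<le> sqrt (w x ^ 6) * sqrt ((w x)\<^sup>2)" for x
      unfolding w6 F_def using power_Suc2[of "\<bar>w x\<bar>" 3] by (simp add: power_abs)
  qed (auto intro!: continuous_intros cw cF)
  have int_F': "integral (V Lx Ly) (\<lambda>x. \<bar>F' j x\<bar>) \<le> 4 * (sqrt S * a j)" for j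
  proof -
    have "integral (V Lx Ly) (\<lambda>x. \<bar>w x ^ 3 * pd j w x\<bar>) \<le> sqrt S * a j"
      unfolding S_def a_def
    proof (rule integral_V_Cauchy_Schwarz[OF L])
      show "\<bar>w x ^ 3 * pd j w x\<bar> \<le> sqrt (w x ^ 6) * sqrt ((pd j w x)\<^sup>2)" for x
        unfolding w6 by (simp add: abs_mult power_abs)
    qed (auto intro!: continuous_intros cw cp)
    then show ?thesis unfolding F'_def by (simp add: abs_mult mult.assoc)
  qed
  have i1: "integral {0..Ly} (\<lambda>y. integral {0..1} (g1 y)) \<le> sqrt S * (N / Lx + 2 * a 1)"
  proof -
    let ?G = "\<lambda>x. 1 / Lx * \<bar>F x\<bar> + 1/2 * \<bar>F' 1 x\<bar>"
    have c: "continuous_on slab ?G" by (intro continuous_intros cF)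
    have "integral {0..Ly} (\<lambda>y. integral {0..1} (g1 y)) = integral {0..Ly} (\<lambda>y. integral {0..1} (\<lambda>z. integral {0..Lx} (\<lambda>x. ?G (vec3 x y z))))"
      unfolding g1_def by (intro HK_integral_cong)
        (subst HK_integral_add,
         use L in \<open>auto intro!: integrable_continuous_real continuous_intros continuous_on_slab_line(1)[OF cF(1)] continuous_on_slab_line(1)[OF cF(2)]\<close>)
    also have "\<dots> = integral (V Lx Ly) ?G" by (rule integral_V_yzx[OF c, symmetric])
    also have "\<dots> = 1 / Lx * integral (V Lx Ly) (\<lambda>x. \<bar>F x\<bar>) + 1/2 * integral (V Lx Ly) (\<lambda>x. \<bar>F' 1 x\<bar>)"
      using L by (subst HK_integral_add) (auto intro!: integrable_V continuous_intros cF)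
    also have "\<dots> \<le> 1 / Lx * (sqrt S * N) + 1/2 * (4 * (sqrt S * a 1))"
      by (intro add_mono mult_left_mono int_F int_F') (use L in auto)
    finally show ?thesis by (simp add: algebra_simps)
  qed
  have i2: "integral {0..Lx} (\<lambda>x. integral {0..1} (g2 x)) \<le> sqrt S * (N / Ly + 2 * a 2)"
  proof -
    let ?G = "\<lambda>x. 1 / Ly * \<bar>F x\<bar> + 1/2 * \<bar>F' 2 x\<bar>"
    have c: "continuous_on slab ?G" by (intro continuous_intros cF)
    have "integral {0..Lx} (\<lambda>x. integral {0..1} (g2 x)) = integral {0..Lx} (\<lambda>x. integral {0..1} (\<lambda>z. integral {0..Ly} (\<lambda>y. ?G (vec3 x y z))))"
      unfolding g2_def by (intro HK_integral_cong)
        (subst HK_integral_add,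
         use L in \<open>auto intro!: integrable_continuous_real continuous_intros continuous_on_slab_line(2)[OF cF(1)] continuous_on_slab_line(2)[OF cF(2)]\<close>)
    also have "\<dots> = integral (V Lx Ly) ?G" by (rule integral_V_xzy[OF c, symmetric])
    also have "\<dots> = 1 / Ly * integral (V Lx Ly) (\<lambda>x. \<bar>F x\<bar>) + 1/2 * integral (V Lx Ly) (\<lambda>x. \<bar>F' 2 x\<bar>)"
      using L by (subst HK_integral_add) (auto intro!: integrable_V continuous_intros cF)
    also have "\<dots> \<le> 1 / Ly * (sqrt S * N) + 1/2 * (4 * (sqrt S * a 2))"
      by (intro add_mono mult_left_mono int_F int_F') (use L in auto)
    finally show ?thesis by (simp add: algebra_simps)
  qed
  have i3: "integral {0..Lx} (\<lambda>x. integral {0..Ly} (g3 x)) \<le> sqrt S * (N + 4 * a 3)"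
  proof -
    let ?G = "\<lambda>x. \<bar>F x\<bar> + \<bar>F' 3 x\<bar>"
    have c: "continuous_on slab ?G" by (intro continuous_intros cF)
    have "integral {0..Lx} (\<lambda>x. integral {0..Ly} (g3 x)) = integral {0..Lx} (\<lambda>x. integral {0..Ly} (\<lambda>y. integral {0..1} (\<lambda>z. ?G (vec3 x y z))))"
      unfolding g3_def by (intro HK_integral_cong)
        (subst HK_integral_add,
         use L in \<open>auto intro!: integrable_continuous_real continuous_intros continuous_on_slab_line(3)[OF cF(1)] continuous_on_slab_line(3)[OF cF(2)]\<close>)
    also have "\<dots> = integral (V Lx Ly) ?G" by (rule integral_V_xyz[OF c, symmetric])
    also have "\<dots> = integral (V Lx Ly) (\<lambda>x. \<bar>F x\<bar>) + integral (V Lx Ly) (\<lambda>x. \<bar>F' 3 x\<bar>)"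
      using L by (subst HK_integral_add) (auto intro!: integrable_V continuous_intros cF)
    also have "\<dots> \<le> sqrt S * N + 4 * (sqrt S * a 3)"
      by (intro add_mono int_F int_F')
    finally show ?thesis by (simp add: algebra_simps)
  qed
  have g0: "z \<in> {0..1} \<Longrightarrow> 0 \<le> g1 y z" "z \<in> {0..1} \<Longrightarrow> 0 \<le> g2 x z" "0 \<le> g3 x y" for x y z
    using b1[of 0 z y] b2[of 0 z x] b3[of 0 x y] L by force+
  \<comment> \<open>A function that is not integrable has integral 0, so nonnegativity holds without
    an integrability proof.\<close>
  have nn: "0 \<le> integral A f" if "\<And>x. x \<in> A \<Longrightarrow> 0 \<le> f x" for A :: "real set" and f :: "real \<Rightarrow> real"
    using that by (cases "f integrable_on A") (auto intro: integral_nonneg simp: not_integrable_integral)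
  define r where "r = sqrt S"
  have r: "0 \<le> r" "S = r * r" using S0 by (simp_all add: r_def)
  let ?s = "(N / Lx + 2 * a 1) * (N / Ly + 2 * a 2) * (N + 4 * a 3)"
  have "S \<le> sqrt (integral {0..Ly} (\<lambda>y. integral {0..1} (g1 y)))
    * sqrt (integral {0..Lx} (\<lambda>x. integral {0..1} (g2 x))) * sqrt (integral {0..Lx} (\<lambda>x. integral {0..Ly} (g3 x)))"
    unfolding S_def
  proof (rule Loomis_Whitney_box[OF L])
    show "w (vec3 x y z) ^ 6 \<le> sqrt (g1 y z) * sqrt (g2 x z) * sqrt (g3 x y)"
      if "x \<in> {0..Lx}" "y \<in> {0..Ly}" "z \<in> {0..1}" for x y z
    proof -
      let ?w = "w (vec3 x y z)"
      have "sqrt \<bar>F (vec3 x y z)\<bar> = ?w\<^sup>2"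
        unfolding F_def by (simp add: real_sqrt_unique power_mult[symmetric])
      then have "?w\<^sup>2 \<le> sqrt (g1 y z)" "?w\<^sup>2 \<le> sqrt (g2 x z)" "?w\<^sup>2 \<le> sqrt (g3 x y)"
        using b1[OF that(1,3), of y] b2[OF that(2,3), of x] b3[OF that(3), of x y] by (metis real_sqrt_le_mono)+
      then have "?w\<^sup>2 * ?w\<^sup>2 * ?w\<^sup>2 \<le> sqrt (g1 y z) * sqrt (g2 x z) * sqrt (g3 x y)"
        by (intro mult_mono) (use g0 that in auto)
      then show ?thesis by (simp add: power_add[symmetric])
    qed
    show "continuous_on ({0..Ly} \<times> {0..1}) (\<lambda>p. g1 (fst p) (snd p))"
      unfolding g1_def by (intro continuous_intros continuous_on_integral_x cF') auto
    show "continuous_on ({0..Lx} \<times> {0..1}) (\<lambda>p. g2 (fst p) (snd p))"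
      unfolding g2_def by (intro continuous_intros continuous_on_integral_y cF') auto
    show "continuous_on ({0..Lx} \<times> {0..Ly}) (\<lambda>p. g3 (fst p) (snd p))"
      unfolding g3_def by (intro continuous_intros continuous_on_integral_z cF')
  qed (use g0 L in \<open>auto intro!: continuous_intros cw\<close>)
  also have "\<dots> \<le> sqrt (r * (N / Lx + 2 * a 1)) * sqrt (r * (N / Ly + 2 * a 2)) * sqrt (r * (N + 4 * a 3))"
    by (intro mult_mono real_sqrt_le_mono i1[folded r_def] i2[folded r_def] i3[folded r_def]) (use r(1) N0 L in \<open>auto intro!: nn g0\<close>)
  also have "\<dots> = sqrt (r ^ 3 * ?s)"
    by (simp add: real_sqrt_mult power3_eq_cube mult_ac)
  \<comment> \<open>The unknown \<open>r = sqrt S\<close> stands on both sides. Squaring leaves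
    \<open>r ^ 4\<close> against \<open>r ^ 3 * ?s\<close>, and the common power cancels.\<close>
  finally have "S\<^sup>2 \<le> (sqrt (r ^ 3 * ?s))\<^sup>2" using S0 by (intro power_mono)
  also have "\<dots> = r ^ 3 * ?s" using r(1) N0 L by (subst real_sqrt_pow2) auto
  also have "S\<^sup>2 = r ^ 3 * r" unfolding r(2) by (simp add: power2_eq_square power3_eq_cube)
  finally have "r ^ 3 * r \<le> r ^ 3 * ?s" .
  moreover have "0 \<le> ?s" using N0 L by simp
  ultimately have "r \<le> ?s" using r(1) by (cases "r = 0") (auto simp: mult_le_cancel_left)
  then show ?thesis by (simp add: S_def r_def)
qed

text \<open>\<open>n = 0\<close> is excluded because \<open>0 ^ 0 = 1\<close> whereas
  \<open>0 powr 0 = 0\<close>.\<close>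

lemma power_powr:
  fixes x r :: real
  assumes "0 \<le> x" "0 < n"
  shows "(x ^ n) powr r = x powr (real n * r)"
proof (cases "x = 0")
  case False
  then have "x ^ n = x powr real n" using assms by (intro powr_realpow[symmetric]) simp
  then show ?thesis by (simp only: powr_powr)
qed (use assms in simp)

text \<open>The mean inequality is applied to the squares, because the Sobolev proof bounds the
  Euclidean length of the vector with entries \<open>a\<close>, \<open>b\<close>,
  \<open>c\<close>.\<close>

lemma AM_GM_cube:
  fixes a b c G :: real
  assumes "0 \<le> a" "0 \<le> b" "0 \<le> c" "a\<^sup>2 + b\<^sup>2 + c\<^sup>2 \<le> G\<^sup>2" "0 \<le> G"
  shows "a * b * c \<le> (G / sqrt 3) ^ 3"
proof -
  have AM: "27 * (x * y * z) \<le> (x + y + z) ^ 3" if "0 \<le> x" "0 \<le> y" "0 \<le> z" for x y z :: real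
  proof -
    \<comment> \<open>The first part is the classical factorisation of
      \<open>x ^ 3 + y ^ 3 + z ^ 3 - 3 * x * y * z\<close>; the second collects the mixed
      terms.\<close>
    have "(x + y + z) ^ 3 - 27 * (x * y * z) = 1/2 * (x + y + z) * ((x - y)\<^sup>2 + (y - z)\<^sup>2 + (z - x)\<^sup>2)
        + 3 * (x * (y - z)\<^sup>2 + y * (z - x)\<^sup>2 + z * (x - y)\<^sup>2)"
      by (simp add: power2_eq_square power3_eq_cube field_simps)
    also have "\<dots> \<ge> 0" using that by simp
    finally show ?thesis by simp
  qed
  have "27 * (a\<^sup>2 * b\<^sup>2 * c\<^sup>2) \<le> (a\<^sup>2 + b\<^sup>2 + c\<^sup>2) ^ 3" by (rule AM) auto
  also have "\<dots> \<le> (G\<^sup>2) ^ 3" by (rule power_mono) (use assms in auto)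
  finally have "a\<^sup>2 * b\<^sup>2 * c\<^sup>2 \<le> ((G / sqrt 3)\<^sup>2) ^ 3"
    by (simp add: power_divide)
  then have "(a * b * c)\<^sup>2 \<le> ((G / sqrt 3) ^ 3)\<^sup>2"
    by (simp add: power_mult_distrib flip: power_mult)
  then show ?thesis by (rule power2_le_imp_le) (use assms in simp)
qed

text \<open>With \<open>q = 1 / Lx\<^sup>2 + 1 / Ly\<^sup>2\<close> and \<open>m = 1 / lambda1\<close>, the left-hand side is what Gagliardo's argument
  yields. Since \<open>0.83\<^sup>3 \<le> 4 \<surd>2 / \<pi>\<^sup>2\<close>, it suffices that \<open>0.17 \<le> m (0.83 \<surd>(1 + q) - \<surd>(1/4 + q) / 2)\<close>;
  this follows from \<open>m \<ge> 1/\<pi>\<close>, because the bracket is at least \<open>0.57\<close> for every \<open>q\<close>.\<close>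

lemma C_S_lower_bound:
  assumes L: "0 < Lx" "0 < Ly"
  shows "16 * ((1 + sqrt (1/4 + 1 / Lx\<^sup>2 + 1 / Ly\<^sup>2) / (2 * lambda1 Lx Ly)) / sqrt 3) ^ 3 \<le> C_S Lx Ly ^ 3"
proof -
  define q where "q = 1 / Lx\<^sup>2 + 1 / Ly\<^sup>2"
  define m where "m = 1 / lambda1 Lx Ly"
  have q: "0 \<le> q" by (simp add: q_def)
  have m: "1 / pi \<le> m" "0 < m" using lambda1_bounds[OF L] by (auto simp: m_def field_simps)
  define A B where "A = sqrt (1 + q)" and "B = sqrt (1/4 + q)"
  have AB: "A\<^sup>2 = B\<^sup>2 + 3/4" "0 \<le> A" "0 < B" using q by (auto simp: A_def B_def add_pos_nonneg)
  have "57/100 + B/2 \<le> 83/100 * A"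
  proof (rule power2_le_imp_le)
    \<comment> \<open>The right side minus the left is a quadratic in \<open>B\<close> with leading
      coefficients 0.4389 and -0.57; completing the square at \<open>B = 2850/4389\<close> leaves a
      positive constant.\<close>
    have "(57/100 + B/2)\<^sup>2 \<le> (83/100)\<^sup>2 * (B\<^sup>2 + 3/4)"
      using zero_le_power2[of "B * 4389 - 2850"] by (simp add: power2_eq_square algebra_simps)
    then show "(57/100 + B/2)\<^sup>2 \<le> (83/100 * A)\<^sup>2" unfolding power_mult_distrib AB(1) .
  qed (use AB in simp)
  then have "m * (57/100) \<le> m * (83/100 * A - B/2)" using m by simp
  moreover have "17/100 \<le> m * (57/100)"
  proof -
    have "17/100 \<le> 1 / pi * (57/100)" using pi_approx(2) by (simp add: field_simps)
    also have "\<dots> \<le> m * (57/100)" using m(1) by (intro mult_right_mono) auto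
    finally show ?thesis .
  qed
  ultimately have key: "1 + m * B/2 \<le> 83/100 * (1 + m * A)" by (simp add: algebra_simps)
  have sqrt3: "sqrt 3 ^ 3 = 3 * sqrt 3" by (simp add: power3_eq_cube)
  have C3: "C3 ^ 3 = 4 / (pi\<^sup>2 * (3 * sqrt 3))"
  proof -
    have p: "(x powr (2/3)) ^ 3 = x\<^sup>2" if "0 < x" for x :: real
    proof -
      have "(x powr (2/3)) ^ 3 = (x powr (2/3)) powr real 3" using that by (intro powr_realpow[symmetric]) simp
      then show ?thesis using that by (simp add: powr_powr)
    qed
    show ?thesis unfolding C3_def power_divide power_mult_distrib sqrt3 by (simp add: p)
  qed
  \<comment> \<open>Cancelling \<open>16 / (3 * sqrt 3)\<close> leaves
    \<open>(83/100) ^ 3 * pi\<^sup>2 \<le> 4 * sqrt 2\<close>, about 5.643 against 5.657. This is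
    where the choice of \<open>83/100\<close> comes from.\<close>
  have num: "16 * (83/100) ^ 3 / (3 * sqrt 3) \<le> (2 * sqrt 2 * C3) ^ 3"
  proof -
    have pi2: "pi\<^sup>2 \<le> (31416/10000)\<^sup>2" by (rule power_mono) (use pi_approx(2) in auto)
    have s2: "14142/10000 \<le> sqrt 2" by (rule real_le_rsqrt) (simp add: power2_eq_square)
    have "(83/100) ^ 3 * pi\<^sup>2 \<le> (83/100) ^ 3 * (31416/10000)\<^sup>2" using pi2 by simp
    also have "\<dots> \<le> 4 * (14142/10000)" by (simp add: power2_eq_square power3_eq_cube)
    also have "\<dots> \<le> 4 * sqrt 2" using s2 by simp
    finally have n: "(83/100) ^ 3 * pi\<^sup>2 \<le> 4 * sqrt 2" .
    have "(2 * sqrt 2 * C3) ^ 3 = 16 * sqrt 2 * (4 / (pi\<^sup>2 * (3 * sqrt 3)))"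
      unfolding power_mult_distrib C3 by (simp add: power3_eq_cube)
    also have "\<dots> = 16 * (4 * sqrt 2 / pi\<^sup>2) / (3 * sqrt 3)" by simp
    finally have e: "(2 * sqrt 2 * C3) ^ 3 = 16 * (4 * sqrt 2 / pi\<^sup>2) / (3 * sqrt 3)" .
    have "(83/100) ^ 3 \<le> 4 * sqrt 2 / pi\<^sup>2" using n by (subst pos_le_divide_eq) auto
    then show ?thesis unfolding e by (intro divide_right_mono mult_left_mono) auto
  qed
  have "16 * ((1 + m * B/2) / sqrt 3) ^ 3 \<le> 16 * ((83/100 * (1 + m * A)) / sqrt 3) ^ 3"
    by (intro mult_left_mono power_mono divide_right_mono key) (use m AB in auto)
  also have "\<dots> = 16 * (83/100) ^ 3 / (3 * sqrt 3) * (1 + m * A) ^ 3"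
    unfolding power_mult_distrib power_divide sqrt3 by simp
  also have "\<dots> \<le> (2 * sqrt 2 * C3) ^ 3 * (1 + m * A) ^ 3"
    by (intro mult_right_mono num) (use m AB in auto)
  also have "\<dots> = C_S Lx Ly ^ 3"
    unfolding C_S_def power_mult_distrib by (simp add: A_def q_def m_def add.assoc)
  finally show ?thesis by (simp add: B_def q_def m_def add.assoc mult.commute)
qed

lemma C_P_pos: "0 < Lx \<Longrightarrow> 0 < Ly \<Longrightarrow> 0 < C_P Lx Ly"
  by (simp add: C_P_def lambda1_bounds)

lemma C_S_pos: "0 < Lx \<Longrightarrow> 0 < Ly \<Longrightarrow> 0 < C_S Lx Ly"
  unfolding C_S_def C3_def using lambda1_bounds(1)[of Lx Ly]
  by (auto intro!: mult_pos_pos divide_pos_pos add_pos_nonneg)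

definition grad_energy :: "real \<Rightarrow> real \<Rightarrow> (real^3 \<Rightarrow> real) \<Rightarrow> real" where
  "grad_energy Lx Ly f = (\<Sum>j\<in>UNIV. integral (V Lx Ly) (\<lambda>x. (pd j f x)\<^sup>2))"

lemma grad_energy_nonneg: "C1 f \<Longrightarrow> 0 \<le> grad_energy Lx Ly f"
  unfolding grad_energy_def by (intro sum_nonneg integral_V_nonneg continuous_intros C1_continuous_pd) auto

text \<open>Each factor in Gagliardo's bound is 2, 2 or 4 times an entry of \<open>?v + ?n\<close>,
  which accounts for the 16. At given length of a vector the product of its entries is largest when
  they are equal, and the length is at most \<open>G * (1 + D)\<close> by the triangle and Poincare
  inequalities.\<close>

lemma Sobolev_L6:
  fixes w :: "real^3 \<Rightarrow> real"
  assumes w: "C1 w" and per: "xy_periodic Lx Ly w" and L: "0 < Lx" "0 < Ly"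
    and poincare: "integral (V Lx Ly) (\<lambda>x. (w x)\<^sup>2) \<le> (C_P Lx Ly)\<^sup>2 * grad_energy Lx Ly w"
  shows "integral (V Lx Ly) (\<lambda>x. w x ^ 6) \<le> ((C_S Lx Ly)\<^sup>2 * grad_energy Lx Ly w) ^ 3"
proof -
  define N where "N = sqrt (integral (V Lx Ly) (\<lambda>x. (w x)\<^sup>2))"
  define a where "a j = sqrt (integral (V Lx Ly) (\<lambda>x. (pd j w x)\<^sup>2))" for j
  define G where "G = sqrt (grad_energy Lx Ly w)"
  define D where "D = sqrt (1/4 + 1 / Lx\<^sup>2 + 1 / Ly\<^sup>2) / (2 * lambda1 Lx Ly)"
  note lam = lambda1_bounds[OF L]
  have i0: "0 \<le> integral (V Lx Ly) (\<lambda>x. (w x)\<^sup>2)" "0 \<le> integral (V Lx Ly) (\<lambda>x. (pd j w x)\<^sup>2)" for j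
    by (intro integral_V_nonneg continuous_intros C1_continuous[OF w] C1_continuous_pd[OF w]; simp)+
  have N0: "0 \<le> N" "0 \<le> a j" "0 \<le> G" for j by (auto simp: N_def a_def G_def i0 grad_energy_nonneg[OF w])
  have G: "(a 1)\<^sup>2 + (a 2)\<^sup>2 + (a 3)\<^sup>2 = G\<^sup>2"
    using i0 grad_energy_nonneg[OF w] by (simp add: a_def G_def grad_energy_def sum_3)
  have NG: "N \<le> G / lambda1 Lx Ly"
  proof -
    have "N \<le> sqrt ((C_P Lx Ly)\<^sup>2 * grad_energy Lx Ly w)" unfolding N_def using poincare by simp
    also have "\<dots> = G / lambda1 Lx Ly" using lam(1) by (simp add: real_sqrt_mult G_def C_P_def)
    finally show ?thesis .
  qed
  have D0: "0 \<le> D" unfolding D_def using lam(1) by simp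
  let ?v = "vec3 (a 1) (a 2) (a 3)" and ?n = "N *\<^sub>R vec3 (1 / (2 * Lx)) (1 / (2 * Ly)) (1/4)"
  have norm3: "norm (vec3 x y z) = sqrt (x\<^sup>2 + y\<^sup>2 + z\<^sup>2)" for x y z
    by (simp add: norm_eq_sqrt_inner inner_vec_def sum_3 power2_eq_square)
  have "norm (?v + ?n) \<le> norm ?v + norm ?n" by (rule norm_triangle_ineq)
  also have "norm ?v = G" using N0 by (simp add: norm3 G)
  also have "norm ?n = N * (sqrt (1/4 + 1 / Lx\<^sup>2 + 1 / Ly\<^sup>2) / 2)"
  proof -
    have "(1 / (2 * Lx))\<^sup>2 + (1 / (2 * Ly))\<^sup>2 + (1/4)\<^sup>2 = (1/4 + 1 / Lx\<^sup>2 + 1 / Ly\<^sup>2) / 2\<^sup>2"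
      by (simp add: power2_eq_square field_simps)
    then have "sqrt ((1 / (2 * Lx))\<^sup>2 + (1 / (2 * Ly))\<^sup>2 + (1/4)\<^sup>2) = sqrt (1/4 + 1 / Lx\<^sup>2 + 1 / Ly\<^sup>2) / 2"
      by (simp only: real_sqrt_divide) simp
    then show ?thesis unfolding norm_scaleR norm3 using N0 by simp
  qed
  also have "\<dots> \<le> G / lambda1 Lx Ly * (sqrt (1/4 + 1 / Lx\<^sup>2 + 1 / Ly\<^sup>2) / 2)"
    by (intro mult_right_mono NG) simp
  also have "G + \<dots> = G * (1 + D)" by (simp add: D_def algebra_simps)
  finally have "norm (?v + ?n) \<le> G * (1 + D)" by simp
  then have "(norm (?v + ?n))\<^sup>2 \<le> (G * (1 + D))\<^sup>2" by (rule power_mono) simp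
  moreover have "(norm (?v + ?n))\<^sup>2 = (a 1 + N / (2 * Lx))\<^sup>2 + (a 2 + N / (2 * Ly))\<^sup>2 + (a 3 + N / 4)\<^sup>2"
    unfolding power2_norm_eq_inner inner_vec_def sum_3 by (simp add: power2_eq_square)
  ultimately have "(a 1 + N / (2 * Lx)) * (a 2 + N / (2 * Ly)) * (a 3 + N / 4) \<le> (G * (1 + D) / sqrt 3) ^ 3"
    by (intro AM_GM_cube) (use N0 L D0 in auto)
  moreover have "(G * (1 + D) / sqrt 3) ^ 3 = ((1 + D) / sqrt 3) ^ 3 * G ^ 3"
    unfolding power_divide power_mult_distrib by simp
  ultimately have "16 * ((a 1 + N / (2 * Lx)) * (a 2 + N / (2 * Ly)) * (a 3 + N / 4)) \<le> 16 * ((1 + D) / sqrt 3) ^ 3 * G ^ 3"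
    by linarith
  also have "16 * ((a 1 + N / (2 * Lx)) * (a 2 + N / (2 * Ly)) * (a 3 + N / 4)) = (N / Lx + 2 * a 1) * (N / Ly + 2 * a 2) * (N + 4 * a 3)"
    using L by (simp add: field_simps)
  also have "16 * ((1 + D) / sqrt 3) ^ 3 * G ^ 3 \<le> C_S Lx Ly ^ 3 * G ^ 3"
    unfolding D_def by (intro mult_right_mono C_S_lower_bound L) (use N0 in simp)
  finally have "sqrt (integral (V Lx Ly) (\<lambda>x. w x ^ 6)) \<le> (C_S Lx Ly * G) ^ 3"
    using Gagliardo_L6[OF w per L] by (simp add: N_def a_def power_mult_distrib)
  then have "integral (V Lx Ly) (\<lambda>x. w x ^ 6) \<le> ((C_S Lx Ly * G) ^ 3)\<^sup>2"
    by (rule sqrt_le_D)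
  also have "\<dots> = ((C_S Lx Ly)\<^sup>2 * G\<^sup>2) ^ 3" by (simp add: power_mult_distrib flip: power_mult)
  also have "G\<^sup>2 = grad_energy Lx Ly w" by (simp add: G_def grad_energy_nonneg[OF w])
  finally show ?thesis .
qed

lemma integral_V_Hoelder:
  fixes h :: "real^3 \<Rightarrow> real" and f :: "'i \<Rightarrow> real^3 \<Rightarrow> real" and w :: "'i \<Rightarrow> real"
  assumes L: "0 < Lx" "0 < Ly" and J: "finite J"
    and h: "continuous_on slab h" and f: "\<And>i. i \<in> J \<Longrightarrow> continuous_on slab (f i)"
    and f0: "\<And>i x. i \<in> J \<Longrightarrow> x \<in> slab \<Longrightarrow> 0 \<le> f i x"
    and w: "\<And>i. i \<in> J \<Longrightarrow> 0 \<le> w i" "(\<Sum>i\<in>J. w i) = 1"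
    and le: "\<And>x. x \<in> slab \<Longrightarrow> h x \<le> (\<Prod>i\<in>J. f i x powr w i)"
  shows "integral (V Lx Ly) h \<le> (\<Prod>i\<in>J. integral (V Lx Ly) (f i) powr w i)"
proof -
  have "cbox 0 (vec3 Lx Ly 1) \<subseteq> slab" using V_subset_slab V_cbox by metis
  then show ?thesis unfolding V_cbox using assms
    by (intro integral_Hoelder box_V_nonempty) (auto intro: continuous_on_subset)
qed

text \<open>The sixth power of the norm is the cube of a sum of squares; each of its 27 terms is
  bounded by Hoelder's inequality with three exponents 3. In effect this is Minkowski's inequality
  for the squares, so the scalar constant survives for vector fields.\<close>

lemma vector_Sobolev_L6:
  fixes F :: "real^3 \<Rightarrow> real^3"
  assumes F: "C1 F" and per: "xy_periodic Lx Ly F" and L: "0 < Lx" "0 < Ly"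
    and poincare: "\<And>i. integral (V Lx Ly) (\<lambda>x. (F x $ i)\<^sup>2) \<le> (C_P Lx Ly)\<^sup>2 * grad_energy Lx Ly (\<lambda>x. F x $ i)"
  shows "integral (V Lx Ly) (\<lambda>x. norm (F x) ^ 6) \<le> ((C_S Lx Ly)\<^sup>2 * (\<Sum>i\<in>UNIV. grad_energy Lx Ly (\<lambda>x. F x $ i))) ^ 3"
proof -
  define w where "w i x = F x $ i" for i x
  have w: "C1 (w i)" for i unfolding w_def using C1_component[OF F] by auto
  note cw = C1_continuous[OF w]
  define K where "K i = (C_S Lx Ly)\<^sup>2 * grad_energy Lx Ly (w i)" for i
  have K0: "0 \<le> K i" for i by (simp add: K_def grad_energy_nonneg w)
  have S: "integral (V Lx Ly) (\<lambda>x. w i x ^ 6) \<le> K i ^ 3" for i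
    unfolding K_def w_def using Sobolev_L6[OF C1_component[OF F] xy_periodic_component[OF per] L poincare] .
  have S0: "0 \<le> integral (V Lx Ly) (\<lambda>x. w i x ^ 6)" for i
    by (intro integral_V_nonneg continuous_intros cw) simp
  have cube_root: "(x ^ 3) powr (1/3) = x" if "0 \<le> x" for x :: real
    using power_powr[OF that, of 3 "1/3"] that by simp
  have triple: "integral (V Lx Ly) (\<lambda>x. (w i x)\<^sup>2 * ((w j x)\<^sup>2 * (w k x)\<^sup>2)) \<le> K i * (K j * K k)" for i j k
  proof -
    \<comment> \<open>The triple may contain repetitions, so Hoelder's inequality is indexed by
      position and not by component.\<close>
    define \<sigma> :: "3 \<Rightarrow> 3" where "\<sigma> l = (if l = 1 then i else if l = 2 then j else k)" for l
    have "integral (V Lx Ly) (\<lambda>x. (w i x)\<^sup>2 * ((w j x)\<^sup>2 * (w k x)\<^sup>2))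
        \<le> (\<Prod>l\<in>UNIV. integral (V Lx Ly) (\<lambda>x. w (\<sigma> l) x ^ 6) powr (1/3))"
    proof (rule integral_V_Hoelder[OF L finite])
      show "(w i x)\<^sup>2 * ((w j x)\<^sup>2 * (w k x)\<^sup>2) \<le> (\<Prod>l\<in>UNIV. (w (\<sigma> l) x ^ 6) powr (1/3))" for x
      proof -
        have "(y ^ 6) powr (1/3) = y\<^sup>2" for y :: real
          using cube_root[of "y\<^sup>2"] by (simp flip: power_mult)
        then show ?thesis unfolding UNIV_3 by (simp add: \<sigma>_def)
      qed
    qed (auto intro!: continuous_intros cw)
    also have "\<dots> \<le> (\<Prod>l\<in>UNIV. K (\<sigma> l))"
    proof (rule prod_mono, intro conjI)
      fix l
      have "integral (V Lx Ly) (\<lambda>x. w (\<sigma> l) x ^ 6) powr (1/3) \<le> (K (\<sigma> l) ^ 3) powr (1/3)"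
        by (intro powr_mono2 S S0) simp
      then show "integral (V Lx Ly) (\<lambda>x. w (\<sigma> l) x ^ 6) powr (1/3) \<le> K (\<sigma> l)" by (simp add: cube_root K0)
    qed simp
    also have "\<dots> = K i * (K j * K k)" unfolding UNIV_3 by (simp add: \<sigma>_def)
    finally show ?thesis .
  qed
  have "norm (F x) ^ 6 = (\<Sum>i\<in>UNIV. \<Sum>j\<in>UNIV. \<Sum>k\<in>UNIV. (w i x)\<^sup>2 * ((w j x)\<^sup>2 * (w k x)\<^sup>2))" for x
  proof -
    have "norm (F x) ^ 6 = ((norm (F x))\<^sup>2) ^ 3" by (simp flip: power_mult)
    also have "(norm (F x))\<^sup>2 = (\<Sum>i\<in>UNIV. (w i x)\<^sup>2)"
      unfolding power2_norm_eq_inner inner_vec_def w_def by (simp add: power2_eq_square)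
    also have "\<dots> ^ 3 = (\<Sum>i\<in>UNIV. \<Sum>j\<in>UNIV. \<Sum>k\<in>UNIV. (w i x)\<^sup>2 * ((w j x)\<^sup>2 * (w k x)\<^sup>2))"
      by (simp add: sum_3 power3_eq_cube algebra_simps)
    finally show ?thesis .
  qed
  then have "integral (V Lx Ly) (\<lambda>x. norm (F x) ^ 6)
      = (\<Sum>i\<in>UNIV. \<Sum>j\<in>UNIV. \<Sum>k\<in>UNIV. integral (V Lx Ly) (\<lambda>x. (w i x)\<^sup>2 * ((w j x)\<^sup>2 * (w k x)\<^sup>2)))"
    by (simp add: Henstock_Kurzweil_Integration.integral_sum integrable_sum integrable_V continuous_intros cw)
  also have "\<dots> \<le> (\<Sum>i\<in>UNIV. \<Sum>j\<in>UNIV. \<Sum>k\<in>UNIV. K i * (K j * K k))"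
    by (intro sum_mono triple)
  also have "\<dots> = (\<Sum>i\<in>UNIV. K i) ^ 3" by (simp add: sum_3 power3_eq_cube algebra_simps)
  finally show ?thesis by (simp add: K_def sum_distrib_left w_def[abs_def])
qed

text \<open>\<open>b\<close> is split as \<open>b powr (1 - 3/p)\<close> times
  \<open>b powr (3/p)\<close>, the first part measured in L2 and the second in L6. The weights
  \<open>1/2\<close>, \<open>1/p\<close>, \<open>(1 - 3/p) / 2\<close>, \<open>1 / (2 * p)\<close>
  of \<open>d\<close>, \<open>v\<close> and these two parts sum to 1, and nonnegativity of the third
  is the condition \<open>3 \<le> p\<close>.\<close>

lemma interpolated_Hoelder:
  fixes b v d :: "real^3 \<Rightarrow> real" and p a c g :: real
  assumes L: "0 < Lx" "0 < Ly" and p: "3 \<le> p"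
    and cont: "continuous_on slab b" "continuous_on slab v" "continuous_on slab d"
    and nonneg: "\<And>x. 0 \<le> b x" "\<And>x. 0 \<le> v x" "\<And>x. 0 \<le> d x" and acg: "0 < a" "0 < c" "0 < g"
    and d: "integral (V Lx Ly) (\<lambda>x. (d x)\<^sup>2) = g\<^sup>2"
    and b2: "integral (V Lx Ly) (\<lambda>x. (b x)\<^sup>2) \<le> (a * g)\<^sup>2"
    and b6: "integral (V Lx Ly) (\<lambda>x. b x ^ 6) \<le> (c\<^sup>2 * g\<^sup>2) ^ 3"
  shows "integral (V Lx Ly) (\<lambda>x. v x * (b x * d x))
    \<le> a powr ((p - 3) / p) * c powr (3 / p) * (integral (V Lx Ly) (\<lambda>x. v x powr p)) powr (1 / p) * g\<^sup>2"
proof -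
  define f where "f i = (if i = 0 then (\<lambda>x. (d x)\<^sup>2) else if i = 1 then (\<lambda>x. v x powr p)
     else if i = 2 then (\<lambda>x. (b x)\<^sup>2) else (\<lambda>x. b x ^ 6))" for i :: nat
  define w where "w i = (if i = 0 then 1/2 else if i = 1 then 1/p else if i = 2 then (1 - 3/p) / 2 else 1 / (2 * p))" for i :: nat
  have J: "{..<4::nat} = {0, 1, 2, 3}" by auto
  have prod4: "(\<Prod>i\<in>{..<4::nat}. k i) = k 0 * (k 1 * (k 2 * k 3))" for k :: "nat \<Rightarrow> real" unfolding J by simp
  have sum4: "(\<Sum>i\<in>{..<4::nat}. k i) = k 0 + (k 1 + (k 2 + k 3))" for k :: "nat \<Rightarrow> real" unfolding J by simp
  have sq: "(y\<^sup>2) powr r = y powr (2 * r)" if "0 \<le> y" for y r :: real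
    using power_powr[OF that, of 2 r] by simp
  have six: "(y ^ 6) powr r = y powr (6 * r)" if "0 \<le> y" for y r :: real
    using power_powr[OF that, of 6 r] by simp
  have "integral (V Lx Ly) (\<lambda>x. v x * (b x * d x)) \<le> (\<Prod>i\<in>{..<4}. integral (V Lx Ly) (f i) powr w i)"
  proof (rule integral_V_Hoelder[OF L])
    show "(\<Sum>i<4. w i) = 1" unfolding sum4 using p by (simp add: w_def field_simps)
    show "0 \<le> w i" for i using p by (simp add: w_def)
    show "v x * (b x * d x) \<le> (\<Prod>i<4. f i x powr w i)" for x
    proof (cases "b x = 0")
      case True then show ?thesis by (simp add: prod_nonneg)
    next
      case False
      have "b x powr (1 - 3/p) * b x powr (3/p) = b x"
        using False nonneg(1)[of x] by (simp add: powr_add[symmetric])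
      moreover have "(v x powr p) powr (1/p) = v x" using p nonneg(2)[of x] by (simp add: powr_powr)
      moreover have "d x powr 1 = d x" using nonneg(3)[of x] by simp
      moreover have "(b x)\<^sup>2 powr ((1 - 3/p) / 2) = b x powr (1 - 3/p)" "(b x ^ 6) powr (1 / (2 * p)) = b x powr (3/p)"
        "(d x)\<^sup>2 powr (1/2) = d x powr 1"
        unfolding sq[OF nonneg(1)] sq[OF nonneg(3)] six[OF nonneg(1)] by (simp_all add: diff_divide_distrib)
      moreover have "(\<Prod>i<4. f i x powr w i) = (d x)\<^sup>2 powr (1/2) * ((v x powr p) powr (1/p) *
          ((b x)\<^sup>2 powr ((1 - 3/p) / 2) * (b x ^ 6) powr (1 / (2 * p))))"
        unfolding prod4 f_def w_def by simp
      ultimately show ?thesis by (simp only: mult_ac order_refl)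
    qed
    show "continuous_on slab (f i)" for i
      using p nonneg by (auto simp: f_def intro!: continuous_intros cont continuous_on_powr')
    show "0 \<le> f i x" for i x using nonneg by (auto simp: f_def)
  qed (auto intro!: continuous_intros cont)
  also have "\<dots> = g * ((integral (V Lx Ly) (\<lambda>x. v x powr p)) powr (1/p) *
      ((integral (V Lx Ly) (\<lambda>x. (b x)\<^sup>2)) powr ((1 - 3/p) / 2) * (integral (V Lx Ly) (\<lambda>x. b x ^ 6)) powr (1 / (2 * p))))"
    unfolding prod4 using acg by (simp add: f_def w_def d sq)
  also have "\<dots> \<le> g * ((integral (V Lx Ly) (\<lambda>x. v x powr p)) powr (1/p) *
      (((a * g)\<^sup>2) powr ((1 - 3/p) / 2) * ((c\<^sup>2 * g\<^sup>2) ^ 3) powr (1 / (2 * p))))"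
    using acg p by (intro mult_left_mono mult_mono powr_mono2 b2 b6 integral_V_nonneg continuous_intros cont) auto
  also have "((a * g)\<^sup>2) powr ((1 - 3/p) / 2) = (a * g) powr ((p - 3) / p)"
  proof -
    have "2 * ((1 - 3/p) / 2) = (p - 3) / p" using p by (simp add: field_simps)
    moreover have "0 \<le> a * g" using acg by simp
    ultimately show ?thesis by (simp only: sq)
  qed
  also have "((c\<^sup>2 * g\<^sup>2) ^ 3) powr (1 / (2 * p)) = (c * g) powr (3 / p)"
  proof -
    have "(c\<^sup>2 * g\<^sup>2) ^ 3 = (c * g) ^ 6" by (simp add: power_mult_distrib flip: power_mult)
    then show ?thesis using acg by (simp add: six)
  qed
  also have "(a * g) powr ((p - 3) / p) * (c * g) powr (3 / p) = a powr ((p - 3) / p) * c powr (3 / p) * g"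
  proof -
    have "g powr ((p - 3) / p) * g powr (3 / p) = g powr 1"
      using p unfolding powr_add[symmetric] by (simp add: field_simps)
    then show ?thesis using acg by (simp add: powr_mult mult_ac)
  qed
  finally show ?thesis by (simp add: power2_eq_square mult_ac)
qed

section \<open>Identities at one instant\<close>

lemma
  fixes f g :: "real^3 \<Rightarrow> real"
  assumes "continuous_on slab f" "continuous_on slab g"
  shows integral_V_add: "integral (V Lx Ly) (\<lambda>x. f x + g x) = integral (V Lx Ly) f + integral (V Lx Ly) g"
    and integral_V_diff: "integral (V Lx Ly) (\<lambda>x. f x - g x) = integral (V Lx Ly) f - integral (V Lx Ly) g"
  using integrable_V[OF assms(1)] integrable_V[OF assms(2)]
  by (auto intro: HK_integral_add Henstock_Kurzweil_Integration.integral_diff)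

lemma integral_V_cong:
  "(\<And>x. x \<in> slab \<Longrightarrow> f x = g x) \<Longrightarrow> integral (V Lx Ly) f = integral (V Lx Ly) g"
  by (rule HK_integral_cong) (use V_subset_slab in blast)

lemma integral_V_mono:
  fixes f g :: "real^3 \<Rightarrow> real"
  assumes "continuous_on slab f" "continuous_on slab g" "\<And>x. x \<in> slab \<Longrightarrow> f x \<le> g x"
  shows "integral (V Lx Ly) f \<le> integral (V Lx Ly) g"
  by (rule integral_le) (use assms V_subset_slab integrable_V in blast)+

lemma integral_V_sum:
  fixes f :: "'i \<Rightarrow> real^3 \<Rightarrow> real"
  assumes "finite J" "\<And>i. i \<in> J \<Longrightarrow> continuous_on slab (f i)"
  shows "integral (V Lx Ly) (\<lambda>x. \<Sum>i\<in>J. f i x) = (\<Sum>i\<in>J. integral (V Lx Ly) (f i))"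
  by (rule Henstock_Kurzweil_Integration.integral_sum) (use assms integrable_V in auto)

text \<open>Only the product has to vanish on the walls: depending on the component, a Dirichlet
  condition on \<open>f\<close> or a Neumann condition on \<open>g\<close> supplies the
  zero.\<close>

lemma integral_V_lap_by_parts:
  fixes f g :: "real^3 \<Rightarrow> real"
  assumes f: "C1 f" "xy_periodic Lx Ly f" and g: "C1 g" "xy_periodic Lx Ly g" "\<And>j. C1 (pd j g)" and L: "0 < Lx" "0 < Ly"
    and bdry: "\<And>x y z. z = 0 \<or> z = 1 \<Longrightarrow> f (vec3 x y z) * pd 3 g (vec3 x y z) = 0"
  shows "integral (V Lx Ly) (\<lambda>x. f x * lap g x) = - (\<Sum>j\<in>UNIV. integral (V Lx Ly) (\<lambda>x. pd j f x * pd j g x))"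
proof -
  have "integral (V Lx Ly) (\<lambda>x. f x * lap g x) = (\<Sum>j\<in>UNIV. integral (V Lx Ly) (\<lambda>x. f x * pd j (pd j g) x))"
    unfolding lap_def sum_distrib_left
    by (rule integral_V_sum) (auto intro!: continuous_intros C1_continuous[OF f(1)] C1_continuous_pd[OF g(3)])
  also have "\<dots> = (\<Sum>j\<in>UNIV. - integral (V Lx Ly) (\<lambda>x. pd j f x * pd j g x))"
    by (intro sum.cong refl integral_V_by_parts f g xy_periodic_pd L) (simp add: bdry)
  finally show ?thesis by (simp add: sum_negf)
qed

text \<open>Fields frozen at one time. The time derivative of \<open>B\<close> is treated outside,
  and the wall conditions are restated by components, in the same form for both walls.\<close>

locale inertialess_instant =
  fixes Lx Ly Ek \<Lambda> Ra :: real and U B :: "real^3 \<Rightarrow> real^3" and P T :: "real^3 \<Rightarrow> real"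
  assumes L: "0 < Lx" "0 < Ly"
    and smooth: "smooth_on slab U" "smooth_on slab B" "smooth_on slab P" "smooth_on slab T"
    and periodic: "xy_periodic Lx Ly U" "xy_periodic Lx Ly B" "xy_periodic Lx Ly P" "xy_periodic Lx Ly T"
    and momentum: "\<And>x. x \<in> slab \<Longrightarrow> cross3 e_z (U x) + grad P x - Ek *\<^sub>R lap U x
        = \<Lambda> *\<^sub>R cross3 (curl B x) (B x) + (Ra * T x) *\<^sub>R e_z"
    and divergence: "\<And>x. x \<in> slab \<Longrightarrow> dive U x = 0" "\<And>x. x \<in> slab \<Longrightarrow> dive B x = 0"
    and wall_U: "\<And>x y z. z = 0 \<or> z = 1 \<Longrightarrow> U (vec3 x y z) $ 3 = 0"
    and wall_curl: "\<And>x y z. z = 0 \<or> z = 1 \<Longrightarrow> curl U (vec3 x y z) $ 1 = 0 \<and> curl U (vec3 x y z) $ 2 = 0"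
    and wall_B: "\<And>x y z. z = 0 \<or> z = 1 \<Longrightarrow> B (vec3 x y z) $ 1 = 0 \<and> B (vec3 x y z) $ 2 = 0"
begin

definition u :: "3 \<Rightarrow> real^3 \<Rightarrow> real" where "u i x = U x $ i"
definition b :: "3 \<Rightarrow> real^3 \<Rightarrow> real" where "b i x = B x $ i"
definition \<phi> :: "real^3 \<Rightarrow> real" where "\<phi> = Tbar T"

text \<open>The test field \<open>v = (v\<^sub>1, v\<^sub>2, 0)\<close> is the horizontal gradient of \<open>\<phi>\<close> rotated by a right angle. It is
  divergence free and tangential to the walls, and \<open>(e\<^sub>z \<times> u) \<bullet> v\<close> is the horizontal part of \<open>u \<bullet> \<nabla>\<phi>\<close>.\<close>

definition v :: "3 \<Rightarrow> real^3 \<Rightarrow> real" where "v i x = (if i = 1 then - pd 2 \<phi> x else pd 1 \<phi> x)"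

lemma smooth_u: "smooth_on slab (u i)" and smooth_b: "smooth_on slab (b i)"
  unfolding u_def b_def by (intro smooth_on_slab_component smooth)+

lemma C1_u: "C1 (u i)" and C1_pd_u: "C1 (pd j (u i))" and C1_b: "C1 (b i)" and C1_pd_b: "C1 (pd j (b i))"
  and C1_P: "C1 P" and C1_T: "C1 T" and C1_pd_T: "C1 (pd j T)"
  by (intro smooth_on_slab_C1 smooth_on_slab_pd smooth smooth_u smooth_b)+

lemma per_u: "xy_periodic Lx Ly (u i)" and per_b: "xy_periodic Lx Ly (b i)"
  unfolding u_def b_def using periodic by (auto intro: xy_periodic_component)

lemma C1_\<phi>: "C1 \<phi>" unfolding \<phi>_def by (rule C1_Tbar[OF C1_T])

lemma per_\<phi>: "xy_periodic Lx Ly \<phi>"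
  unfolding \<phi>_def by (rule xy_periodic_Tbar[OF C1_continuous[OF C1_T] periodic(4)])

lemma pd_\<phi>: "x \<in> slab \<Longrightarrow> pd 1 \<phi> x = Tbar (pd 1 T) x" "x \<in> slab \<Longrightarrow> pd 2 \<phi> x = Tbar (pd 2 T) x"
  "x \<in> slab \<Longrightarrow> pd 3 \<phi> x = T x"
  unfolding \<phi>_def by (simp_all add: pd_Tbar[OF C1_T])

text \<open>On the slab, \<open>pd j \<phi>\<close> is again a vertical primitive, namely of
  \<open>pd j T\<close>, so \<open>C1_Tbar\<close> applies once more.\<close>

lemma C1_pd_\<phi>: "j \<noteq> 3 \<Longrightarrow> C1 (pd j \<phi>)"
  using exhaust_3[of j] C1_cong[OF C1_Tbar[OF C1_pd_T[of 1]], of "pd 1 \<phi>"]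
    C1_cong[OF C1_Tbar[OF C1_pd_T[of 2]], of "pd 2 \<phi>"] pd_\<phi> by auto

lemma pd_\<phi>_commute: "x \<in> slab \<Longrightarrow> pd 2 (pd 1 \<phi>) x = pd 1 (pd 2 \<phi>) x"
  by (intro pd_commute C1_\<phi> C1_pd_\<phi>) auto

lemma C1_v: "C1 (v i)" and per_v: "xy_periodic Lx Ly (v i)"
proof -
  have "v i = (if i = 1 then (\<lambda>x. - pd 2 \<phi> x) else pd 1 \<phi>)" by (auto simp: v_def)
  then show "C1 (v i)" using C1_pd_\<phi> C1_minus by auto
  show "xy_periodic Lx Ly (v i)"
    using xy_periodic_pd[OF C1_\<phi> per_\<phi>] by (auto simp: xy_periodic_def v_def)
qed

lemmas cont = C1_continuous[OF C1_u] C1_continuous_pd[OF C1_u] C1_continuous_pd[OF C1_pd_u]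
  C1_continuous[OF C1_b] C1_continuous_pd[OF C1_b] C1_continuous_pd[OF C1_pd_b]
  C1_continuous[OF C1_P] C1_continuous_pd[OF C1_P] C1_continuous[OF C1_T] C1_continuous[OF C1_\<phi>]
  C1_continuous_pd[OF C1_\<phi>] C1_continuous[OF C1_v] C1_continuous_pd[OF C1_v]

lemma continuous_lap: "continuous_on slab (lap (u i))" "continuous_on slab (lap (b i))"
  unfolding lap_def[abs_def] by (intro continuous_intros cont)+

lemma div_u: "x \<in> slab \<Longrightarrow> pd 3 (u 3) x = - pd 1 (u 1) x - pd 2 (u 2) x"
  and div_b: "x \<in> slab \<Longrightarrow> pd 3 (b 3) x = - pd 1 (b 1) x - pd 2 (b 2) x"
proof -
  assume x: "x \<in> slab"
  have "pd 1 (u 1) x + pd 2 (u 2) x + pd 3 (u 3) x = 0" "pd 1 (b 1) x + pd 2 (b 2) x + pd 3 (b 3) x = 0"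
    using divergence[OF x] by (simp_all add: dive_def sum_3 u_def[abs_def] b_def[abs_def])
  then show "pd 3 (u 3) x = - pd 1 (u 1) x - pd 2 (u 2) x" "pd 3 (b 3) x = - pd 1 (b 1) x - pd 2 (b 2) x"
    by linarith+
qed

lemma wall_u3: "z = 0 \<or> z = 1 \<Longrightarrow> u 3 (vec3 x y z) = 0"
  and wall_b12: "z = 0 \<or> z = 1 \<Longrightarrow> b 1 (vec3 x y z) = 0" "z = 0 \<or> z = 1 \<Longrightarrow> b 2 (vec3 x y z) = 0"
  using wall_U wall_B by (simp_all add: u_def b_def)

text \<open>The horizontal components of the curl contain one vertical derivative of
  \<open>u 1\<close> or \<open>u 2\<close> and one horizontal derivative of \<open>u 3\<close>. The
  latter vanishes by no penetration, so stress-free becomes a Neumann condition.\<close>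

lemma wall_pd_u: "z = 0 \<or> z = 1 \<Longrightarrow> pd 3 (u 1) (vec3 x y z) = 0" "z = 0 \<or> z = 1 \<Longrightarrow> pd 3 (u 2) (vec3 x y z) = 0"
proof -
  assume z: "z = 0 \<or> z = 1"
  then have z': "z \<in> {0..1}" by auto
  show "pd 3 (u 1) (vec3 x y z) = 0" "pd 3 (u 2) (vec3 x y z) = 0"
    using wall_curl[OF z, of x y] pd_plane_zero[OF C1_u[of 3] z' wall_u3[OF z], of x y]
    by (simp_all add: curl_def u_def[abs_def])
qed

text \<open>\<open>b 1\<close> and \<open>b 2\<close> vanish along the walls, hence so do their
  horizontal derivatives, and the divergence condition leaves a Neumann condition for
  \<open>b 3\<close>.\<close>

lemma wall_pd_b3: "z = 0 \<or> z = 1 \<Longrightarrow> pd 3 (b 3) (vec3 x y z) = 0"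
proof -
  assume z: "z = 0 \<or> z = 1"
  then have z': "z \<in> {0..1}" by auto
  then have "vec3 x y z \<in> slab" by simp
  then show ?thesis
    using pd_plane_zero(1)[OF C1_b[of 1] z' wall_b12(1)[OF z], of x y]
      pd_plane_zero(2)[OF C1_b[of 2] z' wall_b12(2)[OF z], of x y] by (simp add: div_b)
qed

text \<open>The vertical derivatives in \<open>curl E\<close> come multiplied by \<open>b 1\<close>
  or \<open>b 2\<close>, which vanish on the walls, so \<open>E\<close> may be arbitrary
  there.\<close>

lemma curl_by_parts:
  assumes E: "\<And>k. C1 (\<lambda>x. E x $ k)" "\<And>k. xy_periodic Lx Ly (\<lambda>x. E x $ k)"
  shows "integral (V Lx Ly) (\<lambda>x. B x \<bullet> curl E x) = integral (V Lx Ly) (\<lambda>x. E x \<bullet> curl B x)"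
proof -
  define e where "e k x = E x $ k" for k x
  have e: "C1 (e k)" "xy_periodic Lx Ly (e k)" for k unfolding e_def using E by auto
  note ce = C1_continuous[OF e(1)] C1_continuous_pd[OF e(1)]
  have ibp: "integral (V Lx Ly) (\<lambda>x. b i x * pd j (e k) x) = - integral (V Lx Ly) (\<lambda>x. pd j (b i) x * e k x)"
    if "j \<noteq> 3 \<or> i \<noteq> 3" for i j k
  proof (rule integral_V_by_parts[OF C1_b per_b e L])
    show "b i (vec3 x y 0) * e k (vec3 x y 0) = 0 \<and> b i (vec3 x y 1) * e k (vec3 x y 1) = 0" if "j = 3" for x y
      using \<open>j \<noteq> 3 \<or> i \<noteq> 3\<close> that exhaust_3[of i] wall_b12 by auto
  qed
  have "integral (V Lx Ly) (\<lambda>x. B x \<bullet> curl E x) = integral (V Lx Ly) (\<lambda>x.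
      (b 1 x * pd 2 (e 3) x - b 1 x * pd 3 (e 2) x) + (b 2 x * pd 3 (e 1) x - b 2 x * pd 1 (e 3) x)
      + (b 3 x * pd 1 (e 2) x - b 3 x * pd 2 (e 1) x))"
    by (intro integral_V_cong) (simp add: inner_vec_def sum_3 curl_def b_def e_def[abs_def] algebra_simps)
  also have "\<dots> = integral (V Lx Ly) (\<lambda>x.
      (pd 3 (b 1) x * e 2 x - pd 2 (b 1) x * e 3 x) + (pd 1 (b 2) x * e 3 x - pd 3 (b 2) x * e 1 x)
      + (pd 2 (b 3) x * e 1 x - pd 1 (b 3) x * e 2 x))"
    by (simp add: integral_V_add integral_V_diff continuous_intros cont ce ibp[of 1 2 3] ibp[of 1 3 2] ibp[of 2 3 1] ibp[of 2 1 3] ibp[of 3 1 2] ibp[of 3 2 1])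
  also have "\<dots> = integral (V Lx Ly) (\<lambda>x. E x \<bullet> curl B x)"
    by (intro integral_V_cong) (simp add: inner_vec_def sum_3 curl_def b_def[abs_def] e_def algebra_simps)
  finally show ?thesis .
qed

section \<open>Energy balances of the magnetic field and the velocity\<close>

definition GU :: real where "GU = (\<Sum>i\<in>UNIV. grad_energy Lx Ly (u i))"
definition GB :: real where "GB = (\<Sum>i\<in>UNIV. grad_energy Lx Ly (b i))"
definition GV :: real where "GV = grad_energy Lx Ly (v 1) + grad_energy Lx Ly (v 2)"

definition lorentz_work :: real where
  "lorentz_work = integral (V Lx Ly) (\<lambda>x. U x \<bullet> cross3 (curl B x) (B x))"

lemma B_lap: "integral (V Lx Ly) (\<lambda>x. B x \<bullet> lap B x) = - GB"
proof -
  have "integral (V Lx Ly) (\<lambda>x. B x \<bullet> lap B x) = integral (V Lx Ly) (\<lambda>x. \<Sum>i\<in>UNIV. b i x * lap (b i) x)"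
    by (intro integral_V_cong) (simp add: inner_vec_def lap_component[OF smooth(2)] b_def[abs_def])
  also have "\<dots> = (\<Sum>i\<in>UNIV. integral (V Lx Ly) (\<lambda>x. b i x * lap (b i) x))"
    by (rule integral_V_sum) (auto intro!: continuous_intros cont continuous_lap)
  also have "\<dots> = (\<Sum>i\<in>UNIV. - (\<Sum>j\<in>UNIV. integral (V Lx Ly) (\<lambda>x. pd j (b i) x * pd j (b i) x)))"
  proof (intro sum.cong refl integral_V_lap_by_parts C1_b C1_pd_b per_b L)
    show "b i (vec3 x y z) * pd 3 (b i) (vec3 x y z) = 0" if "z = 0 \<or> z = 1" for i x y z
      using exhaust_3[of i] wall_b12[OF that] wall_pd_b3[OF that] by auto
  qed
  finally show ?thesis by (simp add: GB_def grad_energy_def sum_negf power2_eq_square)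
qed

lemma emf_component: "(\<lambda>x. cross3 (U x) (B x) $ k) =
    (if k = 1 then (\<lambda>x. u 2 x * b 3 x - u 3 x * b 2 x) else if k = 2 then (\<lambda>x. u 3 x * b 1 x - u 1 x * b 3 x)
     else (\<lambda>x. u 1 x * b 2 x - u 2 x * b 1 x))"
  using exhaust_3[of k] by (auto simp: cross3_def u_def b_def)

text \<open>Once the curl has been moved to \<open>B\<close>, the scalar triple product is minus the
  integrand of \<open>lorentz_work\<close>.\<close>

lemma induction_balance:
  "integral (V Lx Ly) (\<lambda>x. B x \<bullet> curl (\<lambda>y. cross3 (U y) (B y)) x) = - lorentz_work"
proof -
  have "integral (V Lx Ly) (\<lambda>x. B x \<bullet> curl (\<lambda>y. cross3 (U y) (B y)) x) = integral (V Lx Ly) (\<lambda>x. cross3 (U x) (B x) \<bullet> curl B x)"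
  proof (rule curl_by_parts)
    show "C1 (\<lambda>x. cross3 (U x) (B x) $ k)" for k unfolding emf_component by (auto intro!: C1_diff C1_mult C1_u C1_b)
    show "xy_periodic Lx Ly (\<lambda>x. cross3 (U x) (B x) $ k)" for k
      using periodic by (simp add: xy_periodic_def)
  qed
  also have "\<dots> = integral (V Lx Ly) (\<lambda>x. - (U x \<bullet> cross3 (curl B x) (B x)))"
    by (intro integral_V_cong) (simp add: cross3_def inner_vec_def sum_3 algebra_simps)
  finally show ?thesis by (simp add: lorentz_work_def)
qed

lemma continuous_curl_emf: "continuous_on slab (\<lambda>x. B x \<bullet> curl (\<lambda>y. cross3 (U y) (B y)) x)"
proof -
  have "C1 (\<lambda>x. cross3 (U x) (B x) $ k)" for k
    unfolding emf_component by (auto intro!: C1_diff C1_mult C1_u C1_b)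
  then have c: "continuous_on slab (pd j (\<lambda>x. cross3 (U x) (B x) $ k))" for j k by (rule C1_continuous_pd)
  show ?thesis unfolding inner_vec_def sum_3 curl_def vector_3 inner_real_def b_def[symmetric]
    by (intro continuous_intros cont c)
qed

lemma continuous_lap_B: "continuous_on slab (lap B)"
  unfolding lap_def[abs_def]
  by (intro continuous_intros C1_continuous_pd smooth_on_slab_C1 smooth_on_slab_pd smooth)

text \<open>Magnetic tension minus the gradient of the magnetic pressure, half the squared norm of
  \<open>B\<close>.\<close>

lemma lorentz_component: "x \<in> slab \<Longrightarrow> cross3 (curl B x) (B x) $ i =
    (\<Sum>j\<in>UNIV. b j x * pd j (b i) x) - (\<Sum>j\<in>UNIV. b j x * pd i (b j) x)"
  using exhaust_3[of i] by (auto simp: cross3_def curl_def sum_3 b_def[abs_def] algebra_simps)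

lemma momentum_component: "x \<in> slab \<Longrightarrow>
   (if i = 1 then - u 2 x else if i = 2 then u 1 x else 0) + pd i P x - Ek * lap (u i) x
     = \<Lambda> * cross3 (curl B x) (B x) $ i + (if i = 3 then Ra * T x else 0)"
proof -
  assume x: "x \<in> slab"
  have "cross3 e_z (U x) $ i = (if i = 1 then - u 2 x else if i = 2 then u 1 x else 0)"
    using exhaust_3[of i] by (auto simp: cross3_def u_def axis_def)
  then show ?thesis
    using arg_cong[OF momentum[OF x], of "\<lambda>w. w $ i"]
    by (simp add: grad_def lap_component[OF smooth(1) x] u_def[abs_def] axis_def)
qed

lemma continuous_lorentz: "continuous_on slab (\<lambda>x. cross3 (curl B x) (B x) $ i)"
proof -
  have "continuous_on slab (\<lambda>x. (\<Sum>j\<in>UNIV. b j x * pd j (b i) x) - (\<Sum>j\<in>UNIV. b j x * pd i (b j) x))"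
    by (intro continuous_intros cont)
  then show ?thesis by (rule continuous_on_cong[THEN iffD1, rotated -1]) (simp_all add: lorentz_component)
qed

text \<open>The Coriolis force does no work pointwise; the pressure does none because the flow is
  divergence free and does not cross the walls. The viscous wall terms vanish by
  \<open>wall_u3\<close> for \<open>u 3\<close> and by \<open>wall_pd_u\<close> for the
  others.\<close>

lemma kinetic_balance:
  "Ek * GU = \<Lambda> * lorentz_work + Ra * integral (V Lx Ly) (\<lambda>x. T x * u 3 x)"
proof -
  have lap: "integral (V Lx Ly) (\<lambda>x. u i x * lap (u i) x) = - grad_energy Lx Ly (u i)" for i
  proof -
    have "integral (V Lx Ly) (\<lambda>x. u i x * lap (u i) x) = - (\<Sum>j\<in>UNIV. integral (V Lx Ly) (\<lambda>x. pd j (u i) x * pd j (u i) x))"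
    proof (intro integral_V_lap_by_parts C1_u C1_pd_u per_u L)
      show "u i (vec3 x y z) * pd 3 (u i) (vec3 x y z) = 0" if "z = 0 \<or> z = 1" for x y z
        using exhaust_3[of i] wall_u3[OF that] wall_pd_u[OF that] by auto
    qed
    then show ?thesis by (simp add: grad_energy_def power2_eq_square)
  qed
  have P: "integral (V Lx Ly) (\<lambda>x. u i x * pd i P x) = - integral (V Lx Ly) (\<lambda>x. pd i (u i) x * P x)" for i
    by (rule integral_V_by_parts[OF C1_u per_u C1_P periodic(3) L]) (auto simp: wall_u3)
  have "(\<Sum>i\<in>UNIV. integral (V Lx Ly) (\<lambda>x. u i x * pd i P x)) = - integral (V Lx Ly) (\<lambda>x. \<Sum>i\<in>UNIV. pd i (u i) x * P x)"
    unfolding P sum_negf by (subst integral_V_sum) (auto intro!: continuous_intros cont)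
  also have "integral (V Lx Ly) (\<lambda>x. \<Sum>i\<in>UNIV. pd i (u i) x * P x) = integral (V Lx Ly) (\<lambda>x. 0)"
    by (intro integral_V_cong) (simp add: sum_3 div_u algebra_simps)
  finally have P0: "(\<Sum>i\<in>UNIV. integral (V Lx Ly) (\<lambda>x. u i x * pd i P x)) = 0" by simp
  have work: "(\<Sum>i\<in>UNIV. integral (V Lx Ly) (\<lambda>x. u i x * cross3 (curl B x) (B x) $ i)) = lorentz_work"
  proof -
    have "lorentz_work = integral (V Lx Ly) (\<lambda>x. \<Sum>i\<in>UNIV. u i x * cross3 (curl B x) (B x) $ i)"
      unfolding lorentz_work_def by (intro integral_V_cong) (simp add: inner_vec_def u_def)
    also have "\<dots> = (\<Sum>i\<in>UNIV. integral (V Lx Ly) (\<lambda>x. u i x * cross3 (curl B x) (B x) $ i))"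
      by (rule integral_V_sum) (auto intro!: continuous_intros cont continuous_lorentz)
    finally show ?thesis by simp
  qed
  have "(\<Sum>i\<in>UNIV. integral (V Lx Ly) (\<lambda>x. u i x * pd i P x - Ek * (u i x * lap (u i) x)))
    = (\<Sum>i\<in>UNIV. integral (V Lx Ly) (\<lambda>x. \<Lambda> * (u i x * cross3 (curl B x) (B x) $ i) + (if i = 3 then Ra * (T x * u 3 x) else 0)))"
    (is "(\<Sum>i\<in>UNIV. integral _ (?f i)) = (\<Sum>i\<in>UNIV. integral _ (?g i))")
  proof -
    have f: "continuous_on slab (?f i)" for i by (intro continuous_intros cont continuous_lap)
    have g: "continuous_on slab (?g i)" for i
      by (cases "i = 3") (auto intro!: continuous_intros cont continuous_lorentz)
    have "(\<Sum>i\<in>UNIV. ?f i x) = (\<Sum>i\<in>UNIV. ?g i x)" if x: "x \<in> slab" for x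
    proof -
      have "u 1 x * (- u 2 x + pd 1 P x - Ek * lap (u 1) x) = u 1 x * (\<Lambda> * cross3 (curl B x) (B x) $ 1)"
        "u 2 x * (u 1 x + pd 2 P x - Ek * lap (u 2) x) = u 2 x * (\<Lambda> * cross3 (curl B x) (B x) $ 2)"
        "u 3 x * (pd 3 P x - Ek * lap (u 3) x) = u 3 x * (\<Lambda> * cross3 (curl B x) (B x) $ 3 + Ra * T x)"
        using momentum_component[OF x, of 1] momentum_component[OF x, of 2] momentum_component[OF x, of 3] by simp_all
      then show ?thesis by (simp add: sum_3 algebra_simps)
    qed
    then have "integral (V Lx Ly) (\<lambda>x. \<Sum>i\<in>UNIV. ?f i x) = integral (V Lx Ly) (\<lambda>x. \<Sum>i\<in>UNIV. ?g i x)"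
      by (rule integral_V_cong)
    then show ?thesis using integral_V_sum[of UNIV ?f] integral_V_sum[of UNIV ?g] f g by simp
  qed
  moreover have "(\<Sum>i\<in>UNIV. integral (V Lx Ly) (?f i)) = Ek * GU"
    using P0 by (simp add: integral_V_diff continuous_intros cont continuous_lap sum.distrib lap GU_def sum_negf sum_distrib_left)
  moreover have "(\<Sum>i\<in>UNIV. integral (V Lx Ly) (?g i)) = \<Lambda> * lorentz_work + Ra * integral (V Lx Ly) (\<lambda>x. T x * u 3 x)"
    unfolding work[symmetric]
    by (simp add: sum_3 integral_V_add continuous_intros cont continuous_lorentz algebra_simps)
  ultimately show ?thesis by simp
qed

section \<open>The momentum equation tested with the rotated gradient\<close>

definition advection :: real where
  "advection = integral (V Lx Ly) (\<lambda>x. u 1 x * pd 1 \<phi> x + u 2 x * pd 2 \<phi> x)"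

text \<open>Vertical velocity is traded for horizontal velocity: with \<open>T\<close> written as
  \<open>pd 3 \<phi>\<close>, no penetration removes the wall terms, also at the top where \<phi>
  itself need not vanish, and \<open>div_u\<close> replaces \<open>pd 3 (u 3)\<close>.\<close>

lemma buoyancy_work: "integral (V Lx Ly) (\<lambda>x. T x * u 3 x) = - advection"
proof -
  have "integral (V Lx Ly) (\<lambda>x. T x * u 3 x) = integral (V Lx Ly) (\<lambda>x. u 3 x * pd 3 \<phi> x)"
    by (intro integral_V_cong) (simp add: pd_\<phi>)
  also have "\<dots> = - integral (V Lx Ly) (\<lambda>x. pd 3 (u 3) x * \<phi> x)"
    by (rule integral_V_by_parts[OF C1_u per_u C1_\<phi> per_\<phi> L]) (auto simp: wall_u3)
  also have "integral (V Lx Ly) (\<lambda>x. pd 3 (u 3) x * \<phi> x) = integral (V Lx Ly) (\<lambda>x. - (pd 1 (u 1) x * \<phi> x) - pd 2 (u 2) x * \<phi> x)"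
    by (intro integral_V_cong) (simp add: div_u algebra_simps)
  also have "\<dots> = integral (V Lx Ly) (\<lambda>x. u 1 x * pd 1 \<phi> x) + integral (V Lx Ly) (\<lambda>x. u 2 x * pd 2 \<phi> x)"
    using integral_V_by_parts[OF C1_u[of 1] per_u C1_\<phi> per_\<phi> L, of 1] integral_V_by_parts[OF C1_u[of 2] per_u C1_\<phi> per_\<phi> L, of 2]
    by (simp add: integral_V_diff continuous_intros cont)
  finally show ?thesis unfolding advection_def by (simp add: integral_V_add continuous_intros cont)
qed

text \<open>The test field is divergence free by symmetry of mixed derivatives, and being horizontal
  it produces no wall terms. Applied to the pressure and to the magnetic pressure.\<close>

lemma v_orthogonal_gradient:
  assumes S: "C1 S" "xy_periodic Lx Ly S"
  shows "integral (V Lx Ly) (\<lambda>x. v 1 x * pd 1 S x + v 2 x * pd 2 S x) = 0"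
proof -
  have "integral (V Lx Ly) (\<lambda>x. v 1 x * pd 1 S x + v 2 x * pd 2 S x)
      = - (integral (V Lx Ly) (\<lambda>x. pd 1 (v 1) x * S x) + integral (V Lx Ly) (\<lambda>x. pd 2 (v 2) x * S x))"
    using integral_V_by_parts[OF C1_v[of 1] per_v S L, of 1] integral_V_by_parts[OF C1_v[of 2] per_v S L, of 2]
    by (simp add: integral_V_add continuous_intros cont C1_continuous_pd[OF S(1)])
  also have "\<dots> = - integral (V Lx Ly) (\<lambda>x. pd 1 (v 1) x * S x + pd 2 (v 2) x * S x)"
    by (simp add: integral_V_add continuous_intros cont C1_continuous[OF S(1)])
  also have "integral (V Lx Ly) (\<lambda>x. pd 1 (v 1) x * S x + pd 2 (v 2) x * S x) = integral (V Lx Ly) (\<lambda>x. 0)"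
  proof (rule integral_V_cong)
    fix x assume x: "x \<in> slab"
    have "pd 1 (v 1) x = - pd 1 (pd 2 \<phi>) x" "pd 2 (v 2) x = pd 2 (pd 1 \<phi>) x"
      using pd_minus[OF C1_pd_\<phi>[of 2] x] by (simp_all add: v_def[abs_def])
    then show "pd 1 (v 1) x * S x + pd 2 (v 2) x * S x = 0" using pd_\<phi>_commute[OF x] by simp
  qed
  finally show ?thesis by simp
qed

text \<open>Work of the magnetic tension (B \<bullet> \<nabla>) B on the test field. Only the
  indices 1 and 2 occur: the third component of the test field is 0, which \<open>v 3\<close> does
  not encode.\<close>

definition stretching :: real where
  "stretching = integral (V Lx Ly) (\<lambda>x. \<Sum>j\<in>UNIV. b j x * (v 1 x * pd j (b 1) x + v 2 x * pd j (b 2) x))"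

lemma lorentz_v: "integral (V Lx Ly) (\<lambda>x. v 1 x * cross3 (curl B x) (B x) $ 1 + v 2 x * cross3 (curl B x) (B x) $ 2) = stretching"
proof -
  define S where "S x = 1/2 * (b 1 x * b 1 x + b 2 x * b 2 x + b 3 x * b 3 x)" for x
  have S: "C1 S" unfolding S_def[abs_def] by (intro C1_mult C1_add C1_const C1_b)
  have perS: "xy_periodic Lx Ly S" using per_b by (simp add: xy_periodic_def S_def)
  have pdS: "pd i S x = (\<Sum>j\<in>UNIV. b j x * pd i (b j) x)" if "x \<in> slab" for i x
    unfolding S_def[abs_def] using that
    by (subst pd_mult) (auto intro!: C1_mult C1_add C1_const C1_b simp: pd_mult pd_add pd_const C1_mult C1_add C1_b sum_3)
  have "integral (V Lx Ly) (\<lambda>x. v 1 x * cross3 (curl B x) (B x) $ 1 + v 2 x * cross3 (curl B x) (B x) $ 2)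
      = integral (V Lx Ly) (\<lambda>x. (\<Sum>j\<in>UNIV. b j x * (v 1 x * pd j (b 1) x + v 2 x * pd j (b 2) x)) - (v 1 x * pd 1 S x + v 2 x * pd 2 S x))"
    by (intro integral_V_cong) (simp add: lorentz_component pdS sum_3 algebra_simps)
  also have "\<dots> = stretching - 0"
    unfolding stretching_def v_orthogonal_gradient[OF S perS, symmetric]
    by (intro integral_V_diff continuous_intros cont C1_continuous_pd[OF S])
  finally show ?thesis by simp
qed

definition shear_product :: real where
  "shear_product = (\<Sum>j\<in>UNIV. integral (V Lx Ly) (\<lambda>x. pd j (v 1) x * pd j (u 1) x) + integral (V Lx Ly) (\<lambda>x. pd j (v 2) x * pd j (u 2) x))"

text \<open>On the walls the test field is merely tangential; the boundary term of the Laplacian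
  vanishes by the Neumann condition on \<open>u 1\<close> and \<open>u 2\<close>.\<close>

lemma tested_momentum: "advection = \<Lambda> * stretching - Ek * shear_product"
proof -
  have lap: "integral (V Lx Ly) (\<lambda>x. v i x * lap (u i) x) = - (\<Sum>j\<in>UNIV. integral (V Lx Ly) (\<lambda>x. pd j (v i) x * pd j (u i) x))"
    if "i \<noteq> 3" for i
  proof (intro integral_V_lap_by_parts C1_u C1_pd_u per_u C1_v per_v L)
    show "v i (vec3 x y z) * pd 3 (u i) (vec3 x y z) = 0" if "z = 0 \<or> z = 1" for x y z
      using exhaust_3[of i] \<open>i \<noteq> 3\<close> wall_pd_u[OF that] by auto
  qed
  have "\<Lambda> * stretching = integral (V Lx Ly) (\<lambda>x. \<Lambda> * (v 1 x * cross3 (curl B x) (B x) $ 1 + v 2 x * cross3 (curl B x) (B x) $ 2))"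
    unfolding lorentz_v[symmetric] by simp
  also have "\<dots> = integral (V Lx Ly) (\<lambda>x. ((u 1 x * pd 1 \<phi> x + u 2 x * pd 2 \<phi> x) + (v 1 x * pd 1 P x + v 2 x * pd 2 P x))
      - (Ek * (v 1 x * lap (u 1) x) + Ek * (v 2 x * lap (u 2) x)))"
  proof (rule integral_V_cong)
    fix x assume x: "x \<in> slab"
    have v: "v 1 x = - pd 2 \<phi> x" "v 2 x = pd 1 \<phi> x" by (simp_all add: v_def)
    have "v 1 x * (- u 2 x + pd 1 P x - Ek * lap (u 1) x) = v 1 x * (\<Lambda> * cross3 (curl B x) (B x) $ 1)"
      "v 2 x * (u 1 x + pd 2 P x - Ek * lap (u 2) x) = v 2 x * (\<Lambda> * cross3 (curl B x) (B x) $ 2)"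
      using momentum_component[OF x, of 1] momentum_component[OF x, of 2] by simp_all
    then show "\<Lambda> * (v 1 x * cross3 (curl B x) (B x) $ 1 + v 2 x * cross3 (curl B x) (B x) $ 2)
      = ((u 1 x * pd 1 \<phi> x + u 2 x * pd 2 \<phi> x) + (v 1 x * pd 1 P x + v 2 x * pd 2 P x))
      - (Ek * (v 1 x * lap (u 1) x) + Ek * (v 2 x * lap (u 2) x))"
      by (simp add: v algebra_simps)
  qed
  also have "\<dots> = (advection + 0) - (Ek * integral (V Lx Ly) (\<lambda>x. v 1 x * lap (u 1) x) + Ek * integral (V Lx Ly) (\<lambda>x. v 2 x * lap (u 2) x))"
    unfolding advection_def v_orthogonal_gradient[OF C1_P periodic(3), symmetric]
    by (subst integral_V_diff, (intro continuous_intros cont continuous_lap)+, subst integral_V_add, (intro continuous_intros cont)+,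
        subst (3) integral_V_add, (intro continuous_intros cont continuous_lap)+, simp)
  also have "\<dots> = advection + Ek * shear_product"
    by (simp add: lap shear_product_def sum.distrib algebra_simps)
  finally show ?thesis by simp
qed

text \<open>Young's inequality with the weights that give the velocity gradient the coefficient 1,
  so that the dissipation \<open>Ek * GU\<close> absorbs it exactly.\<close>

lemma shear_product_le: "Ra * shear_product \<le> GU + Ra\<^sup>2 / 4 * GV"
proof -
  have *: "Ra * integral (V Lx Ly) (\<lambda>x. pd j (v i) x * pd j (u i) x)
    \<le> integral (V Lx Ly) (\<lambda>x. (pd j (u i) x)\<^sup>2) + Ra\<^sup>2 / 4 * integral (V Lx Ly) (\<lambda>x. (pd j (v i) x)\<^sup>2)" for i j
  proof -
    have "Ra * integral (V Lx Ly) (\<lambda>x. pd j (v i) x * pd j (u i) x) = integral (V Lx Ly) (\<lambda>x. Ra * (pd j (v i) x * pd j (u i) x))"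
      by simp
    also have "\<dots> \<le> integral (V Lx Ly) (\<lambda>x. (pd j (u i) x)\<^sup>2 + Ra\<^sup>2 / 4 * (pd j (v i) x)\<^sup>2)"
    proof (rule integral_V_mono)
      show "Ra * (pd j (v i) x * pd j (u i) x) \<le> (pd j (u i) x)\<^sup>2 + Ra\<^sup>2 / 4 * (pd j (v i) x)\<^sup>2" for x
        using zero_le_power2[of "pd j (u i) x - Ra / 2 * pd j (v i) x"] by (simp add: power2_eq_square algebra_simps)
    qed (intro continuous_intros cont)+
    also have "\<dots> = integral (V Lx Ly) (\<lambda>x. (pd j (u i) x)\<^sup>2) + integral (V Lx Ly) (\<lambda>x. Ra\<^sup>2 / 4 * (pd j (v i) x)\<^sup>2)"
      by (intro integral_V_add continuous_intros cont)
    also have "integral (V Lx Ly) (\<lambda>x. Ra\<^sup>2 / 4 * (pd j (v i) x)\<^sup>2) = Ra\<^sup>2 / 4 * integral (V Lx Ly) (\<lambda>x. (pd j (v i) x)\<^sup>2)"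
      by (rule Henstock_Kurzweil_Integration.integral_mult_right)
    finally show ?thesis .
  qed
  have "Ra * shear_product \<le> grad_energy Lx Ly (u 1) + grad_energy Lx Ly (u 2) + Ra\<^sup>2 / 4 * GV"
    using *[of 1 1] *[of 2 1] *[of 3 1] *[of 1 2] *[of 2 2] *[of 3 2]
    by (simp add: shear_product_def grad_energy_def GV_def sum_3 algebra_simps)
  then show ?thesis using grad_energy_nonneg[OF C1_u[of 3], of Lx Ly] by (simp add: GU_def sum_3)
qed

text \<open>\<open>growth\<close> is the magnetic energy balance under dynamo action. It is
  multiplied by \<Lambda> because the momentum balances determine
  \<open>\<Lambda> * lorentz_work\<close>; the final division produces
  \<open>Ek / (4 * \<Lambda>)\<close>.\<close>

lemma dynamo_inequality:
  assumes "0 < \<Lambda>" "0 < Ek" and growth: "0 \<le> - lorentz_work - 1 / Rm * GB"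
  shows "1 / Rm * GB \<le> - Ra * stretching + Ra\<^sup>2 * Ek / (4 * \<Lambda>) * GV"
proof -
  have "\<Lambda> * lorentz_work = Ek * GU + Ra * (\<Lambda> * stretching - Ek * shear_product)"
    using kinetic_balance unfolding buoyancy_work tested_momentum by (simp add: algebra_simps)
  then have "\<Lambda> * (1 / Rm * GB) \<le> - (Ek * GU + Ra * (\<Lambda> * stretching - Ek * shear_product))"
    using mult_left_mono[OF growth, of \<Lambda>] assms(1) by (simp add: algebra_simps)
  also have "\<dots> \<le> - Ra * \<Lambda> * stretching + Ek * (Ra\<^sup>2 / 4 * GV)"
    using mult_left_mono[OF shear_product_le, of Ek] assms(2) by (simp add: algebra_simps)
  also have "\<dots> = \<Lambda> * (- Ra * stretching + Ra\<^sup>2 * Ek / (4 * \<Lambda>) * GV)"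
    using assms(1) by (simp add: field_simps)
  finally show ?thesis using assms(1) by (simp only: mult_le_cancel_left_pos)
qed

end

section \<open>Norms\<close>

lemma integral_lebesgue_V:
  fixes f :: "real^3 \<Rightarrow> real"
  assumes "continuous_on slab f"
  shows "integral\<^sup>L (lebesgue_on (V Lx Ly)) f = integral (V Lx Ly) f"
    and "integrable (lebesgue_on (V Lx Ly)) f"
  unfolding V_cbox
  by (rule integral_lebesgue_on_cbox; rule continuous_on_subset[OF assms]; use V_subset_slab V_cbox in metis)+

lemma power2_norm_matrix:
  fixes M :: "real^'n^'m"
  shows "(norm M)\<^sup>2 = (\<Sum>i\<in>UNIV. \<Sum>j\<in>UNIV. (M $ i $ j)\<^sup>2)"
  unfolding power2_norm_eq_inner inner_vec_def by (simp add: power2_eq_square)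

lemma continuous_on_Grad:
  fixes F :: "real^3 \<Rightarrow> real^'m"
  assumes "\<And>i. C1 (\<lambda>x. F x $ i)"
  shows "continuous_on slab (Grad F)"
  unfolding Grad_def[abs_def] by (intro continuous_on_vec_lambda C1_continuous_pd assms)

lemma integral_norm_Grad:
  fixes F :: "real^3 \<Rightarrow> real^'m"
  assumes "\<And>i. C1 (\<lambda>x. F x $ i)"
  shows "integral (V Lx Ly) (\<lambda>x. (norm (Grad F x))\<^sup>2) = (\<Sum>i\<in>UNIV. grad_energy Lx Ly (\<lambda>x. F x $ i))"
proof -
  have "integral (V Lx Ly) (\<lambda>x. (norm (Grad F x))\<^sup>2)
      = integral (V Lx Ly) (\<lambda>x. \<Sum>i\<in>UNIV. \<Sum>j\<in>UNIV. (pd j (\<lambda>x. F x $ i) x)\<^sup>2)"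
    by (simp add: power2_norm_matrix Grad_def)
  also have "\<dots> = (\<Sum>i\<in>UNIV. integral (V Lx Ly) (\<lambda>x. \<Sum>j\<in>UNIV. (pd j (\<lambda>x. F x $ i) x)\<^sup>2))"
    by (rule integral_V_sum) (auto intro!: continuous_intros C1_continuous_pd[OF assms])
  also have "\<dots> = (\<Sum>i\<in>UNIV. \<Sum>j\<in>UNIV. integral (V Lx Ly) (\<lambda>x. (pd j (\<lambda>x. F x $ i) x)\<^sup>2))"
    by (intro sum.cong refl integral_V_sum) (auto intro!: continuous_intros C1_continuous_pd[OF assms])
  finally show ?thesis by (simp add: grad_energy_def)
qed

lemma Lp_norm_2_squared:
  fixes F :: "real^3 \<Rightarrow> 'b::real_normed_vector"
  assumes "continuous_on slab F"
  shows "(Lp_norm 2 (V Lx Ly) F)\<^sup>2 = integral (V Lx Ly) (\<lambda>x. (norm (F x))\<^sup>2)"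
proof -
  have c: "continuous_on slab (\<lambda>x. (norm (F x))\<^sup>2)" by (intro continuous_intros assms)
  have "norm (F x) powr 2 = (norm (F x))\<^sup>2" for x by (cases "F x = 0") simp_all
  moreover have "0 \<le> integral (V Lx Ly) (\<lambda>x. (norm (F x))\<^sup>2)" by (rule integral_V_nonneg[OF c]) simp
  ultimately show ?thesis
    by (simp add: Lp_norm_def integral_lebesgue_V[OF c] powr_half_sqrt)
qed

lemma integral_le_esssup_mult:
  fixes f g :: "real^3 \<Rightarrow> real"
  assumes f: "continuous_on slab f" and g: "continuous_on slab g" and g0: "\<And>x. 0 \<le> g x"
  shows "integral (V Lx Ly) (\<lambda>x. f x * g x)
    \<le> real_of_ereal (esssup (lebesgue_on (V Lx Ly)) (\<lambda>x. ereal (f x))) * integral (V Lx Ly) g"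
proof -
  let ?M = "lebesgue_on (V Lx Ly)"
  define s where "s = esssup ?M (\<lambda>x. ereal (f x))"
  have fV: "continuous_on (V Lx Ly) f" using continuous_on_subset[OF f V_subset_slab] .
  have "compact (V Lx Ly)" by (simp add: V_cbox)
  then have "bounded (f ` V Lx Ly)" using fV by (intro compact_imp_bounded compact_continuous_image)
  then obtain K where K: "\<And>x. x \<in> V Lx Ly \<Longrightarrow> \<bar>f x\<bar> \<le> K" by (auto simp: bounded_iff)
  have meas: "f \<in> borel_measurable ?M"
    by (rule continuous_imp_measurable_on_sets_lebesgue[OF fV]) (simp add: V_cbox)
  \<comment> \<open>Finiteness matters because \<open>real_of_ereal\<close> sends infinity to 0,
    which would spoil the estimate.\<close>
  have "s \<le> ereal K" unfolding s_def
  proof (rule esssup_I)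
    show "(\<lambda>x. ereal (f x)) \<in> borel_measurable ?M" using meas by simp
    show "AE x in ?M. ereal (f x) \<le> ereal K"
      by (rule AE_I2) (use K abs_le_iff in \<open>auto simp: space_restrict_space\<close>)
  qed
  then have s: "s \<noteq> \<infinity>" by auto
  have "AE x in ?M. ereal (f x) \<le> s" unfolding s_def by (rule esssup_AE)
  then have AE: "AE x in ?M. f x * g x \<le> real_of_ereal s * g x"
  proof eventually_elim
    case (elim x)
    then have "f x \<le> real_of_ereal s" using s by (cases s) auto
    then show ?case using g0 by (rule mult_right_mono)
  qed
  have c: "continuous_on slab (\<lambda>x. f x * g x)" "continuous_on slab (\<lambda>x. real_of_ereal s * g x)"
    by (intro continuous_intros f g)+
  have "integral (V Lx Ly) (\<lambda>x. f x * g x) \<le> integral (V Lx Ly) (\<lambda>x. real_of_ereal s * g x)"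
    unfolding integral_lebesgue_V(1)[OF c(1), symmetric] integral_lebesgue_V(1)[OF c(2), symmetric]
    by (rule integral_mono_AE[OF integral_lebesgue_V(2)[OF c(1)] integral_lebesgue_V(2)[OF c(2)] AE])
  then show ?thesis by (simp add: s_def)
qed

lemma trilinear_bound:
  fixes F :: "real^3 \<Rightarrow> 'b::real_normed_vector" and b d :: "real^3 \<Rightarrow> real" and p :: ereal
  assumes L: "0 < Lx" "0 < Ly" and p: "3 \<le> p"
    and cont: "continuous_on slab F" "continuous_on slab b" "continuous_on slab d"
    and nonneg: "\<And>x. 0 \<le> b x" "\<And>x. 0 \<le> d x" and g: "0 < g"
    and d: "integral (V Lx Ly) (\<lambda>x. (d x)\<^sup>2) = g\<^sup>2"
    and b2: "integral (V Lx Ly) (\<lambda>x. (b x)\<^sup>2) \<le> (C_P Lx Ly * g)\<^sup>2"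
    and b6: "integral (V Lx Ly) (\<lambda>x. b x ^ 6) \<le> ((C_S Lx Ly)\<^sup>2 * g\<^sup>2) ^ 3"
  shows "integral (V Lx Ly) (\<lambda>x. norm (F x) * (b x * d x)) \<le> A_const p Lx Ly * Lp_norm p (V Lx Ly) F * g\<^sup>2"
proof (cases "p = \<infinity>")
  case True
  define s where "s = Lp_norm p (V Lx Ly) F"
  have cbd: "continuous_on slab (\<lambda>x. b x * d x)" by (intro continuous_intros cont)
  have "integral (V Lx Ly) (\<lambda>x. b x * d x)
      \<le> sqrt (integral (V Lx Ly) (\<lambda>x. (b x)\<^sup>2)) * sqrt (integral (V Lx Ly) (\<lambda>x. (d x)\<^sup>2))"
    by (rule integral_V_Cauchy_Schwarz[OF L cbd]) (use nonneg in \<open>auto intro!: continuous_intros cont\<close>)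
  also have "\<dots> \<le> (C_P Lx Ly * g) * g"
    unfolding d using g C_P_pos[OF L] b2 by (intro mult_mono real_le_lsqrt) auto
  finally have bd: "integral (V Lx Ly) (\<lambda>x. b x * d x) \<le> (C_P Lx Ly * g) * g" .
  have le: "integral (V Lx Ly) (\<lambda>x. norm (F x) * (b x * d x)) \<le> s * integral (V Lx Ly) (\<lambda>x. b x * d x)"
    unfolding s_def Lp_norm_def using True integral_le_esssup_mult[OF continuous_on_norm[OF cont(1)] cbd] nonneg by simp
  \<comment> \<open>The sign of \<open>s\<close> is hidden behind \<open>real_of_ereal\<close>; it
    is read off from the estimate against the constant 1, since the box has positive volume.\<close>
  have "0 \<le> s"
  proof -
    have V0: "0 \<in> V Lx Ly" using L by (simp add: V_def)
    have one: "continuous_on slab (\<lambda>x. 1 :: real)" by (rule continuous_on_const)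
    have "integral (V Lx Ly) (\<lambda>x. 1 :: real) \<noteq> 0"
      using integral_cbox_eq_0_iff[OF continuous_on_const box_V_nonempty[OF L], of "1 :: real"] V0
      unfolding V_cbox by auto
    then have "0 < integral (V Lx Ly) (\<lambda>x. 1 :: real)"
      using integral_V_nonneg[OF one, of Lx Ly] by simp
    moreover have "0 \<le> s * integral (V Lx Ly) (\<lambda>x. 1 :: real)"
      using integral_le_esssup_mult[OF continuous_on_norm[OF cont(1)] one, of Lx Ly] True
        integral_V_nonneg[OF continuous_on_norm[OF cont(1)], of Lx Ly] by (simp add: s_def Lp_norm_def)
    ultimately show ?thesis by (simp add: zero_le_mult_iff)
  qed
  then have "s * integral (V Lx Ly) (\<lambda>x. b x * d x) \<le> s * ((C_P Lx Ly * g) * g)"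
    by (rule mult_left_mono[OF bd])
  with le show ?thesis using True by (simp add: A_const_def s_def power2_eq_square mult_ac)
next
  case False
  then obtain r where r: "p = ereal r" "3 \<le> r" using p by (cases p) auto
  have c: "continuous_on slab (\<lambda>x. norm (F x) powr r)"
    using r by (intro continuous_on_powr' continuous_intros cont) auto
  have "integral (V Lx Ly) (\<lambda>x. norm (F x) * (b x * d x))
      \<le> C_P Lx Ly powr ((r - 3) / r) * C_S Lx Ly powr (3 / r) * (integral (V Lx Ly) (\<lambda>x. norm (F x) powr r)) powr (1 / r) * g\<^sup>2"
    by (rule interpolated_Hoelder[OF L r(2)]) (use assms C_P_pos[OF L] C_S_pos[OF L] in \<open>auto intro: continuous_on_norm\<close>)
  then show ?thesis using r by (simp add: A_const_def Lp_norm_def integral_lebesgue_V[OF c])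
qed

lemma continuous_on_grad_xy:
  assumes "C1 f"
  shows "continuous_on slab (grad_xy f)"
proof -
  have "grad_xy f = (\<lambda>x. \<chi> i. if i = 1 then pd 1 f x else pd 2 f x)"
    by (simp add: fun_eq_iff vec_eq_iff forall_2 grad_xy_def)
  moreover have "continuous_on slab (\<lambda>x. if i = 1 then pd 1 f x else pd 2 f x)" for i :: 2
    by (cases "i = 1") (simp_all add: C1_continuous_pd[OF assms])
  ultimately show ?thesis by (simp add: continuous_on_vec_lambda)
qed

text \<open>Cauchy-Schwarz in the plane for the rotated \<open>q\<close>, where the two sides differ
  by the square of \<open>q $ 1 * \<alpha> + q $ 2 * \<beta>\<close>, then for the first two rows of
  \<open>M\<close>; the third row completes the Frobenius norm.\<close>

lemma trilinear_pointwise: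
  fixes M :: "real^3^3" and B :: "real^3" and q :: "real^2"
  shows "q $ 2 * (B \<bullet> M $ 1) - q $ 1 * (B \<bullet> M $ 2) \<le> norm q * (norm B * norm M)"
proof (rule power2_le_imp_le)
  define \<alpha> \<beta> where "\<alpha> = B \<bullet> M $ 1" and "\<beta> = B \<bullet> M $ 2"
  have CS: "(B \<bullet> M $ i)\<^sup>2 \<le> (norm B)\<^sup>2 * (norm (M $ i))\<^sup>2" for i
    using Cauchy_Schwarz_ineq[of B "M $ i"] by (simp add: power2_norm_eq_inner)
  have "(q $ 2 * \<alpha> - q $ 1 * \<beta>)\<^sup>2 \<le> ((q $ 1)\<^sup>2 + (q $ 2)\<^sup>2) * (\<alpha>\<^sup>2 + \<beta>\<^sup>2)"
    using zero_le_power2[of "q $ 1 * \<alpha> + q $ 2 * \<beta>"] by (simp add: power2_eq_square algebra_simps)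
  also have "(q $ 1)\<^sup>2 + (q $ 2)\<^sup>2 = (norm q)\<^sup>2"
    unfolding power2_norm_eq_inner inner_vec_def by (simp add: sum_2 power2_eq_square)
  also have "(norm q)\<^sup>2 * (\<alpha>\<^sup>2 + \<beta>\<^sup>2) \<le> (norm q)\<^sup>2 * ((norm B)\<^sup>2 * (norm M)\<^sup>2)"
  proof (rule mult_left_mono)
    have "\<alpha>\<^sup>2 + \<beta>\<^sup>2 \<le> (norm B)\<^sup>2 * ((norm (M $ 1))\<^sup>2 + (norm (M $ 2))\<^sup>2 + (norm (M $ 3))\<^sup>2)"
      using add_mono[OF CS[of 1] CS[of 2]] by (simp add: \<alpha>_def \<beta>_def distrib_left add_increasing2)
    also have "(norm (M $ 1))\<^sup>2 + (norm (M $ 2))\<^sup>2 + (norm (M $ 3))\<^sup>2 = (norm M)\<^sup>2"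
      unfolding power2_norm_eq_inner by (simp add: inner_vec_def[of M] sum_3)
    finally show "\<alpha>\<^sup>2 + \<beta>\<^sup>2 \<le> (norm B)\<^sup>2 * (norm M)\<^sup>2" .
  qed simp
  finally show "(q $ 2 * (B \<bullet> M $ 1) - q $ 1 * (B \<bullet> M $ 2))\<^sup>2 \<le> (norm q * (norm B * norm M))\<^sup>2"
    by (simp add: \<alpha>_def \<beta>_def power_mult_distrib)
qed simp

section \<open>Poincare and stretching estimates for the magnetic field\<close>

context inertialess_instant
begin

lemma GB_eq: "GB = integral (V Lx Ly) (\<lambda>x. (norm (Grad B x))\<^sup>2)"
  using integral_norm_Grad[of B] C1_b by (simp add: GB_def b_def[abs_def])

lemma C1_grad_xy: "C1 (\<lambda>x. grad_xy \<phi> x $ i)"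
  using exhaust_2[of i] C1_pd_\<phi> by (auto simp: grad_xy_def)

lemma GV_eq: "GV = integral (V Lx Ly) (\<lambda>x. (norm (Grad (grad_xy \<phi>) x))\<^sup>2)"
proof -
  have "(pd j (v 1) x)\<^sup>2 = (pd j (pd 2 \<phi>) x)\<^sup>2" if "x \<in> slab" for x j
    using pd_minus[OF C1_pd_\<phi>[of 2] that] by (simp add: v_def[abs_def])
  then have "integral (V Lx Ly) (\<lambda>x. (pd j (v 1) x)\<^sup>2) = integral (V Lx Ly) (\<lambda>x. (pd j (pd 2 \<phi>) x)\<^sup>2)" for j
    by (rule integral_V_cong)
  then have "grad_energy Lx Ly (v 1) = grad_energy Lx Ly (pd 2 \<phi>)" by (simp add: grad_energy_def)
  moreover have "v 2 = pd 1 \<phi>" by (auto simp: v_def)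
  ultimately show ?thesis
    unfolding integral_norm_Grad[OF C1_grad_xy] by (simp add: GV_def sum_2 grad_xy_def)
qed

context
  assumes flux: "integral {0..Lx} (\<lambda>x. integral {0..Ly} (\<lambda>y. B (vec3 x y 0) $ 3)) = 0"
begin

text \<open>Two mechanisms: \<open>b 1\<close> and \<open>b 2\<close> vanish on the walls, which
  gives the constant \<open>1 / pi\<close>; \<open>b 3\<close> has mean zero on every horizontal
  slice, by exact flux and zero divergence, which gives the horizontal constants.
  \<open>lambda1\<close> is the worst case.\<close>

lemma Poincare_b: "integral (V Lx Ly) (\<lambda>x. (b i x)\<^sup>2) \<le> (C_P Lx Ly)\<^sup>2 * grad_energy Lx Ly (b i)"
proof -
  have n: "0 \<le> integral (V Lx Ly) (\<lambda>x. (pd j (b i) x)\<^sup>2)" for j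
    by (intro integral_V_nonneg continuous_intros cont) simp
  note lam = lambda1_bounds[OF L]
  show ?thesis
  proof (cases "i = 3")
    case False
    then have "b i (vec3 x y 0) = 0" "b i (vec3 x y 1) = 0" for x y using exhaust_3[of i] wall_b12 by auto
    then have "integral (V Lx Ly) (\<lambda>x. (b i x)\<^sup>2) \<le> (1 / pi)\<^sup>2 * integral (V Lx Ly) (\<lambda>x. (pd 3 (b i) x)\<^sup>2)"
      by (intro Poincare_vertical C1_b)
    also have "\<dots> \<le> (C_P Lx Ly)\<^sup>2 * grad_energy Lx Ly (b i)"
      unfolding C_P_def using lam n by (intro mult_mono power_mono divide_left_mono) (auto simp: grad_energy_def sum_3)
    finally show ?thesis .
  next
    case True
    have "integral {0..Lx} (\<lambda>x. integral {0..Ly} (\<lambda>y. b 3 (vec3 x y z))) = 0" if "z \<in> {0..1}" for z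
      using slice_flux_constant[OF smooth_on_slab_C1[OF smooth(2)] periodic(2) L divergence(2) that] flux by (simp add: b_def)
    then have "integral (V Lx Ly) (\<lambda>x. (b 3 x)\<^sup>2) \<le> (1 / lambda1 Lx Ly)\<^sup>2 * integral (V Lx Ly) (\<lambda>x. (pd 1 (b 3) x)\<^sup>2 + (pd 2 (b 3) x)\<^sup>2)"
      by (intro Poincare_horizontal C1_b per_b L)
    also have "\<dots> \<le> (C_P Lx Ly)\<^sup>2 * grad_energy Lx Ly (b 3)"
      unfolding C_P_def using n True
      by (intro mult_left_mono) (auto simp: grad_energy_def sum_3 integral_V_add continuous_intros cont)
    finally show ?thesis using True by simp
  qed
qed

lemma Poincare_B: "integral (V Lx Ly) (\<lambda>x. (norm (B x))\<^sup>2) \<le> (C_P Lx Ly)\<^sup>2 * GB"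
proof -
  have "integral (V Lx Ly) (\<lambda>x. (norm (B x))\<^sup>2) = integral (V Lx Ly) (\<lambda>x. \<Sum>i\<in>UNIV. (b i x)\<^sup>2)"
    unfolding power2_norm_eq_inner inner_vec_def by (simp add: b_def power2_eq_square)
  also have "\<dots> = (\<Sum>i\<in>UNIV. integral (V Lx Ly) (\<lambda>x. (b i x)\<^sup>2))"
    by (rule integral_V_sum) (auto intro!: continuous_intros cont)
  also have "\<dots> \<le> (\<Sum>i\<in>UNIV. (C_P Lx Ly)\<^sup>2 * grad_energy Lx Ly (b i))"
    by (rule sum_mono[OF Poincare_b])
  finally show ?thesis by (simp add: GB_def sum_distrib_left)
qed

lemma stretching_le:
  assumes p: "3 \<le> p" and GB: "0 < GB"
  shows "- stretching \<le> A_const p Lx Ly * Lp_norm p (V Lx Ly) (grad_xy \<phi>) * GB"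
proof -
  have cB: "continuous_on slab B" by (rule C1_continuous[OF smooth_on_slab_C1[OF smooth(2)]])
  have cG: "continuous_on slab (Grad B)"
    using continuous_on_Grad[of B] C1_b by (simp add: b_def[abs_def])
  have cq: "continuous_on slab (grad_xy \<phi>)" by (rule continuous_on_grad_xy[OF C1_\<phi>])
  have "- stretching = integral (V Lx Ly) (\<lambda>x. - (\<Sum>j\<in>UNIV. b j x * (v 1 x * pd j (b 1) x + v 2 x * pd j (b 2) x)))"
    by (simp add: stretching_def)
  also have "\<dots> \<le> integral (V Lx Ly) (\<lambda>x. norm (grad_xy \<phi> x) * (norm (B x) * norm (Grad B x)))"
  proof (rule integral_V_mono)
    fix x assume "x \<in> slab"
    have "- (\<Sum>j\<in>UNIV. b j x * (v 1 x * pd j (b 1) x + v 2 x * pd j (b 2) x))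
      = grad_xy \<phi> x $ 2 * (B x \<bullet> Grad B x $ 1) - grad_xy \<phi> x $ 1 * (B x \<bullet> Grad B x $ 2)"
      by (simp add: v_def grad_xy_def Grad_def inner_vec_def sum_3 b_def[abs_def] algebra_simps)
    also have "\<dots> \<le> norm (grad_xy \<phi> x) * (norm (B x) * norm (Grad B x))" by (rule trilinear_pointwise)
    finally show "- (\<Sum>j\<in>UNIV. b j x * (v 1 x * pd j (b 1) x + v 2 x * pd j (b 2) x))
      \<le> norm (grad_xy \<phi> x) * (norm (B x) * norm (Grad B x))" .
  qed (intro continuous_intros cont cB cG cq)+
  also have "\<dots> \<le> A_const p Lx Ly * Lp_norm p (V Lx Ly) (grad_xy \<phi>) * (sqrt GB)\<^sup>2"
  proof (rule trilinear_bound[OF L p cq])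
    show "integral (V Lx Ly) (\<lambda>x. (norm (Grad B x))\<^sup>2) = (sqrt GB)\<^sup>2" using GB GB_eq by simp
    show "integral (V Lx Ly) (\<lambda>x. (norm (B x))\<^sup>2) \<le> (C_P Lx Ly * sqrt GB)\<^sup>2"
      using Poincare_B GB by (simp add: power_mult_distrib)
    have "integral (V Lx Ly) (\<lambda>x. norm (B x) ^ 6) \<le> ((C_S Lx Ly)\<^sup>2 * (\<Sum>i\<in>UNIV. grad_energy Lx Ly (\<lambda>x. B x $ i))) ^ 3"
      using Poincare_b by (intro vector_Sobolev_L6 smooth_on_slab_C1 smooth periodic L) (simp add: b_def[abs_def])
    then show "integral (V Lx Ly) (\<lambda>x. norm (B x) ^ 6) \<le> ((C_S Lx Ly)\<^sup>2 * (sqrt GB)\<^sup>2) ^ 3"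
      using GB by (simp add: GB_def b_def[abs_def])
  qed (use GB in \<open>auto intro!: continuous_intros cB cG\<close>)
  finally show ?thesis using GB by simp
qed

end

end

text \<open>The bottom wall is enough, because \<open>slice_flux_constant\<close> carries the value
  to every height.\<close>

lemma flux_exact_bottom:
  assumes B: "continuous_on slab B" and flux: "flux_exact Lx Ly B"
  shows "integral {0..Lx} (\<lambda>x. integral {0..Ly} (\<lambda>y. B (vec3 x y 0) $ 3)) = 0"
proof -
  let ?f = "\<lambda>p. - e_z \<bullet> B (vec3 (fst p) (snd p) 0)"
  have c3: "continuous_on slab (\<lambda>x. - e_z \<bullet> B x)" by (intro continuous_intros B)
  have c: "continuous_on (cbox (0, 0) (Lx, Ly)) ?f"
    by (rule continuous_on_vec3_slab[OF c3]) (auto intro!: continuous_intros)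
  have D: "{0..Lx} \<times> {0..Ly} = cbox (0, 0) (Lx, Ly)" by (simp only: cbox_Pair_eq cbox_interval[where 'a=real])
  have "0 = integral\<^sup>L (lebesgue_on ({0..Lx} \<times> {0..Ly})) ?f"
    using flux unfolding flux_exact_def case_prod_unfold by simp
  also have "\<dots> = integral (cbox (0, 0) (Lx, Ly)) ?f"
    unfolding D by (rule integral_lebesgue_on_cbox(1)[OF c])
  also have "\<dots> = integral (cbox 0 Lx) (\<lambda>x. integral (cbox 0 Ly) (\<lambda>y. - e_z \<bullet> B (vec3 x y 0)))"
    using integral_prod_continuous[OF c] by simp
  also have "\<dots> = - integral {0..Lx} (\<lambda>x. integral {0..Ly} (\<lambda>y. B (vec3 x y 0) $ 3))"
    by (simp add: inner_axis')
  finally show ?thesis by simp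
qed

theorem theorem3p9:
  fixes Lx Ly Ek \<Lambda> Ra Rm Pe T_minus T_plus \<gamma> t :: real
    and Q :: "real^3 \<Rightarrow> real"
    and I :: "real set"
    and u B :: "real \<Rightarrow> real^3 \<Rightarrow> real^3"
    and P T :: "real \<Rightarrow> real^3 \<Rightarrow> real"
    and p :: ereal
  assumes "Lx > 0" and "Ly > 0"
    and "Ek > 0" and "\<Lambda> > 0" and "Ra > 0" and "Rm > 0" and "Pe > 0"
    and "viscous_inertialess_solution Lx Ly Ek \<Lambda> Ra Rm Pe Q T_minus T_plus I u B P T"
    and "\<forall>s\<in>I. flux_exact Lx Ly (B s)"
    and "3 \<le> p"
    and "0 < \<gamma>" and "\<gamma> < 1"
    and "t \<in> I"
    and "\<exists>x\<in>V Lx Ly. B t x \<noteq> 0"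
    and "dynamo_action_at Lx Ly I B t"
  shows "Ra * A_const p Lx Ly * Lp_norm p (V Lx Ly) (grad_xy (Tbar (T t)))
           + Ra\<^sup>2 * Ek powr (1 - \<gamma>) * (Lp_norm 2 (V Lx Ly) (Grad (grad_xy (Tbar (T t)))))\<^sup>2
           \<ge> 1 / Rm
         \<or> 4 * \<Lambda> * integral\<^sup>L (lebesgue_on (V Lx Ly)) (\<lambda>x. (norm (Grad (B t) x))\<^sup>2) \<le> Ek powr \<gamma>"
proof -
  note sol = assms(8)[unfolded viscous_inertialess_solution_def]
  note t = \<open>t \<in> I\<close>
  have I: "is_interval I" "interior I \<noteq> {}" using sol by blast+
  have smoothB: "smooth_on (I \<times> slab) (\<lambda>(t, x). B t x)" using sol by blast
  have wall: "u t (vec3 x y z) $ 3 = 0 \<and> curl (u t) (vec3 x y z) $ 1 = 0 \<and> curl (u t) (vec3 x y z) $ 2 = 0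
      \<and> B t (vec3 x y z) $ 1 = 0 \<and> B t (vec3 x y z) $ 2 = 0" if z: "z = 0 \<or> z = 1" for x y z
  proof -
    \<comment> \<open>The conditions on \<open>u\<close> and \<open>B\<close> are the same for a
      normal and its opposite, so both walls are handled together.\<close>
    have "\<exists>n Tb. (n = e_z \<or> n = - e_z) \<and> bc_at n Tb (u t) (B t) (T t) (vec3 x y z)"
      using z sol t vector_3(3)[of x y z] by metis
    then show ?thesis
      by (auto simp: bc_at_def cross3_def vec_eq_iff forall_3 inner_vec_def sum_3 axis_def)
  qed
  interpret inertialess_instant Lx Ly Ek \<Lambda> Ra "u t" "B t" "P t" "T t"
  proof
    show "smooth_on slab (u t)" "smooth_on slab (B t)" "smooth_on slab (P t)" "smooth_on slab (T t)"
      using sol t by (blast intro: smooth_on_slice)+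
    show "xy_periodic Lx Ly (u t)" "xy_periodic Lx Ly (B t)" "xy_periodic Lx Ly (P t)" "xy_periodic Lx Ly (T t)"
      using sol t by blast+
    show "cross3 e_z (u t x) + grad (P t) x - Ek *\<^sub>R lap (u t) x = \<Lambda> *\<^sub>R cross3 (curl (B t) x) (B t x) + (Ra * T t x) *\<^sub>R e_z"
      "dive (u t) x = 0" "dive (B t) x = 0" if "x \<in> slab" for x
      using sol t that by blast+
  qed (use assms wall in auto)
  have cB: "continuous_on slab (B t)" by (rule C1_continuous[OF smooth_on_slab_C1[OF smooth(2)]])
  have flux: "integral {0..Lx} (\<lambda>x. integral {0..Ly} (\<lambda>y. B t (vec3 x y 0) $ 3)) = 0"
    by (rule flux_exact_bottom[OF cB]) (use assms in blast)
  \<comment> \<open>A continuous field that is nonzero somewhere has positive energy, and the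
    Poincare inequality passes positivity on to its gradient.\<close>
  have GB: "0 < GB"
  proof -
    have c: "continuous_on slab (\<lambda>x. (norm (B t x))\<^sup>2)" by (intro continuous_intros cB)
    have "integral (V Lx Ly) (\<lambda>x. (norm (B t x))\<^sup>2) \<noteq> 0"
    proof
      assume "integral (V Lx Ly) (\<lambda>x. (norm (B t x))\<^sup>2) = 0"
      then have "\<forall>x\<in>V Lx Ly. (norm (B t x))\<^sup>2 = 0"
        using integral_cbox_eq_0_iff[OF continuous_on_subset[OF c] box_V_nonempty[OF L]] V_subset_slab
        unfolding V_cbox by (metis zero_le_power2)
      then show False using assms by auto
    qed
    moreover have "0 \<le> integral (V Lx Ly) (\<lambda>x. (norm (B t x))\<^sup>2)" by (rule integral_V_nonneg[OF c]) simp
    ultimately have "0 < (C_P Lx Ly)\<^sup>2 * GB" using Poincare_B[OF flux] by linarith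
    then show ?thesis using C_P_pos[OF L] by (simp add: zero_less_mult_iff)
  qed
  have growth: "0 \<le> - lorentz_work - 1 / Rm * GB"
  proof -
    obtain D where D: "D \<ge> 0" "((\<lambda>s. magnetic_energy Lx Ly (B s)) has_real_derivative D) (at t within I)"
      using assms(15) by (auto simp: dynamo_action_at_def)
    \<comment> \<open>The derivative granted by the growth hypothesis equals the computed one, since
      derivatives within \<open>I\<close> are unique.\<close>
    have "D = integral (V Lx Ly) (\<lambda>x. B t x \<bullet> dt I (\<lambda>s. B s x) t)"
      using vector_derivative_unique_within[OF is_interval_at_within_neq_bot[OF I t]]
        D(2) magnetic_energy_has_derivative[OF smoothB I t, of Lx Ly]
      unfolding has_real_derivative_iff_has_vector_derivative by blast
    also have "\<dots> = integral (V Lx Ly) (\<lambda>x. B t x \<bullet> curl (\<lambda>y. cross3 (u t y) (B t y)) x + 1 / Rm * (B t x \<bullet> lap (B t) x))"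
    proof (rule integral_V_cong)
      fix x assume "x \<in> slab"
      then have "dt I (\<lambda>s. B s x) t - curl (\<lambda>y. cross3 (u t y) (B t y)) x = (1 / Rm) *\<^sub>R lap (B t) x"
        using sol t by blast
      then have "dt I (\<lambda>s. B s x) t = curl (\<lambda>y. cross3 (u t y) (B t y)) x + (1 / Rm) *\<^sub>R lap (B t) x"
        by (simp add: diff_eq_eq add.commute)
      then show "B t x \<bullet> dt I (\<lambda>s. B s x) t = B t x \<bullet> curl (\<lambda>y. cross3 (u t y) (B t y)) x + 1 / Rm * (B t x \<bullet> lap (B t) x)"
        by (simp add: inner_add_right)
    qed
    also have "\<dots> = integral (V Lx Ly) (\<lambda>x. B t x \<bullet> curl (\<lambda>y. cross3 (u t y) (B t y)) x) + integral (V Lx Ly) (\<lambda>x. 1 / Rm * (B t x \<bullet> lap (B t) x))"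
      by (intro integral_V_add continuous_curl_emf continuous_intros cB continuous_lap_B)
    also have "\<dots> = - lorentz_work - 1 / Rm * GB"
      by (simp add: induction_balance B_lap)
    finally show ?thesis using D(1) by simp
  qed
  define X where "X = A_const p Lx Ly * Lp_norm p (V Lx Ly) (grad_xy (Tbar (T t)))"
  have main: "1 / Rm * GB \<le> Ra * X * GB + Ra\<^sup>2 * Ek / (4 * \<Lambda>) * GV"
  proof -
    have "Ra * (- stretching) \<le> Ra * (X * GB)"
      using stretching_le[OF flux \<open>3 \<le> p\<close> GB] \<open>Ra > 0\<close> unfolding X_def \<phi>_def by (intro mult_left_mono) auto
    then show ?thesis using dynamo_inequality[OF \<open>\<Lambda> > 0\<close> \<open>Ek > 0\<close> growth] by (simp add: mult.assoc)
  qed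
  have GV: "(Lp_norm 2 (V Lx Ly) (Grad (grad_xy (Tbar (T t)))))\<^sup>2 = GV"
    using Lp_norm_2_squared[OF continuous_on_Grad[OF C1_grad_xy], of Lx Ly] by (simp add: GV_eq \<phi>_def)
  have GV0: "0 \<le> GV" unfolding GV_def by (intro add_nonneg_nonneg grad_energy_nonneg C1_v)
  have GBL: "integral\<^sup>L (lebesgue_on (V Lx Ly)) (\<lambda>x. (norm (Grad (B t) x))\<^sup>2) = GB"
    unfolding GB_eq using continuous_on_Grad[of "B t"] C1_b
    by (intro integral_lebesgue_V continuous_intros) (simp add: b_def[abs_def])
  show ?thesis
  proof (cases "4 * \<Lambda> * GB \<le> Ek powr \<gamma>")
    case False
    have "Ek = Ek powr (1 - \<gamma>) * Ek powr \<gamma>" using \<open>Ek > 0\<close> by (simp add: powr_add[symmetric])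
    also have "\<dots> \<le> Ek powr (1 - \<gamma>) * (4 * \<Lambda> * GB)" using False by (intro mult_left_mono) auto
    finally have "Ek / (4 * \<Lambda>) \<le> Ek powr (1 - \<gamma>) * GB" using \<open>\<Lambda> > 0\<close> by (simp add: field_simps)
    then have "Ra\<^sup>2 * GV * (Ek / (4 * \<Lambda>)) \<le> Ra\<^sup>2 * GV * (Ek powr (1 - \<gamma>) * GB)"
      using GV0 by (intro mult_left_mono) auto
    then have "1 / Rm * GB \<le> (Ra * X + Ra\<^sup>2 * Ek powr (1 - \<gamma>) * GV) * GB"
      using main by (simp add: algebra_simps)
    then have "1 / Rm \<le> Ra * X + Ra\<^sup>2 * Ek powr (1 - \<gamma>) * GV" using GB by (simp only: mult_le_cancel_right_pos)
    then show ?thesis unfolding GV X_def by (simp add: mult.assoc)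
  qed (simp add: GBL)
qed

end
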